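(* Assume the Ultrapower Axiom. Then the seed order is transitive: for all uniform ultrafilters \(U_0, U_1, U_2\), if \(U_0 \leq_S U_1\) and \(U_1 \leq_S U_2\), then \(U_0 \leq_S U_2\).
   Context: Work in ZFC. For a countably complete ultrafilter \(U\), \(j_U : V \to \mathrm{Ult}(V,U)\) denotes its ultrapower embedding and \([\mathrm{id}]_U\) its seed. A comparison of \(\langle U_0,U_1\rangle\) by internal ultrafilters is a pair \(\langle W_0,W_1\rangle\) such that \(W_0 \in \mathrm{Ult}(V,U_0)\) and \(W_1 \in \mathrm{Ult}(V,U_1)\); \(\mathrm{Ult}(V,U_0)\) satisfies that \(W_0\) is a countably complete ultrafilter and \(\mathrm{Ult}(V,U_1)\) satisfies that \(W_1\) is a countably complete ultrafilter; \(\mathrm{Ult}(\mathrm{Ult}(V,U_0),W_0) = \mathrm{Ult}(\mathrm{Ult}(V,U_1),W_1)\); and \(j_{W_0}\circ j_{U_0} = j_{W_1}\circ j_{U_1}\). The Ultrapower Axiom is the statement that every pair of countably complete ultrafilters admits a comparison by internal ultrafilters. An ultrafilter \(U\) is uniform if it is a countably complete ultrafilter on \([\kappa]^n\) for some ordinal \(\kappa\) and natural number \(n\), with \(\kappa\) the least ordinal such that \([\kappa]^n \in U\). Finite sets of ordinals are ordered by: \(a < b\) iff the largest element of \(a \cup b\) not in \(a \cap b\) lies in \(b\). The seed order is defined on uniform ultrafilters by \(U_0 \leq_S U_1\) iff there is a comparison \(\langle W_0,W_1\rangle\) of \(\langle U_0,U_1\rangle\) by internal ultrafilters such that \(j_{W_0}([\mathrm{id}]_{U_0})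 \leq j_{W_1}([\mathrm{id}]_{U_1})\). *)

theory Defs
  imports Main
begin

text \<open>
  Working in ZFC is rendered as working in an arbitrary model of first-order ZFC: a carrier
  \<open>V\<close> with a binary relation \<open>\<epsilon>\<close>, not assumed well-founded from outside. A class \<open>M\<close> (\<open>V\<close> itself
  or an inner model such as an ultrapower) is a HOL set with the same \<open>\<epsilon>\<close>. In each notion
  below that takes \<open>M\<close>, all set-theoretic quantifiers are bounded by \<open>M\<close>, so that \<open>P M x\<close>
  says that \<open>(M, \<epsilon>)\<close> satisfies \<open>P x\<close>.
\<close>

datatype fm = FMem nat nat | FEq nat nat | FNeg fm | FConj fm fm | FAll nat fm

locale set_structure =
  fixes E :: "'v \<Rightarrow> 'v \<Rightarrow> bool"  (infix \<open>\<epsilon>\<close> 50)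
begin

primrec sat :: "'v set \<Rightarrow> fm \<Rightarrow> (nat \<Rightarrow> 'v) \<Rightarrow> bool" where
  "sat M (FMem i j) s \<longleftrightarrow> s i \<epsilon> s j"
| "sat M (FEq i j) s \<longleftrightarrow> s i = s j"
| "sat M (FNeg p) s \<longleftrightarrow> \<not> sat M p s"
| "sat M (FConj p q) s \<longleftrightarrow> sat M p s \<and> sat M q s"
| "sat M (FAll i p) s \<longleftrightarrow> (\<forall>a\<in>M. sat M p (s(i := a)))"

definition ext :: "'v set \<Rightarrow> 'v \<Rightarrow> 'v set" where
  "ext M x = {y \<in> M. y \<epsilon> x}"


subsection \<open>The axioms of ZFC\<close>

definition extensionality :: "'v set \<Rightarrow> bool" where
  "extensionality M \<longleftrightarrow> (\<forall>x\<in>M. \<forall>y\<in>M. ext M x = ext M y \<longrightarrow> x = y)"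

definition foundation :: "'v set \<Rightarrow> bool" where
  "foundation M \<longleftrightarrow>
     (\<forall>x\<in>M. ext M x \<noteq> {} \<longrightarrow> (\<exists>y\<in>ext M x. ext M y \<inter> ext M x = {}))"

definition pairing :: "'v set \<Rightarrow> bool" where
  "pairing M \<longleftrightarrow> (\<forall>a\<in>M. \<forall>b\<in>M. \<exists>c\<in>M. ext M c = {a, b})"

definition union_axiom :: "'v set \<Rightarrow> bool" where
  "union_axiom M \<longleftrightarrow> (\<forall>a\<in>M. \<exists>u\<in>M. ext M u = (\<Union>x\<in>ext M a. ext M x))"

definition power_set :: "'v set \<Rightarrow> bool" where
  "power_set M \<longleftrightarrow> (\<forall>a\<in>M. \<exists>p\<in>M. ext M p = {x \<in> M. ext M x \<subseteq> ext M a})"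

definition infinity :: "'v set \<Rightarrow> bool" where
  "infinity M \<longleftrightarrow>
     (\<exists>a\<in>M. (\<exists>z\<in>ext M a. ext M z = {}) \<and>
        (\<forall>x\<in>ext M a. \<exists>y\<in>ext M a. ext M y = insert x (ext M x)))"

definition separation :: "'v set \<Rightarrow> bool" where
  "separation M \<longleftrightarrow>
     (\<forall>p s. range s \<subseteq> M \<longrightarrow>
        (\<forall>a\<in>M. \<exists>b\<in>M. ext M b = {x \<in> ext M a. sat M p (s(0 := x))}))"

definition replacement :: "'v set \<Rightarrow> bool" where
  "replacement M \<longleftrightarrow>
     (\<forall>p s. range s \<subseteq> M \<longrightarrow>
        (\<forall>a\<in>M.
           (\<forall>x\<in>ext M a. \<forall>y\<in>M. \<forall>y'\<in>M.
              sat M p (s(0 := x, 1 := y)) \<longrightarrow> sat M p (s(0 := x, 1 := y')) \<longrightarrow> y = y') \<longrightarrow>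
           (\<exists>b\<in>M. ext M b = {y \<in> M. \<exists>x\<in>ext M a. sat M p (s(0 := x, 1 := y))})))"

definition choice :: "'v set \<Rightarrow> bool" where
  "choice M \<longleftrightarrow>
     (\<forall>a\<in>M.
        (\<forall>x\<in>ext M a. ext M x \<noteq> {}) \<longrightarrow>
        (\<forall>x\<in>ext M a. \<forall>y\<in>ext M a. x \<noteq> y \<longrightarrow> ext M x \<inter> ext M y = {}) \<longrightarrow>
        (\<exists>c\<in>M. \<forall>x\<in>ext M a. \<exists>!z. z \<in> ext M c \<inter> ext M x))"

definition ZFC :: "'v set \<Rightarrow> bool" where
  "ZFC M \<longleftrightarrow>
     extensionality M \<and> foundation M \<and> pairing M \<and> union_axiom M \<and> power_set M \<and>
     infinity M \<and> separation M \<and> replacement M \<and> choice M"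


subsection \<open>Functions, ordinals, natural numbers\<close>

definition is_opair :: "'v set \<Rightarrow> 'v \<Rightarrow> 'v \<Rightarrow> 'v \<Rightarrow> bool" where
  "is_opair M p a b \<longleftrightarrow>
     (\<exists>u\<in>M. \<exists>v\<in>M. ext M u = {a} \<and> ext M v = {a, b} \<and> ext M p = {u, v})"

definition maps_to :: "'v set \<Rightarrow> 'v \<Rightarrow> 'v \<Rightarrow> 'v \<Rightarrow> bool" where
  "maps_to M f x y \<longleftrightarrow> (\<exists>p\<in>ext M f. is_opair M p x y)"

definition is_fun :: "'v set \<Rightarrow> 'v \<Rightarrow> 'v \<Rightarrow> bool" where
  "is_fun M f X \<longleftrightarrow>
     f \<in> M \<and> (\<forall>p\<in>ext M f. \<exists>x\<in>ext M X. \<exists>y\<in>M. is_opair M p x y) \<and>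
     (\<forall>x\<in>ext M X. \<exists>!y. y \<in> M \<and> maps_to M f x y)"

definition app :: "'v set \<Rightarrow> 'v \<Rightarrow> 'v \<Rightarrow> 'v" where
  "app M f x = (THE y. y \<in> M \<and> maps_to M f x y)"

definition trans_set :: "'v set \<Rightarrow> 'v \<Rightarrow> bool" where
  "trans_set M x \<longleftrightarrow> (\<forall>y\<in>ext M x. ext M y \<subseteq> ext M x)"

text \<open>In the presence of foundation, a transitive set of transitive sets is an ordinal.\<close>

definition ordinal :: "'v set \<Rightarrow> 'v \<Rightarrow> bool" where
  "ordinal M a \<longleftrightarrow> a \<in> M \<and> trans_set M a \<and> (\<forall>y\<in>ext M a. trans_set M y)"

text \<open>The natural numbers are those of the model: ordinals with no limit ordinal below or
  equal to them.\<close>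

definition natural :: "'v set \<Rightarrow> 'v \<Rightarrow> bool" where
  "natural M n \<longleftrightarrow>
     ordinal M n \<and>
     (\<forall>m\<in>insert n (ext M n). ext M m = {} \<or> (\<exists>k\<in>M. ext M m = insert k (ext M k)))"

definition omega :: "'v set \<Rightarrow> 'v" where
  "omega M = (THE w. w \<in> M \<and> ext M w = {n. natural M n})"


subsection \<open>Countably complete ultrafilters\<close>

definition cc_ultrafilter_on :: "'v set \<Rightarrow> 'v \<Rightarrow> 'v \<Rightarrow> bool" where
  "cc_ultrafilter_on M U X \<longleftrightarrow>
     U \<in> M \<and> X \<in> M \<and>
     (\<forall>A\<in>ext M U. ext M A \<subseteq> ext M X) \<and>
     X \<in> ext M U \<and>
     (\<forall>A\<in>ext M U. ext M A \<noteq> {}) \<and>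
     (\<forall>A\<in>ext M U. \<forall>B\<in>M. ext M A \<subseteq> ext M B \<and> ext M B \<subseteq> ext M X \<longrightarrow> B \<in> ext M U) \<and>
     (\<forall>A\<in>M. ext M A \<subseteq> ext M X \<longrightarrow>
        A \<in> ext M U \<or> (\<exists>B\<in>ext M U. ext M B = ext M X - ext M A)) \<and>
     (\<forall>F. is_fun M F (omega M) \<and> (\<forall>n\<in>ext M (omega M). app M F n \<in> ext M U) \<longrightarrow>
        (\<exists>B\<in>ext M U. ext M B = (\<Inter>n\<in>ext M (omega M). ext M (app M F n))))"

definition cc_ultrafilter :: "'v set \<Rightarrow> 'v \<Rightarrow> bool" where
  "cc_ultrafilter M U \<longleftrightarrow> (\<exists>X. cc_ultrafilter_on M U X)"


subsection \<open>Ultrapowers\<close>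

text \<open>The set on which an ultrafilter lives is recovered as its union.\<close>

definition underlying :: "'v set \<Rightarrow> 'v \<Rightarrow> 'v" where
  "underlying M U = (THE X. X \<in> M \<and> ext M X = (\<Union>A\<in>ext M U. ext M A))"

definition ufuns :: "'v set \<Rightarrow> 'v \<Rightarrow> 'v set" where
  "ufuns M U = {f. is_fun M f (underlying M U)}"

definition ult_eq :: "'v set \<Rightarrow> 'v \<Rightarrow> 'v \<Rightarrow> 'v \<Rightarrow> bool" where
  "ult_eq M U f g \<longleftrightarrow>
     (\<exists>A\<in>ext M U. ext M A = {x \<in> ext M (underlying M U). app M f x = app M g x})"

definition ult_mem :: "'v set \<Rightarrow> 'v \<Rightarrow> 'v \<Rightarrow> 'v \<Rightarrow> bool" where
  "ult_mem M U f g \<longleftrightarrow>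
     (\<exists>A\<in>ext M U. ext M A = {x \<in> ext M (underlying M U). app M f x \<epsilon> app M g x})"

text \<open>
  As usual, the ultrapower of \<open>M\<close> by \<open>U\<close> (formed with the functions in \<open>M\<close>) is identified with its
  transitive collapse. The collapse \<open>f \<mapsto> [f]\<close> satisfies \<open>[g] = {[f] | f \<in>\<^sub>U g}\<close>, a recursion that
  has to be carried out inside \<open>M\<close>: its attempts \<open>h\<close> are functions in \<open>M\<close> whose domain \<open>D\<close> is a set
  of functions containing, up to \<open>=\<^sub>U\<close>, all \<open>\<in>\<^sub>U\<close>-predecessors of its members.
\<close>

definition collapse_attempt :: "'v set \<Rightarrow> 'v \<Rightarrow> 'v \<Rightarrow> 'v \<Rightarrow> bool" where
  "collapse_attempt M U D h \<longleftrightarrow>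
     D \<in> M \<and> ext M D \<subseteq> ufuns M U \<and> is_fun M h D \<and>
     (\<forall>g\<in>ext M D. \<forall>f\<in>ufuns M U. ult_mem M U f g \<longrightarrow> (\<exists>f'\<in>ext M D. ult_eq M U f' f)) \<and>
     (\<forall>g\<in>ext M D. ext M (app M h g) = app M h ` {f \<in> ext M D. ult_mem M U f g})"

definition ult_class :: "'v set \<Rightarrow> 'v \<Rightarrow> 'v \<Rightarrow> 'v" where
  "ult_class M U f =
     (THE z. \<exists>D h. collapse_attempt M U D h \<and> f \<in> ext M D \<and> z = app M h f)"

definition Ult :: "'v set \<Rightarrow> 'v \<Rightarrow> 'v set" where
  "Ult M U = ult_class M U ` ufuns M U"

definition ult_emb :: "'v set \<Rightarrow> 'v \<Rightarrow> 'v \<Rightarrow> 'v" where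
  "ult_emb M U a =
     ult_class M U (THE c. c \<in> ufuns M U \<and> (\<forall>x\<in>ext M (underlying M U). app M c x = a))"

definition seed :: "'v set \<Rightarrow> 'v \<Rightarrow> 'v" where
  "seed M U =
     ult_class M U (THE i. i \<in> ufuns M U \<and> (\<forall>x\<in>ext M (underlying M U). app M i x = x))"


subsection \<open>Comparisons, the Ultrapower Axiom and the seed order\<close>

definition comparison :: "'v set \<Rightarrow> 'v \<Rightarrow> 'v \<Rightarrow> 'v \<Rightarrow> 'v \<Rightarrow> bool" where
  "comparison V U0 U1 W0 W1 \<longleftrightarrow>
     W0 \<in> Ult V U0 \<and> W1 \<in> Ult V U1 \<and>
     cc_ultrafilter (Ult V U0) W0 \<and> cc_ultrafilter (Ult V U1) W1 \<and>
     Ult (Ult V U0) W0 = Ult (Ult V U1) W1 \<and>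
     (\<forall>a\<in>V. ult_emb (Ult V U0) W0 (ult_emb V U0 a) = ult_emb (Ult V U1) W1 (ult_emb V U1 a))"

definition ultrapower_axiom :: "'v set \<Rightarrow> bool" where
  "ultrapower_axiom V \<longleftrightarrow>
     (\<forall>U0\<in>V. \<forall>U1\<in>V. cc_ultrafilter V U0 \<and> cc_ultrafilter V U1 \<longrightarrow>
        (\<exists>W0 W1. comparison V U0 U1 W0 W1))"

text \<open>\<open>S = [\<kappa>]\<^sup>n\<close>, the set of subsets of \<open>\<kappa>\<close> with exactly \<open>n\<close> elements.\<close>

definition is_nsubsets :: "'v set \<Rightarrow> 'v \<Rightarrow> 'v \<Rightarrow> 'v \<Rightarrow> bool" where
  "is_nsubsets M \<kappa> n S \<longleftrightarrow>
     S \<in> M \<and>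
     ext M S = {a \<in> M. ext M a \<subseteq> ext M \<kappa> \<and>
                  (\<exists>f. is_fun M f n \<and> bij_betw (app M f) (ext M n) (ext M a))}"

definition uniform_ultrafilter :: "'v set \<Rightarrow> 'v \<Rightarrow> bool" where
  "uniform_ultrafilter M U \<longleftrightarrow>
     (\<exists>\<kappa> n S. ordinal M \<kappa> \<and> natural M n \<and> is_nsubsets M \<kappa> n S \<and> cc_ultrafilter_on M U S \<and>
        (\<forall>\<alpha>\<in>ext M \<kappa>. \<forall>T. is_nsubsets M \<alpha> n T \<longrightarrow> T \<notin> ext M U))"

text \<open>The order on finite sets of ordinals: \<open>\<xi>\<close> is the largest element of \<open>a \<union> b\<close> not in \<open>a \<inter> b\<close>.\<close>

definition finset_less :: "'v set \<Rightarrow> 'v \<Rightarrow> 'v \<Rightarrow> bool" where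
  "finset_less M a b \<longleftrightarrow>
     (\<exists>\<xi> \<in> (ext M a \<union> ext M b) - (ext M a \<inter> ext M b).
        (\<forall>\<eta> \<in> (ext M a \<union> ext M b) - (ext M a \<inter> ext M b). \<eta> = \<xi> \<or> \<eta> \<epsilon> \<xi>) \<and> \<xi> \<in> ext M b)"

definition finset_le :: "'v set \<Rightarrow> 'v \<Rightarrow> 'v \<Rightarrow> bool" where
  "finset_le M a b \<longleftrightarrow> finset_less M a b \<or> a = b"

definition seed_le :: "'v set \<Rightarrow> 'v \<Rightarrow> 'v \<Rightarrow> bool" where
  "seed_le V U0 U1 \<longleftrightarrow>
     (\<exists>W0 W1. comparison V U0 U1 W0 W1 \<and>
        finset_le V (ult_emb (Ult V U0) W0 (seed V U0)) (ult_emb (Ult V U1) W1 (seed V U1)))"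

end

end

theory Submission
  imports Defs
begin

text \<open>
  Let \<open>(W\<^sub>0, W\<^sub>1)\<close> witness \<open>U\<^sub>0 \<le> U\<^sub>1\<close> and \<open>(W\<^sub>1', W\<^sub>2)\<close> witness \<open>U\<^sub>1 \<le> U\<^sub>2\<close>. The Ultrapower Axiom is
  first-order, since ultrapowers are uniformly definable over models of ZFC, so by Los's theorem
  it holds in \<open>Ult V U\<^sub>1\<close>, where it yields a comparison \<open>(Z, Z')\<close> of \<open>(W\<^sub>1, W\<^sub>1')\<close>. In \<open>Ult V U\<^sub>0\<close> the
  iterated ultrapower by \<open>W\<^sub>0\<close> and \<open>Z\<close> is the ultrapower by a single ultrafilter, and likewise in
  \<open>Ult V U\<^sub>2\<close> for \<open>W\<^sub>2\<close> and \<open>Z'\<close>; these two ultrafilters compare \<open>U\<^sub>0\<close> with \<open>U\<^sub>2\<close>. Applying \<open>j\<^sub>Z\<close> and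
  \<open>j\<^sub>Z\<^sub>'\<close> to the two given inequalities, which then share the middle term
  \<open>j\<^sub>Z (j\<^sub>W\<^sub>1 seed) = j\<^sub>Z\<^sub>' (j\<^sub>W\<^sub>1\<^sub>' seed)\<close>, gives the inequality of the images of the seeds.
\<close>

section \<open>Uniform definability\<close>

context set_structure
begin

text \<open>The model may be ill-founded from outside, and Separation and Replacement apply only to
  properties given by a formula. The calculus \<open>dfn\<close> yields its formulas uniformly in
  the structure, so one fact serves Separation, Los's theorem and the evaluation of a notion inside
  an ultrapower.

  That an iterated ultrapower is a single one is obtained without product ultrafilters. If an
  elementary embedding \<open>j\<close> into a transitive class is definable, adds no new element to
  the image of omega, and every element of the class is \<open>j(f)(t)\<close> for one fixed
  \<open>t\<close>, then the ultrafilter derived from \<open>t\<close> is countably complete and its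
  ultrapower is that class. For two steps, \<open>t\<close> pairs the image of the first seed with
  the second seed.

  The inequalities of seeds are stated in \<open>V\<close>, whereas the second-stage embeddings are
  elementary on intermediate models; absoluteness for transitive classes moves them down and up
  again.\<close>

lemma sat_finite_support:
  "\<exists>k. \<forall>M s s'. (\<forall>i<k. s i = s' i) \<longrightarrow> sat M p s = sat M p s'"
proof (induction p)
  case (FMem i j)
  show ?case by (rule exI[of _ "Suc (max i j)"]) auto
next
  case (FEq i j)
  show ?case by (rule exI[of _ "Suc (max i j)"]) auto
next
  case (FConj p q)
  then obtain k l where "\<forall>M s s'. (\<forall>i<k. s i = s' i) \<longrightarrow> sat M p s = sat M p s'"
    and "\<forall>M s s'. (\<forall>i<l. s i = s' i) \<longrightarrow> sat M q s = sat M q s'" by blast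
  then show ?case by (intro exI[of _ "max k l"]) (metis max.strict_coboundedI1 max.strict_coboundedI2 sat.simps(4))
next
  case (FAll i p)
  then obtain k where k: "\<And>M s s'. (\<forall>i<k. s i = s' i) \<Longrightarrow> sat M p s = sat M p s'" by blast
  show ?case
  proof (intro exI[of _ k] allI impI)
    fix M :: "'v set" and s s' assume "\<forall>i<k. s i = (s' i :: 'v)"
    then have "sat M p (s(i := a)) = sat M p (s'(i := a))" for a
      by (intro k) auto
    then show "sat M (FAll i p) s = sat M (FAll i p) s'" by simp
  qed
qed auto

text \<open>Under a quantifier the bound variable moves to an index \<open>j\<close> that
  \<open>\<pi>\<close> does not take on the finitely many variables that matter, so nothing is
  captured even if \<open>\<pi>\<close> is not injective. One formula \<open>q\<close> serves all
  structures, which keeps definability uniform.\<close>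

lemma sat_rename: "\<exists>q. \<forall>M s. sat M q s = sat M p (\<lambda>n. s (\<pi> n))"
proof (induction p arbitrary: \<pi>)
  case (FMem i j)
  show ?case by (rule exI[of _ "FMem (\<pi> i) (\<pi> j)"]) auto
next
  case (FEq i j)
  show ?case by (rule exI[of _ "FEq (\<pi> i) (\<pi> j)"]) auto
next
  case (FNeg p)
  then show ?case by (metis sat.simps(3))
next
  case (FConj p q)
  then show ?case by (metis sat.simps(4))
next
  case (FAll i p)
  obtain k where k: "\<And>M s s'. (\<forall>i<k. s i = s' i) \<Longrightarrow> sat M p s = sat M p s'"
    using sat_finite_support by blast
  obtain j where j: "j \<notin> \<pi> ` {..<k}"
    using ex_new_if_finite[of "\<pi> ` {..<k}"] infinite_UNIV_nat by blast
  obtain q where q: "\<And>M s. sat M q s = sat M p (\<lambda>n. s ((\<pi>(i := j)) n))"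
    using FAll by blast
  have "sat M q (s(j := a)) = sat M p ((\<lambda>n. s (\<pi> n))(i := a))" for M s a
    unfolding q by (rule k) (use j in auto)
  then show ?case by (intro exI[of _ "FAll j q"]) simp
qed

text \<open>
  \<open>dfn C A R\<close>: one formula, with parameters from \<open>A\<close>, defines \<open>R N\<close> over every \<open>N\<close> in the class \<open>C\<close> of
  structures. Environments are read as de Bruijn stacks: a quantifier pushes its value at index 0.
\<close>

definition tm :: "'v set \<Rightarrow> ((nat \<Rightarrow> 'v) \<Rightarrow> 'v) \<Rightarrow> bool" where
  "tm A \<tau> \<longleftrightarrow> (\<exists>i. \<tau> = (\<lambda>s. s i)) \<or> (\<exists>c\<in>A. \<tau> = (\<lambda>s. c))"

definition dfn :: "'v set set \<Rightarrow> 'v set \<Rightarrow> ('v set \<Rightarrow> (nat \<Rightarrow> 'v) \<Rightarrow> bool) \<Rightarrow> bool" where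
  "dfn C A R \<longleftrightarrow> (\<exists>p \<tau>. (\<forall>n. tm A (\<tau> n)) \<and>
     (\<forall>N\<in>C. A \<subseteq> N \<longrightarrow> (\<forall>s. range s \<subseteq> N \<longrightarrow> R N s = sat N p (\<lambda>n. \<tau> n s))))"

named_theorems dfn_intros

lemma tm_var [dfn_intros]: "tm A (\<lambda>s. s i)"
  and tm_const [dfn_intros]: "c \<in> A \<Longrightarrow> tm A (\<lambda>s. c)"
  unfolding tm_def by blast+

lemma tm_subst: "tm A x \<Longrightarrow> (\<And>n. tm A (v n)) \<Longrightarrow> tm A (\<lambda>s. x (\<lambda>n. v n s))"
  unfolding tm_def by auto

lemma tm_shift: "tm A x \<Longrightarrow> tm A (\<lambda>s. x (\<lambda>n. s (Suc n)))"
  by (erule tm_subst[where v = "\<lambda>n s. s (Suc n)"]) (rule tm_var)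

lemma tm_in: "tm A x \<Longrightarrow> A \<subseteq> N \<Longrightarrow> range s \<subseteq> N \<Longrightarrow> x s \<in> N"
  unfolding tm_def by auto

lemma dfnI:
  assumes "\<And>n. tm A (\<tau> n)"
    and "\<And>N s. N \<in> C \<Longrightarrow> A \<subseteq> N \<Longrightarrow> range s \<subseteq> N \<Longrightarrow> R N s = sat N p (\<lambda>n. \<tau> n s)"
  shows "dfn C A R"
  unfolding dfn_def using assms by blast

lemma dfnE:
  assumes "dfn C A R"
  obtains p \<tau> where "\<And>n. tm A (\<tau> n)"
    and "\<And>N s. N \<in> C \<Longrightarrow> A \<subseteq> N \<Longrightarrow> range s \<subseteq> N \<Longrightarrow> R N s = sat N p (\<lambda>n. \<tau> n s)"
proof -
  from assms obtain p \<tau> where "\<forall>n. tm A (\<tau> n)"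
    and "\<forall>N\<in>C. A \<subseteq> N \<longrightarrow> (\<forall>s. range s \<subseteq> N \<longrightarrow> R N s = sat N p (\<lambda>n. \<tau> n s))"
    unfolding dfn_def by (elim exE conjE)
  then show thesis by (intro that[of \<tau> p]) auto
qed

lemma dfn_cong:
  assumes "dfn C A R'"
    and "\<And>N s. N \<in> C \<Longrightarrow> A \<subseteq> N \<Longrightarrow> range s \<subseteq> N \<Longrightarrow> R N s = R' N s"
  shows "dfn C A R"
  using assms unfolding dfn_def by simp

lemma dfn_sat: "(\<And>n. tm A (v n)) \<Longrightarrow> dfn C A (\<lambda>N s. sat N p (\<lambda>n. v n s))"
  by (rule dfnI) auto

lemma dfn_subst:
  assumes "dfn C A R" and v: "\<And>n. tm A (v n)"
  shows "dfn C A (\<lambda>N s. R N (\<lambda>n. v n s))"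
proof -
  from assms(1) obtain p \<tau> where \<tau>: "\<And>n. tm A (\<tau> n)"
    and p: "\<And>N s. N \<in> C \<Longrightarrow> A \<subseteq> N \<Longrightarrow> range s \<subseteq> N \<Longrightarrow> R N s = sat N p (\<lambda>n. \<tau> n s)" by (rule dfnE) blast
  show ?thesis
  proof (rule dfnI[where \<tau> = "\<lambda>m s. \<tau> m (\<lambda>n. v n s)" and p = p])
    show "tm A (\<lambda>s. \<tau> m (\<lambda>n. v n s))" for m
      by (rule tm_subst[OF \<tau> v])
    show "R N (\<lambda>n. v n s) = sat N p (\<lambda>m. \<tau> m (\<lambda>n. v n s))"
      if "N \<in> C" "A \<subseteq> N" "range s \<subseteq> N" for N s
      using that tm_in[OF v] by (intro p) auto
  qed
qed

section \<open>Closure of definability under connectives and bounded quantifiers\<close>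

lemma dfn_mem [dfn_intros]: "tm A x \<Longrightarrow> tm A y \<Longrightarrow> dfn C A (\<lambda>N s. x s \<epsilon> y s)"
  by (rule dfnI[where \<tau> = "case_nat x (\<lambda>_. y)" and p = "FMem 0 1"]) (auto split: nat.split)

lemma dfn_eq [dfn_intros]: "tm A x \<Longrightarrow> tm A y \<Longrightarrow> dfn C A (\<lambda>N s. x s = y s)"
  by (rule dfnI[where \<tau> = "case_nat x (\<lambda>_. y)" and p = "FEq 0 1"]) (auto split: nat.split)

lemma dfn_not [dfn_intros]:
  assumes "dfn C A P" shows "dfn C A (\<lambda>N s. \<not> P N s)"
proof -
  from assms obtain p \<tau> where \<tau>: "\<And>n. tm A (\<tau> n)"
    and p: "\<And>N s. N \<in> C \<Longrightarrow> A \<subseteq> N \<Longrightarrow> range s \<subseteq> N \<Longrightarrow> P N s = sat N p (\<lambda>n. \<tau> n s)" by (rule dfnE) blast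
  show ?thesis by (rule dfnI[where \<tau> = \<tau> and p = "FNeg p"]) (auto simp: \<tau> p)
qed

text \<open>The two formulas come with unrelated readings \<open>\<tau>\<close> and
  \<open>\<sigma>\<close> of their variables. Renaming sends the variables of \<open>p\<close> to
  even and those of \<open>q\<close> to odd indices, so that a single interleaved reading serves
  both.\<close>

lemma dfn_conj [dfn_intros]:
  assumes "dfn C A P" and "dfn C A Q"
  shows "dfn C A (\<lambda>N s. P N s \<and> Q N s)"
proof -
  from assms(1) obtain p \<tau> where \<tau>: "\<And>n. tm A (\<tau> n)"
    and p: "\<And>N s. N \<in> C \<Longrightarrow> A \<subseteq> N \<Longrightarrow> range s \<subseteq> N \<Longrightarrow> P N s = sat N p (\<lambda>n. \<tau> n s)" by (rule dfnE) blast
  from assms(2) obtain q \<sigma> where \<sigma>: "\<And>n. tm A (\<sigma> n)"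
    and q: "\<And>N s. N \<in> C \<Longrightarrow> A \<subseteq> N \<Longrightarrow> range s \<subseteq> N \<Longrightarrow> Q N s = sat N q (\<lambda>n. \<sigma> n s)" by (rule dfnE) blast
  obtain p' where p': "\<And>M s. sat M p' s = sat M p (\<lambda>n. s (2 * n))" using sat_rename by meson
  obtain q' where q': "\<And>M s. sat M q' s = sat M q (\<lambda>n. s (2 * n + 1))" using sat_rename by meson
  show ?thesis
    by (rule dfnI[where \<tau> = "\<lambda>n. if even n then \<tau> (n div 2) else \<sigma> (n div 2)" and p = "FConj p' q'"])
      (auto simp: \<tau> \<sigma> p q p' q')
qed

lemma dfn_all [dfn_intros]:
  assumes "dfn C A (\<lambda>N s. P N (\<lambda>n. s (Suc n)) (s 0))"
  shows "dfn C A (\<lambda>N s. \<forall>a\<in>N. P N s a)"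
proof -
  from assms obtain p \<tau> where \<tau>: "\<And>n. tm A (\<tau> n)"
    and p: "\<And>N s. N \<in> C \<Longrightarrow> A \<subseteq> N \<Longrightarrow> range s \<subseteq> N \<Longrightarrow>
      P N (\<lambda>n. s (Suc n)) (s 0) = sat N p (\<lambda>n. \<tau> n s)" by (rule dfnE) blast
  \<comment> \<open>Every variable read as the top of the stack becomes the variable 0 bound by
    \<open>FAll 0 q\<close>; the others shift up by one. \<open>\<sigma>\<close> reads these from
    the outer stack, with \<open>s 0\<close> pushed to fill the place of the bound value.\<close>
  define \<pi> where "\<pi> n = (if \<tau> n = (\<lambda>s. s 0) then 0 else Suc n)" for n
  obtain q where q: "\<And>M s. sat M q s = sat M p (\<lambda>n. s (\<pi> n))" using sat_rename by meson
  define \<sigma> where "\<sigma> n = (\<lambda>s :: nat \<Rightarrow> 'v. \<tau> (n - 1) (case_nat (s 0) s))" for n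
  show ?thesis
  proof (rule dfnI[where \<tau> = \<sigma> and p = "FAll 0 q"])
    fix n
    have "(\<lambda>s :: nat \<Rightarrow> 'v. \<tau> (n - 1) (case_nat (s 0) s)) =
          (\<lambda>s. \<tau> (n - 1) (\<lambda>m. case_nat (\<lambda>s. s 0) (\<lambda>k s. s k) m s))"
      by (intro ext arg_cong[where f = "\<tau> (n - 1)"]) (auto split: nat.split)
    moreover have "tm A \<dots>"
      by (rule tm_subst[OF \<tau>]) (auto split: nat.split intro: tm_var)
    ultimately show "tm A (\<sigma> n)" unfolding \<sigma>_def by simp
  next
    fix N and s :: "nat \<Rightarrow> 'v" assume N: "N \<in> C" "A \<subseteq> N" "range s \<subseteq> N"
    have "P N s a = sat N q ((\<lambda>n. \<sigma> n s)(0 := a))" if "a \<in> N" for a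
    proof -
      have "P N s a = sat N p (\<lambda>n. \<tau> n (case_nat a s))"
      proof -
        have "range (case_nat a s) \<subseteq> N" using N that by (auto simp: image_subset_iff split: nat.split)
        from p[OF N(1,2) this] show ?thesis by simp
      qed
      also have "(\<lambda>n. \<tau> n (case_nat a s)) = (\<lambda>n. ((\<lambda>n. \<sigma> n s)(0 := a)) (\<pi> n))"
      proof (intro ext)
        fix n
        show "\<tau> n (case_nat a s) = ((\<lambda>n. \<sigma> n s)(0 := a)) (\<pi> n)"
          using \<tau>[of n] unfolding \<pi>_def \<sigma>_def tm_def
          by (auto split: nat.split simp: gr0_conv_Suc)
      qed
      finally show ?thesis unfolding q .
    qed
    then show "(\<forall>a\<in>N. P N s a) = sat N (FAll 0 q) (\<lambda>n. \<sigma> n s)" by simp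
  qed
qed

lemma dfn_disj [dfn_intros]:
  assumes "dfn C A P" and "dfn C A Q" shows "dfn C A (\<lambda>N s. P N s \<or> Q N s)"
  by (rule dfn_cong[OF dfn_not[OF dfn_conj[OF assms[THEN dfn_not]]]]) auto

lemma dfn_imp [dfn_intros]:
  assumes "dfn C A P" and "dfn C A Q" shows "dfn C A (\<lambda>N s. P N s \<longrightarrow> Q N s)"
  by (rule dfn_cong[OF dfn_disj[OF dfn_not[OF assms(1)] assms(2)]]) auto

lemma dfn_iff [dfn_intros]:
  assumes "dfn C A P" and "dfn C A Q" shows "dfn C A (\<lambda>N s. P N s \<longleftrightarrow> Q N s)"
  by (rule dfn_cong[OF dfn_conj[OF dfn_imp[OF assms] dfn_imp[OF assms(2,1)]]]) auto

lemma dfn_ex [dfn_intros]: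
  "dfn C A (\<lambda>N s. P N (\<lambda>n. s (Suc n)) (s 0)) \<Longrightarrow> dfn C A (\<lambda>N s. \<exists>a\<in>N. P N s a)"
  using dfn_not[OF dfn_all, of C A "\<lambda>N s a. \<not> P N s a"] by (simp add: dfn_not)

lemma dfn_ball_ext [dfn_intros]:
  assumes "tm A x" and "dfn C A (\<lambda>N s. P N (\<lambda>n. s (Suc n)) (s 0))"
  shows "dfn C A (\<lambda>N s. \<forall>a\<in>ext N (x s). P N s a)"
proof -
  have "dfn C A (\<lambda>N s. \<forall>a\<in>N. a \<epsilon> x s \<longrightarrow> P N s a)"
    by (intro dfn_all dfn_imp dfn_mem tm_shift tm_var assms)
  then show ?thesis unfolding ext_def by (rule dfn_cong) auto
qed

lemma dfn_bex_ext [dfn_intros]: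
  assumes "tm A x" and "dfn C A (\<lambda>N s. P N (\<lambda>n. s (Suc n)) (s 0))"
  shows "dfn C A (\<lambda>N s. \<exists>a\<in>ext N (x s). P N s a)"
proof -
  have "dfn C A (\<lambda>N s. \<exists>a\<in>N. a \<epsilon> x s \<and> P N s a)"
    by (intro dfn_ex dfn_conj dfn_mem tm_shift tm_var assms)
  then show ?thesis unfolding ext_def by (rule dfn_cong) auto
qed

lemma dfn_in_ext [dfn_intros]: "tm A x \<Longrightarrow> tm A y \<Longrightarrow> dfn C A (\<lambda>N s. x s \<in> ext N (y s))"
  by (rule dfn_cong[OF dfn_mem]) (auto simp: ext_def tm_in)

lemma dfn_ext_collect [dfn_intros]:
  assumes "tm A x" and "dfn C A (\<lambda>N s. P N (\<lambda>n. s (Suc n)) (s 0))"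
  shows "dfn C A (\<lambda>N s. ext N (x s) = {z \<in> N. P N s z})"
proof -
  have "dfn C A (\<lambda>N s. \<forall>z\<in>N. z \<epsilon> x s \<longleftrightarrow> P N s z)"
    by (intro dfn_all dfn_iff dfn_mem tm_shift tm_var assms)
  then show ?thesis by (rule dfn_cong) (auto simp: ext_def)
qed

lemma dfn_ext_collect_ext [dfn_intros]:
  assumes "tm A x" "tm A y" and "dfn C A (\<lambda>N s. P N (\<lambda>n. s (Suc n)) (s 0))"
  shows "dfn C A (\<lambda>N s. ext N (x s) = {z \<in> ext N (y s). P N s z})"
proof -
  have "dfn C A (\<lambda>N s. ext N (x s) = {z \<in> N. z \<epsilon> y s \<and> P N s z})"
    by (intro dfn_ext_collect dfn_conj dfn_mem tm_shift tm_var assms)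
  then show ?thesis by (rule dfn_cong) (auto simp: ext_def)
qed

lemma dfn_ext_empty [dfn_intros]:
  assumes "tm A x" shows "dfn C A (\<lambda>N s. ext N (x s) = {})"
proof -
  have "dfn C A (\<lambda>N s. \<forall>z\<in>N. \<not> z \<epsilon> x s)"
    by (intro dfn_all dfn_not dfn_mem tm_shift tm_var assms)
  then show ?thesis by (rule dfn_cong) (auto simp: ext_def)
qed

lemma dfn_ext_subset [dfn_intros]:
  assumes "tm A x" "tm A y" shows "dfn C A (\<lambda>N s. ext N (x s) \<subseteq> ext N (y s))"
proof -
  have "dfn C A (\<lambda>N s. \<forall>z\<in>N. z \<epsilon> x s \<longrightarrow> z \<epsilon> y s)"
    by (intro dfn_all dfn_imp dfn_mem tm_shift tm_var assms)
  then show ?thesis by (rule dfn_cong) (auto simp: ext_def)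
qed

lemma dfn_ext_single [dfn_intros]:
  assumes "tm A x" "tm A y" shows "dfn C A (\<lambda>N s. ext N (x s) = {y s})"
proof -
  have "dfn C A (\<lambda>N s. ext N (x s) = {z \<in> N. z = y s})"
    by (intro dfn_ext_collect dfn_eq tm_shift tm_var assms)
  then show ?thesis by (rule dfn_cong) (use assms tm_in in \<open>fastforce simp: ext_def\<close>)
qed

lemma dfn_ext_pair [dfn_intros]:
  assumes "tm A x" "tm A y" "tm A z" shows "dfn C A (\<lambda>N s. ext N (x s) = {y s, z s})"
proof -
  have "dfn C A (\<lambda>N s. ext N (x s) = {v \<in> N. v = y s \<or> v = z s})"
    by (intro dfn_ext_collect dfn_eq dfn_disj tm_shift tm_var assms)
  then show ?thesis by (rule dfn_cong) (use assms tm_in in \<open>fastforce simp: ext_def\<close>)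
qed

lemma dfn_ext_insert [dfn_intros]:
  assumes "tm A x" "tm A y" "tm A z" shows "dfn C A (\<lambda>N s. ext N (x s) = insert (y s) (ext N (z s)))"
proof -
  have "dfn C A (\<lambda>N s. ext N (x s) = {v \<in> N. v = y s \<or> v \<epsilon> z s})"
    by (intro dfn_ext_collect dfn_eq dfn_mem dfn_disj tm_shift tm_var assms)
  then show ?thesis by (rule dfn_cong) (use assms tm_in in \<open>fastforce simp: ext_def\<close>)
qed

text \<open>With this and its two- and three-place versions, a notion is shown definable once, on
  the variables 0, 1, 2; its use at other terms is a substitution.\<close>

lemma dfn_subst1:
  "dfn C A (\<lambda>N s. R N (s 0)) \<Longrightarrow> tm A x \<Longrightarrow> dfn C A (\<lambda>N s. R N (x s))"
  using dfn_subst[of C A "\<lambda>N s. R N (s 0)" "\<lambda>n. x"] by simp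

lemma dfn_subst2:
  "dfn C A (\<lambda>N s. R N (s 0) (s 1)) \<Longrightarrow> tm A x \<Longrightarrow> tm A y \<Longrightarrow> dfn C A (\<lambda>N s. R N (x s) (y s))"
  using dfn_subst[of C A "\<lambda>N s. R N (s 0) (s 1)" "\<lambda>n. [x, y] ! (n mod 2)"]
  by (simp add: nth_Cons' mod_2_eq_odd)

lemma dfn_subst3:
  assumes "dfn C A (\<lambda>N s. R N (s 0) (s 1) (s 2))" "tm A x" "tm A y" "tm A z"
  shows "dfn C A (\<lambda>N s. R N (x s) (y s) (z s))"
  using dfn_subst[OF assms(1), of "\<lambda>n. if n = 0 then x else if n = 1 then y else z"] assms(2-) by simp

section \<open>Definability of pairs, functions, ordinals and natural numbers\<close>

lemma dfn_is_opair [dfn_intros]: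
  "tm A p \<Longrightarrow> tm A a \<Longrightarrow> tm A b \<Longrightarrow> dfn C A (\<lambda>N s. is_opair N (p s) (a s) (b s))"
  by (rule dfn_subst3[where R = is_opair]) (unfold is_opair_def, intro dfn_intros)

lemma dfn_maps_to [dfn_intros]:
  "tm A f \<Longrightarrow> tm A x \<Longrightarrow> tm A y \<Longrightarrow> dfn C A (\<lambda>N s. maps_to N (f s) (x s) (y s))"
  by (rule dfn_subst3[where R = maps_to]) (unfold maps_to_def, intro dfn_intros)

lemma dfn_ex1 [dfn_intros]:
  assumes "dfn C A (\<lambda>N s. P N (\<lambda>n. s (Suc n)) (s 0))"
  shows "dfn C A (\<lambda>N s. \<exists>!y. y \<in> N \<and> P N s y)"
proof -
  have *: "dfn C A (\<lambda>N s. P N (\<lambda>n. s (Suc (Suc n))) (s 0))"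
    using dfn_subst[OF assms, of "\<lambda>n. case_nat (\<lambda>s. s 0) (\<lambda>k s. s (Suc (Suc k))) n"]
    by (simp add: tm_var split: nat.splits)
  have "dfn C A (\<lambda>N s. \<exists>y\<in>N. P N s y \<and> (\<forall>z\<in>N. P N s z \<longrightarrow> z = y))"
    by (intro dfn_intros assms *)
  then show ?thesis by (rule dfn_cong) metis
qed

lemma dfn_is_fun [dfn_intros]:
  "tm A f \<Longrightarrow> tm A x \<Longrightarrow> dfn C A (\<lambda>N s. is_fun N (f s) (x s))"
proof (rule dfn_subst2[where R = is_fun])
  show "dfn C A (\<lambda>N s. is_fun N (s 0) (s 1))"
    by (rule dfn_cong[where R' = "\<lambda>N s. (\<forall>p\<in>ext N (s 0). \<exists>x\<in>ext N (s 1). \<exists>y\<in>N. is_opair N p x y) \<and>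
     (\<forall>x\<in>ext N (s 1). \<exists>!y. y \<in> N \<and> maps_to N (s 0) x y)"]) (intro dfn_intros, auto simp: is_fun_def)
qed

lemma dfn_trans_set [dfn_intros]: "tm A x \<Longrightarrow> dfn C A (\<lambda>N s. trans_set N (x s))"
  by (rule dfn_subst1[where R = trans_set]) (unfold trans_set_def, intro dfn_intros)

lemma dfn_ordinal [dfn_intros]: "tm A x \<Longrightarrow> dfn C A (\<lambda>N s. ordinal N (x s))"
proof (rule dfn_subst1[where R = ordinal])
  show "dfn C A (\<lambda>N s. ordinal N (s 0))"
    by (rule dfn_cong[where R' = "\<lambda>N s. trans_set N (s 0) \<and> (\<forall>y\<in>ext N (s 0). trans_set N y)"])
      (intro dfn_intros, auto simp: ordinal_def)
qed

lemma dfn_natural [dfn_intros]: "tm A x \<Longrightarrow> dfn C A (\<lambda>N s. natural N (x s))"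
proof (rule dfn_subst1[where R = natural])
  show "dfn C A (\<lambda>N s. natural N (s 0))"
    by (rule dfn_cong[where R' = "\<lambda>N s. ordinal N (s 0) \<and>
       (\<forall>m\<in>N. m = s 0 \<or> m \<epsilon> s 0 \<longrightarrow> ext N m = {} \<or> (\<exists>k\<in>N. ext N m = insert k (ext N k)))"])
      (intro dfn_intros, auto simp: natural_def ordinal_def ext_def)
qed

text \<open>The bridge from \<open>dfn\<close> to the two axiom schemes, which expect one formula
  and one assignment into the model: the constants allowed as terms in \<open>dfn\<close> are packed
  into the assignment.\<close>

lemma dfn_param2:
  assumes "dfn {M} M (\<lambda>N s. Q N (s 0) (s 1))" and "M \<noteq> {}"
  shows "\<exists>p s. range s \<subseteq> M \<and> (\<forall>x\<in>M. \<forall>y\<in>M. Q M x y = sat M p (s(0 := x, 1 := y)))"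
proof -
  from assms(1) obtain p \<tau> where \<tau>: "\<And>n. tm M (\<tau> n)"
    and p: "\<And>s. range s \<subseteq> M \<Longrightarrow> Q M (s 0) (s 1) = sat M p (\<lambda>n. \<tau> n s)" by (rule dfnE) blast
  obtain m where m: "m \<in> M" using assms(2) by blast
  define c where "c n = (if \<exists>a\<in>M. \<tau> n = (\<lambda>s. a) then \<tau> n (\<lambda>_. m) else m)" for n
  \<comment> \<open>Constants are stored from index 2 on. The environment has \<open>x\<close> at 0
    and \<open>y\<close> at every later index, so each remaining variable is read at 0 or at
    1.\<close>
  define \<pi> where "\<pi> n = (if \<exists>a\<in>M. \<tau> n = (\<lambda>s. a) then n + 2 else if \<tau> n = (\<lambda>s. s 0) then 0 else 1)" for n
  obtain q where q: "\<And>M s. sat M q s = sat M p (\<lambda>n. s (\<pi> n))" using sat_rename by meson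
  have rng: "range (case_nat x (\<lambda>_. y)) \<subseteq> M" if "x \<in> M" "y \<in> M" for x y
    using that by (auto split: nat.split)
  have "Q M x y = sat M q ((\<lambda>n. c (n - 2))(0 := x, 1 := y))" if "x \<in> M" "y \<in> M" for x y
  proof -
    let ?s = "case_nat x (\<lambda>_. y)"
    have "Q M x y = sat M p (\<lambda>n. \<tau> n ?s)"
      using p[OF rng[OF that]] by simp
    also have "(\<lambda>n. \<tau> n ?s) = (\<lambda>n. ((\<lambda>n. c (n - 2))(0 := x, 1 := y)) (\<pi> n))"
    proof
      fix n
      show "\<tau> n ?s = ((\<lambda>n. c (n - 2))(0 := x, 1 := y)) (\<pi> n)"
        using \<tau>[of n] unfolding \<pi>_def c_def tm_def
        by (auto split: nat.splits simp: fun_eq_iff gr0_conv_Suc)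
          (metis old.nat.simps(4) old.nat.simps(5))+
    qed
    finally show ?thesis unfolding q .
  qed
  moreover have "range (\<lambda>n. c (n - 2)) \<subseteq> M" using m unfolding c_def by auto
  ultimately show ?thesis by blast
qed

end

section \<open>Sets, functions and well-founded recursion in a model of ZFC\<close>

locale zfc_model = set_structure E for E :: "'v \<Rightarrow> 'v \<Rightarrow> bool"  (infix \<open>\<epsilon>\<close> 50) +
  fixes M :: "'v set"
  assumes ZFC_M: "ZFC M"
begin

abbreviation DM :: "('v set \<Rightarrow> (nat \<Rightarrow> 'v) \<Rightarrow> bool) \<Rightarrow> bool" where
  "DM \<equiv> dfn {M} M"

text \<open>Says that an external collection is the extension of an element of the model. Closure
  properties can then be stated on HOL set expressions, without naming the coding elements.\<close>

definition is_set :: "'v set \<Rightarrow> bool" where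
  "is_set S \<longleftrightarrow> (\<exists>b\<in>M. ext M b = S)"

lemma in_ext_iff: "y \<in> ext M x \<longleftrightarrow> y \<in> M \<and> y \<epsilon> x"
  by (simp add: ext_def)

lemma ext_in: "y \<in> ext M x \<Longrightarrow> y \<in> M"
  by (simp add: ext_def)

lemma ext_inject: "a \<in> M \<Longrightarrow> b \<in> M \<Longrightarrow> ext M a = ext M b \<Longrightarrow> a = b"
  using ZFC_M unfolding ZFC_def extensionality_def by blast

lemma is_set_ext [simp]: "a \<in> M \<Longrightarrow> is_set (ext M a)"
  unfolding is_set_def by blast

lemma is_setE:
  assumes "is_set S" obtains b where "b \<in> M" "ext M b = S"
  using assms unfolding is_set_def by blast

lemma is_set_in: "is_set S \<Longrightarrow> x \<in> S \<Longrightarrow> x \<in> M"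
  unfolding is_set_def using ext_in by blast

lemma M_nonempty: "M \<noteq> {}"
  using ZFC_M unfolding ZFC_def infinity_def by blast

lemma is_set_sep:
  assumes S: "is_set S" and P: "DM (\<lambda>N s. P N (s 0))"
  shows "is_set {x \<in> S. P M x}"
proof -
  from S obtain a where a: "a \<in> M" "ext M a = S" by (rule is_setE)
  obtain p s where s: "range s \<subseteq> M"
    and p: "\<forall>x\<in>M. \<forall>y\<in>M. P M x = sat M p (s(0 := x, 1 := y))"
    using dfn_param2[where Q = "\<lambda>N x y. P N x", OF P M_nonempty] by (elim exE conjE)
  \<comment> \<open>The formula obtained has two slots; \<open>P\<close> speaks of the first, and
    the second is filled with \<open>a\<close>.\<close>
  obtain b where "b \<in> M" "ext M b = {x \<in> ext M a. sat M p ((s(1 := a))(0 := x))}"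
  proof -
    have "range (s(1 := a)) \<subseteq> M" using s a by auto
    then show thesis using that ZFC_M a(1) unfolding ZFC_def separation_def by blast
  qed
  moreover have "sat M p ((s(1 := a))(0 := x)) = P M x" if "x \<in> ext M a" for x
    using p that a(1) ext_in[of x a] by (simp add: fun_upd_twist)
  ultimately have "b \<in> M \<and> ext M b = {x \<in> S. P M x}" using a(2) by blast
  then show ?thesis unfolding is_set_def by blast
qed

lemma is_set_sub:
  "is_set S \<Longrightarrow> DM (\<lambda>N s. P N (s 0)) \<Longrightarrow> (\<And>x. x \<in> T \<longleftrightarrow> x \<in> S \<and> P M x) \<Longrightarrow> is_set T"
  using is_set_sep[of S P] by (metis (mono_tags, lifting) Collect_cong Collect_mem_eq)

lemma is_set_repl:
  assumes S: "is_set S" and Q: "DM (\<lambda>N s. Q N (s 0) (s 1))"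
    and un: "\<And>x y y'. x \<in> S \<Longrightarrow> y \<in> M \<Longrightarrow> y' \<in> M \<Longrightarrow> Q M x y \<Longrightarrow> Q M x y' \<Longrightarrow> y = y'"
  shows "is_set {y \<in> M. \<exists>x\<in>S. Q M x y}"
proof -
  from S obtain a where a: "a \<in> M" "ext M a = S" by (rule is_setE)
  obtain p s where s: "range s \<subseteq> M"
    and p: "\<forall>x\<in>M. \<forall>y\<in>M. Q M x y = sat M p (s(0 := x, 1 := y))"
    using dfn_param2[where Q = Q, OF Q M_nonempty] by (elim exE conjE)
  have fn: "\<forall>x\<in>ext M a. \<forall>y\<in>M. \<forall>y'\<in>M.
      sat M p (s(0 := x, 1 := y)) \<longrightarrow> sat M p (s(0 := x, 1 := y')) \<longrightarrow> y = y'"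
    using un a p by (metis ext_in)
  have "replacement M" using ZFC_M unfolding ZFC_def by blast
  note this[unfolded replacement_def, THEN spec, of p, THEN spec, of s, THEN mp, OF s,
      THEN bspec, OF a(1), THEN mp, OF fn]
  then obtain b where "b \<in> M" "ext M b = {y \<in> M. \<exists>x\<in>ext M a. sat M p (s(0 := x, 1 := y))}"
    by (elim bexE)
  moreover have "sat M p (s(0 := x, 1 := y)) = Q M x y" if "x \<in> S" "y \<in> M" for x y
    using p that a(2) ext_in[of x a] by simp
  ultimately have "b \<in> M \<and> ext M b = {y \<in> M. \<exists>x\<in>S. Q M x y}" unfolding a(2) by blast
  then show ?thesis unfolding is_set_def by blast
qed

lemma is_set_pair: "a \<in> M \<Longrightarrow> b \<in> M \<Longrightarrow> is_set {a, b}"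
  using ZFC_M unfolding ZFC_def pairing_def is_set_def by blast

lemma is_set_single: "a \<in> M \<Longrightarrow> is_set {a}"
  using is_set_pair[of a a] by simp

lemma is_set_Union: "is_set S \<Longrightarrow> is_set (\<Union>x\<in>S. ext M x)"
  using ZFC_M unfolding ZFC_def union_axiom_def is_set_def by blast

lemma is_set_Pow: "is_set S \<Longrightarrow> is_set {x \<in> M. ext M x \<subseteq> S}"
  using ZFC_M unfolding ZFC_def power_set_def is_set_def by blast

lemma is_set_Un: "is_set S \<Longrightarrow> is_set T \<Longrightarrow> is_set (S \<union> T)"
proof -
  assume "is_set S" "is_set T"
  then obtain a b where ab: "a \<in> M" "ext M a = S" "b \<in> M" "ext M b = T" by (metis is_setE)
  show ?thesis using is_set_Union[OF is_set_pair[OF ab(1,3)]] ab by simp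
qed

lemma is_set_insert: "a \<in> M \<Longrightarrow> is_set S \<Longrightarrow> is_set (insert a S)"
  using is_set_Un[OF is_set_single, of a S] by simp

lemma is_set_Diff: "is_set S \<Longrightarrow> is_set T \<Longrightarrow> is_set (S - T)"
proof -
  assume S: "is_set S" and "is_set T"
  then obtain b where b: "b \<in> M" "ext M b = T" by (metis is_setE)
  show ?thesis
    by (rule is_set_sub[OF S, where P = "\<lambda>N x. x \<notin> ext N b"]) (intro dfn_intros b, auto simp: b)
qed

lemma is_set_empty: "is_set {}"
  using M_nonempty is_set_Diff[of S S for S] is_set_ext by (metis Diff_cancel ex_in_conv)

lemma foundation_set:
  assumes "is_set S" "S \<noteq> {}"
  shows "\<exists>y\<in>S. ext M y \<inter> S = {}"
  using assms ZFC_M unfolding ZFC_def foundation_def is_set_def by blast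

section \<open>Ordered pairs and functions inside the model\<close>

lemma opair_ex:
  assumes "a \<in> M" "b \<in> M" shows "\<exists>p\<in>M. is_opair M p a b"
proof -
  obtain u where u: "u \<in> M" "ext M u = {a}" using is_set_single[OF assms(1)] by (rule is_setE)
  obtain v where v: "v \<in> M" "ext M v = {a, b}" using is_set_pair[OF assms] by (rule is_setE)
  obtain p where "p \<in> M" "ext M p = {u, v}" using is_set_pair[OF u(1) v(1)] by (rule is_setE)
  then show ?thesis using u v unfolding is_opair_def by blast
qed

lemma opair_inject:
  assumes "is_opair M p a b" "is_opair M p c d" shows "a = c \<and> b = d"
proof -
  obtain u v where uv: "ext M u = {a}" "ext M v = {a, b}" "ext M p = {u, v}"
    using assms(1) unfolding is_opair_def by blast
  obtain u' v' where uv': "ext M u' = {c}" "ext M v' = {c, d}" "ext M p = {u', v'}"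
    using assms(2) unfolding is_opair_def by blast
  have "u = u' \<and> v = v' \<or> u = v' \<and> v = u'" 
    using uv(3)[symmetric] unfolding uv'(3) doubleton_eq_iff by auto
  then show ?thesis using uv uv' by (auto simp: doubleton_eq_iff)
qed

lemma opair_unique:
  assumes "is_opair M p a b" "is_opair M q a b" "p \<in> M" "q \<in> M" shows "p = q"
  using assms unfolding is_opair_def by (metis ext_inject)

lemma opair_in: "is_opair M p a b \<Longrightarrow> a \<in> M \<and> b \<in> M"
  unfolding is_opair_def using ext_in by blast

lemma maps_to_in: "maps_to M f x y \<Longrightarrow> x \<in> M \<and> y \<in> M"
  unfolding maps_to_def using opair_in by blast

text \<open>The translation used throughout: \<open>app\<close> is a definite description,
  convenient for reasoning, while \<open>maps_to\<close> is first-order and false outside the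
  domain, hence fit for definability. Formulas are written with \<open>maps_to\<close> and rewritten
  by this equivalence.\<close>

lemma maps_to_iff: "is_fun M f X \<Longrightarrow> maps_to M f x y \<longleftrightarrow> x \<in> ext M X \<and> y = app M f x"
proof -
  assume f: "is_fun M f X"
  have dom: "x \<in> ext M X" if "maps_to M f x y" for x y
  proof -
    obtain p where "p \<in> ext M f" "is_opair M p x y" using \<open>maps_to M f x y\<close> unfolding maps_to_def by blast
    moreover then obtain x' y' where "x' \<in> ext M X" "is_opair M p x' y'"
      using f unfolding is_fun_def by blast
    ultimately show ?thesis using opair_inject by blast
  qed
  have *: "\<exists>!y. y \<in> M \<and> maps_to M f x y" if "x \<in> ext M X" for x
    using f that unfolding is_fun_def by blast
  have "app M f x \<in> M \<and> maps_to M f x (app M f x)" if "x \<in> ext M X" for x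
    unfolding app_def by (rule theI'[OF *[OF that]])
  then show ?thesis using * dom maps_to_in by blast
qed

lemma app_maps: "is_fun M f X \<Longrightarrow> x \<in> ext M X \<Longrightarrow> maps_to M f x (app M f x)"
  by (simp add: maps_to_iff)

lemma app_in: "is_fun M f X \<Longrightarrow> x \<in> ext M X \<Longrightarrow> app M f x \<in> M"
  using app_maps maps_to_in by blast

lemma is_fun_in: "is_fun M f X \<Longrightarrow> f \<in> M"
  unfolding is_fun_def by blast

lemma fun_eqI:
  assumes f: "is_fun M f X" and g: "is_fun M g X" and eq: "\<And>x. x \<in> ext M X \<Longrightarrow> app M f x = app M g x"
  shows "f = g"
proof -
  have "p \<in> ext M g" if f: "is_fun M f X" and g: "is_fun M g X"
    and eq: "\<And>x. x \<in> ext M X \<Longrightarrow> app M f x = app M g x" and p: "p \<in> ext M f" for p f g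
  proof -
    obtain x y where xy: "x \<in> ext M X" "is_opair M p x y" using f p unfolding is_fun_def by blast
    then have "maps_to M f x y" using p unfolding maps_to_def by blast
    then have "maps_to M g x y" using maps_to_iff[OF f] maps_to_iff[OF g] eq by simp
    then obtain q where "q \<in> ext M g" "is_opair M q x y" unfolding maps_to_def by blast
    then show ?thesis using opair_unique[OF xy(2)] p ext_in by blast
  qed
  then have "ext M f = ext M g" using f g eq by (metis subsetI subset_antisym)
  then show ?thesis using ext_inject is_fun_in f g by blast
qed

lemma mk_fun:
  assumes X: "X \<in> M" and Q: "DM (\<lambda>N s. Q N (s 0) (s 1))"
    and un: "\<And>x. x \<in> ext M X \<Longrightarrow> \<exists>!y. y \<in> M \<and> Q M x y"
  shows "\<exists>f. is_fun M f X \<and> (\<forall>x\<in>ext M X. Q M x (app M f x))"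
proof -
  note Qt = dfn_subst2[OF Q]
  have "is_set {p \<in> M. \<exists>x\<in>ext M X. \<exists>y\<in>M. Q M x y \<and> is_opair M p x y}"
  proof (rule is_set_repl[where Q = "\<lambda>N x p. \<exists>y\<in>N. Q N x y \<and> is_opair N p x y"])
    show "DM (\<lambda>N s. \<exists>y\<in>N. Q N (s 0) y \<and> is_opair N (s 1) (s 0) y)"
      by (intro dfn_intros Qt)
  next
    fix x p p' assume "x \<in> ext M X" "p \<in> M" "p' \<in> M" "\<exists>y\<in>M. Q M x y \<and> is_opair M p x y"
      "\<exists>y\<in>M. Q M x y \<and> is_opair M p' x y"
    then show "p = p'" using un opair_unique by metis
  qed (use X in simp)
  then obtain f where f: "f \<in> M" "ext M f = {p \<in> M. \<exists>x\<in>ext M X. \<exists>y\<in>M. Q M x y \<and> is_opair M p x y}"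
    by (rule is_setE)
  have mt: "maps_to M f x y \<longleftrightarrow> x \<in> ext M X \<and> y \<in> M \<and> Q M x y" for x y
  proof
    assume "maps_to M f x y"
    then show "x \<in> ext M X \<and> y \<in> M \<and> Q M x y"
      unfolding maps_to_def f(2) using opair_inject by blast
  next
    assume r: "x \<in> ext M X \<and> y \<in> M \<and> Q M x y"
    then obtain p where "p \<in> M" "is_opair M p x y" using opair_ex ext_in by blast
    then show "maps_to M f x y" using r unfolding maps_to_def f(2) by blast
  qed
  have fn: "is_fun M f X" unfolding is_fun_def
  proof (intro conjI ballI)
    show "f \<in> M" by (rule f(1))
    show "\<exists>x\<in>ext M X. \<exists>y\<in>M. is_opair M p x y" if "p \<in> ext M f" for p
      using that unfolding f(2) by blast
    show "\<exists>!y. y \<in> M \<and> maps_to M f x y" if "x \<in> ext M X" for x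
      using un[OF that] that unfolding mt by blast
  qed
  then show ?thesis using mt app_maps by blast
qed

section \<open>Recursion along a definable well-founded relation\<close>

text \<open>Well-foundedness is assumed only for collections that are sets of the model, so the
  recursion is carried out internally. Attempts agree by a minimal disagreement, their values form
  one function, and a minimal point outside its domain could be added. \<open>\<Gamma>\<close>
  receives the set of values at the predecessors.\<close>

lemma wf_rec:
  assumes D: "D \<in> M" and R: "DM (\<lambda>N s. R N (s 0) (s 1))"
    and wf: "\<And>S. is_set S \<Longrightarrow> S \<subseteq> ext M D \<Longrightarrow> S \<noteq> {} \<Longrightarrow> \<exists>d\<in>S. \<forall>e\<in>S. \<not> R M e d"
    and G: "DM (\<lambda>N s. \<Gamma> N (s 0) (s 1))" and fn: "\<And>S. S \<in> M \<Longrightarrow> \<exists>!y. y \<in> M \<and> \<Gamma> M S y"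
  shows "\<exists>h. is_fun M h D \<and> (\<forall>d\<in>ext M D. \<exists>S\<in>M.
    ext M S = app M h ` {e \<in> ext M D. R M e d} \<and> \<Gamma> M S (app M h d))"
proof -
  \<comment> \<open>An attempt is a function on an initial segment \<open>A\<close> of
    \<open>D\<close> that satisfies the recursion there; it is phrased with \<open>maps_to\<close>,
    so that being an attempt is definable.\<close>
  define att where "att N A g \<longleftrightarrow> is_fun N g A \<and> ext N A \<subseteq> ext N D \<and>
    (\<forall>d\<in>ext N A. \<forall>e\<in>ext N D. R N e d \<longrightarrow> e \<in> ext N A) \<and>
    (\<forall>d\<in>ext N A. \<exists>S\<in>N. ext N S = {v \<in> N. \<exists>e\<in>ext N D. R N e d \<and> maps_to N g e v} \<and>
       (\<exists>y\<in>N. maps_to N g d y \<and> \<Gamma> N S y))" for N A g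
  note Rt = dfn_subst2[OF R] and Gt = dfn_subst2[OF G]
  have "DM (\<lambda>N s. att N (s 0) (s 1))"
    unfolding att_def by (intro dfn_intros Rt Gt D)
  note attt = dfn_subst2[OF this]
  have attE: "\<exists>S\<in>M. ext M S = {v \<in> M. \<exists>e\<in>ext M D. R M e d \<and> maps_to M g e v} \<and> \<Gamma> M S (app M g d)"
    if att: "att M A g" and d: "d \<in> ext M A" for A g d
  proof -
    have "\<exists>S\<in>M. ext M S = {v \<in> M. \<exists>e\<in>ext M D. R M e d \<and> maps_to M g e v} \<and>
        (\<exists>y\<in>M. maps_to M g d y \<and> \<Gamma> M S y)" and f: "is_fun M g A"
      using att d unfolding att_def by simp_all
    then obtain S y where "S \<in> M" "ext M S = {v \<in> M. \<exists>e\<in>ext M D. R M e d \<and> maps_to M g e v}"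
      "maps_to M g d y" "\<Gamma> M S y" by blast
    then show ?thesis using maps_to_iff[OF f, of d y] by blast
  qed
  have agree: "app M g d = app M g' d"
    if A: "A \<in> M" "A' \<in> M" and att: "att M A g" "att M A' g'" and d: "d \<in> ext M A" "d \<in> ext M A'"
    for A A' g g' d
  proof -
    from att have f: "is_fun M g A" "is_fun M g' A'" unfolding att_def by auto
    have g: "g \<in> M" "g' \<in> M" using f is_fun_in by auto
    define B where "B = {d \<in> ext M A. d \<in> ext M A' \<and> app M g d \<noteq> app M g' d}"
    have "is_set B"
      by (rule is_set_sub[OF is_set_ext[OF A(1)], where P = "\<lambda>N d. d \<in> ext N A' \<and>
          (\<exists>y\<in>N. \<exists>y'\<in>N. maps_to N g d y \<and> maps_to N g' d y' \<and> y \<noteq> y')"])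
        (intro dfn_intros A g, auto simp: B_def maps_to_iff[OF f(1)] maps_to_iff[OF f(2)] app_in[OF f(1)] app_in[OF f(2)])
    moreover have "B \<subseteq> ext M D" using att unfolding att_def B_def by blast
    moreover have "\<exists>e\<in>B. R M e b" if b: "b \<in> B" for b
    proof (rule ccontr)
      assume nex: "\<not> (\<exists>e\<in>B. R M e b)"
      have bA: "b \<in> ext M A" "b \<in> ext M A'" "app M g b \<noteq> app M g' b" using b unfolding B_def by auto
      have eq: "app M g e = app M g' e \<and> e \<in> ext M A \<and> e \<in> ext M A'" if "e \<in> ext M D" "R M e b" for e
        using nex that bA att unfolding B_def att_def by blast
      obtain S where S: "S \<in> M" "ext M S = {v \<in> M. \<exists>e\<in>ext M D. R M e b \<and> maps_to M g e v}"
        "\<Gamma> M S (app M g b)"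
        using attE[OF att(1) bA(1)] by blast
      obtain S' where S': "S' \<in> M" "ext M S' = {v \<in> M. \<exists>e\<in>ext M D. R M e b \<and> maps_to M g' e v}"
        "\<Gamma> M S' (app M g' b)"
        using attE[OF att(2) bA(2)] by blast
      have "ext M S = ext M S'"
        unfolding S(2) S'(2) maps_to_iff[OF f(1)] maps_to_iff[OF f(2)] using eq by auto
      then have "S = S'" using ext_inject S S' by blast
      then show False using S(3) S'(3) fn[OF S(1)] app_in[OF f(1) bA(1)] app_in[OF f(2) bA(2)] bA(3) by blast
    qed
    ultimately have "B = {}" using wf by blast
    then show ?thesis using d unfolding B_def by blast
  qed
  \<comment> \<open>The union of all attempts, as a definable relation; its domain \<open>D0\<close>
    below is a set by Separation, and \<open>g1\<close> is its restriction to that set.\<close>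
  define Q where "Q N d y \<longleftrightarrow> (\<exists>A\<in>N. \<exists>g\<in>N. att N A g \<and> d \<in> ext N A \<and> maps_to N g d y)" for N d y
  have Q: "DM (\<lambda>N s. Q N (s 0) (s 1))" unfolding Q_def by (intro dfn_intros attt)
  note Qt = dfn_subst2[OF Q]
  have Qun: "y = y'" if q: "Q M d y" "Q M d y'" for d y y'
  proof -
    obtain A g where 1: "A \<in> M" "att M A g" "d \<in> ext M A" "maps_to M g d y" using q(1) unfolding Q_def by blast
    obtain A' g' where 2: "A' \<in> M" "att M A' g'" "d \<in> ext M A'" "maps_to M g' d y'" using q(2) unfolding Q_def by blast
    have "is_fun M g A" "is_fun M g' A'" using 1 2 unfolding att_def by auto
    then show ?thesis using agree[OF 1(1) 2(1) 1(2) 2(2) 1(3) 2(3)] 1(4) 2(4) maps_to_iff by metis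
  qed
  have "is_set {d \<in> ext M D. \<exists>y\<in>M. Q M d y}"
    by (rule is_set_sep[OF is_set_ext[OF D]]) (intro dfn_intros Qt)
  then obtain D0 where D0: "D0 \<in> M" "ext M D0 = {d \<in> ext M D. \<exists>y\<in>M. Q M d y}" by (rule is_setE)
  have ex1: "\<exists>!y. y \<in> M \<and> Q M x y" if "x \<in> ext M D0" for x
    using that Qun unfolding D0(2) by blast
  obtain g1 where g1: "is_fun M g1 D0" "\<And>x. x \<in> ext M D0 \<Longrightarrow> Q M x (app M g1 x)"
    using mk_fun[OF D0(1) Q] ex1 by blast
  have down: "e \<in> ext M D0" if d: "d \<in> ext M D0" and e: "e \<in> ext M D" "R M e d" for d e
  proof -
    obtain A g where 1: "A \<in> M" "g \<in> M" "att M A g" "d \<in> ext M A" using d D0(2) unfolding Q_def by blast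
    then have eA: "e \<in> ext M A" using e unfolding att_def by blast
    have "is_fun M g A" using 1(3) unfolding att_def by blast
    then have "Q M e (app M g e)" "app M g e \<in> M"
      using 1 eA app_maps app_in unfolding Q_def by blast+
    then show ?thesis using D0(2) e(1) by blast
  qed
  have rec: "\<exists>S\<in>M. ext M S = {v \<in> M. \<exists>e\<in>ext M D. R M e d \<and> maps_to M g1 e v} \<and>
       (\<exists>y\<in>M. maps_to M g1 d y \<and> \<Gamma> M S y)" if d: "d \<in> ext M D0" for d
  proof -
    obtain A g where 1: "A \<in> M" "g \<in> M" "att M A g" "d \<in> ext M A" using d D0(2) unfolding Q_def by blast
    have gf: "is_fun M g A" using 1(3) unfolding att_def by blast
    have same: "app M g1 e = app M g e" if "e \<in> ext M A" for e
    proof -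
      have "Q M e (app M g e)" using 1 that app_maps[OF gf] unfolding Q_def by blast
      moreover have "e \<in> ext M D0"
        using calculation that 1(3) app_in[OF gf that] unfolding D0(2) att_def by blast
      ultimately show ?thesis using g1(2) Qun by blast
    qed
    obtain S where S: "S \<in> M" "ext M S = {v \<in> M. \<exists>e\<in>ext M D. R M e d \<and> maps_to M g e v}"
      "\<Gamma> M S (app M g d)"
      using attE[OF 1(3,4)] by blast
    have pA: "e \<in> ext M A" if "e \<in> ext M D" "R M e d" for e using that 1(3,4) unfolding att_def by blast
    have "ext M S = {v \<in> M. \<exists>e\<in>ext M D. R M e d \<and> maps_to M g1 e v}"
      unfolding S(2) maps_to_iff[OF gf] maps_to_iff[OF g1(1)] using same pA down[OF d] by auto
    then show ?thesis using S same[OF 1(4)] app_maps[OF g1(1) d] app_in[OF g1(1) d] by metis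
  qed
  have att0: "att M D0 g1"
    unfolding att_def using g1(1) D0(2) down rec by blast
  have "ext M D0 = ext M D"
  proof (rule ccontr)
    assume "ext M D0 \<noteq> ext M D"
    then have "ext M D - ext M D0 \<noteq> {}" using D0(2) by blast
    then obtain d where d: "d \<in> ext M D" "d \<notin> ext M D0" and mn: "\<And>e. e \<in> ext M D \<Longrightarrow> R M e d \<Longrightarrow> e \<in> ext M D0"
      using wf[OF is_set_Diff[OF is_set_ext[OF D] is_set_ext[OF D0(1)]]] by blast
    have dM: "d \<in> M" using d ext_in by blast
    \<comment> \<open>\<open>d\<close> is a minimal point not covered. All its predecessors are
      covered, so \<open>g1\<close> extended by the value that \<open>\<Gamma>\<close> prescribes at
      \<open>d\<close> is an attempt, which puts \<open>d\<close> into \<open>D0\<close>.\<close>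
    obtain A2 where A2: "A2 \<in> M" "ext M A2 = insert d (ext M D0)"
      using is_set_insert[OF dM is_set_ext[OF D0(1)]] by (rule is_setE)
    have g1M: "g1 \<in> M" using g1(1) is_fun_in by blast
    have "is_set {v \<in> M. \<exists>e\<in>ext M D. R M e d \<and> maps_to M g1 e v}"
      by (rule is_set_repl[OF is_set_ext[OF D], where Q = "\<lambda>N e v. R N e d \<and> maps_to N g1 e v"])
        (intro dfn_intros Rt dM g1M, auto simp: maps_to_iff[OF g1(1)])
    then obtain S where S: "S \<in> M" "ext M S = {v \<in> M. \<exists>e\<in>ext M D. R M e d \<and> maps_to M g1 e v}"
      by (rule is_setE)
    obtain y where y: "y \<in> M" "\<Gamma> M S y" using fn[OF S(1)] by blast
    have ex2: "\<exists>!v. v \<in> M \<and> (maps_to M g1 x v \<or> x = d \<and> v = y)" if "x \<in> ext M A2" for x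
    proof (cases "x = d")
      case True
      then show ?thesis using d(2) y(1) maps_to_iff[OF g1(1)] by blast
    next
      case False
      then have "x \<in> ext M D0" using that A2(2) by blast
      then show ?thesis using False app_in[OF g1(1)] maps_to_iff[OF g1(1)]
        by (intro ex1I[of _ "app M g1 x"]) auto
    qed
    have "\<exists>g2. is_fun M g2 A2 \<and> (\<forall>x\<in>ext M A2. maps_to M g1 x (app M g2 x) \<or> x = d \<and> app M g2 x = y)"
      by (rule mk_fun[OF A2(1), where Q = "\<lambda>N x v. maps_to N g1 x v \<or> x = d \<and> v = y"])
        (intro dfn_intros g1M dM y, use ex2 in blast)
    then obtain g2 where g2: "is_fun M g2 A2"
      "\<And>x. x \<in> ext M A2 \<Longrightarrow> maps_to M g1 x (app M g2 x) \<or> x = d \<and> app M g2 x = y" by blast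
    have g2d: "app M g2 d = y" using g2(2)[of d] A2(2) d(2) maps_to_iff[OF g1(1)] by auto
    have g2e: "app M g2 e = app M g1 e" if "e \<in> ext M D0" for e
      using g2(2)[of e] A2(2) d(2) that maps_to_iff[OF g1(1)] by auto
    have pred: "e \<in> ext M D0" if "x \<in> ext M A2" "e \<in> ext M D" "R M e x" for x e
      using that mn down A2(2) by auto
    have same: "{v \<in> M. \<exists>e\<in>ext M D. R M e x \<and> maps_to M g1 e v} =
        {v \<in> M. \<exists>e\<in>ext M D. R M e x \<and> maps_to M g2 e v}" if "x \<in> ext M A2" for x
      unfolding maps_to_iff[OF g2(1)] maps_to_iff[OF g1(1)]
      using pred[OF that] g2e A2(2) by auto
    have "att M A2 g2"
      unfolding att_def
    proof (intro conjI ballI)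
      show "is_fun M g2 A2" by (rule g2)
      show "ext M A2 \<subseteq> ext M D" using d(1) unfolding A2(2) D0(2) by auto
      show "R M e x \<longrightarrow> e \<in> ext M A2" if "x \<in> ext M A2" "e \<in> ext M D" for x e
        using pred that A2(2) by blast
      show "\<exists>S\<in>M. ext M S = {v \<in> M. \<exists>e\<in>ext M D. R M e x \<and> maps_to M g2 e v} \<and>
         (\<exists>y\<in>M. maps_to M g2 x y \<and> \<Gamma> M S y)" if x: "x \<in> ext M A2" for x
      proof (cases "x = d")
        case True
        have "maps_to M g2 x y" using app_maps[OF g2(1) x] g2d True by simp
        moreover have "ext M S = {v \<in> M. \<exists>e\<in>ext M D. R M e x \<and> maps_to M g2 e v}"
          using S(2) same[OF x] True by simp
        ultimately show ?thesis using S(1) y by blast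
      next
        case False
        then have x0: "x \<in> ext M D0" using x A2(2) by blast
        have "maps_to M g1 x y \<longleftrightarrow> maps_to M g2 x y" for y
          using x x0 g2e[OF x0] unfolding maps_to_iff[OF g2(1)] maps_to_iff[OF g1(1)] by auto
        then show ?thesis using rec[OF x0] unfolding same[OF x] by simp
      qed
    qed
    then have "Q M d y" using A2 is_fun_in[OF g2(1)] app_maps[OF g2(1), of d] g2d unfolding Q_def by blast
    then show False using d y D0(2) by blast
  qed
  then have "D0 = D" using ext_inject D0(1) D by blast
  have "\<exists>S\<in>M. ext M S = app M g1 ` {e \<in> ext M D. R M e d} \<and> \<Gamma> M S (app M g1 d)"
    if "d \<in> ext M D" for d
  proof -
    have "{v \<in> M. \<exists>e\<in>ext M D. R M e d \<and> maps_to M g1 e v} = app M g1 ` {e \<in> ext M D. R M e d}"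
      unfolding maps_to_iff[OF g1(1)] \<open>D0 = D\<close> using app_in[OF g1(1)[unfolded \<open>D0 = D\<close>]] by auto
    then show ?thesis
      using rec[unfolded \<open>D0 = D\<close>, OF that] maps_to_iff[OF g1(1)] by metis
  qed
  then show ?thesis using g1(1)[unfolded \<open>D0 = D\<close>] by blast
qed

section \<open>Choice and collection\<close>

lemma mem_irrefl: "x \<in> M \<Longrightarrow> x \<notin> ext M x"
  using foundation_set[OF is_set_single, of x] by auto

lemma mem_asym: "x \<in> ext M y \<Longrightarrow> y \<in> ext M x \<Longrightarrow> False"
  using foundation_set[OF is_set_pair, of x y] ext_in by auto

lemma succ_ex: "n \<in> M \<Longrightarrow> \<exists>m\<in>M. ext M m = insert n (ext M n)"
  using is_set_insert is_set_ext unfolding is_set_def by blast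

lemma succ_inject:
  assumes "k \<in> M" "k' \<in> M" "insert k (ext M k) = insert k' (ext M k')" shows "k = k'"
proof (rule ccontr)
  assume "k \<noteq> k'"
  then have "k \<in> ext M k'" "k' \<in> ext M k" using assms(3) by (metis insert_iff)+
  then show False by (rule mem_asym)
qed

lemma natural_zero: "z \<in> M \<Longrightarrow> ext M z = {} \<Longrightarrow> natural M z"
  unfolding natural_def ordinal_def trans_set_def by simp

lemma natural_succ:
  assumes n: "natural M n" and m: "m \<in> M" "ext M m = insert n (ext M n)"
  shows "natural M m"
proof -
  have "n \<in> M" "trans_set M n" "\<forall>y\<in>ext M n. trans_set M y"
    using n unfolding natural_def ordinal_def by auto
  then show ?thesis using n m unfolding natural_def ordinal_def trans_set_def by auto
qed

lemma natural_elem: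
  assumes n: "natural M n" and k: "k \<in> ext M n"
  shows "natural M k"
proof -
  have "n \<in> M" "trans_set M n" "\<forall>y\<in>ext M n. trans_set M y"
    using n unfolding natural_def ordinal_def by auto
  moreover then have "ext M k \<subseteq> ext M n" using k unfolding trans_set_def by blast
  ultimately show ?thesis using n k ext_in[OF k] unfolding natural_def ordinal_def by auto
qed

text \<open>Naturals are those of the model, so there is no external induction. If a natural
  \<open>n\<close> were outside the inductive set \<open>a\<close>, Foundation applied to the
  members of its successor outside \<open>a\<close> would give a least one; that is zero or a
  successor, and both lie in \<open>a\<close>. Separation inside \<open>a\<close> then yields
  omega.\<close>

lemma omega_spec: "omega M \<in> M \<and> ext M (omega M) = {n. natural M n}"
proof -
  obtain a z where a: "a \<in> M" "z \<in> ext M a" "ext M z = {}"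
    "\<And>x. x \<in> ext M a \<Longrightarrow> \<exists>y\<in>ext M a. ext M y = insert x (ext M x)"
    using ZFC_M unfolding ZFC_def infinity_def by blast
  have "n \<in> ext M a" if n: "natural M n" for n
  proof (rule ccontr)
    assume "n \<notin> ext M a"
    have nM: "n \<in> M" "trans_set M n" using n unfolding natural_def ordinal_def by auto
    have "is_set (insert n (ext M n) - ext M a)"
      by (intro is_set_Diff is_set_insert is_set_ext nM a)
    then obtain m where m: "m \<in> insert n (ext M n)" "m \<notin> ext M a"
      "ext M m \<inter> (insert n (ext M n) - ext M a) = {}"
      using foundation_set \<open>n \<notin> ext M a\<close> by blast
    have mM: "m \<in> M" using m(1) nM ext_in by blast
    have "ext M m \<subseteq> ext M n" using m(1) nM(2) unfolding trans_set_def by blast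
    then have sub: "ext M m \<subseteq> ext M a" using m(3) by blast
    consider "ext M m = {}" | k where "k \<in> M" "ext M m = insert k (ext M k)"
      using m(1) n unfolding natural_def by blast
    then have "m \<in> ext M a"
    proof cases
      case 1
      then show ?thesis using a(2,3) ext_inject[OF mM] ext_in by metis
    next
      case 2
      then obtain y where "y \<in> ext M a" "ext M y = ext M m" using a(4)[of k] sub by auto
      then show ?thesis using ext_inject[OF mM] ext_in by metis
    qed
    then show False using m(2) by blast
  qed
  then have "is_set {n. natural M n}"
    by (intro is_set_sub[OF is_set_ext[OF a(1)], where P = natural]) (intro dfn_intros, auto)
  then obtain w where "w \<in> M" "ext M w = {n. natural M n}" by (rule is_setE)
  then have "\<exists>!w. w \<in> M \<and> ext M w = {n. natural M n}" using ext_inject by metis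
  then show ?thesis unfolding omega_def by (rule theI')
qed

lemma omega_in: "omega M \<in> M" and in_omega: "n \<in> ext M (omega M) \<longleftrightarrow> natural M n"
  using omega_spec by auto

lemma zero_ex: "\<exists>z\<in>ext M (omega M). ext M z = {}"
proof -
  obtain z where z: "z \<in> M" "ext M z = {}" using is_set_empty by (rule is_setE)
  then have "z \<in> ext M (omega M)" using natural_zero in_omega by simp
  then show ?thesis using z(2) by blast
qed

lemma omega_succ: "n \<in> ext M (omega M) \<Longrightarrow> \<exists>m\<in>ext M (omega M). ext M m = insert n (ext M n)"
proof -
  assume n: "n \<in> ext M (omega M)"
  then obtain m where m: "m \<in> M" "ext M m = insert n (ext M n)" using succ_ex[OF ext_in] by blast
  then have "m \<in> ext M (omega M)" using natural_succ n in_omega by simp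
  then show ?thesis using m(2) by blast
qed

text \<open>An instance of \<open>wf_rec\<close> for the relation of immediate succession, which is
  well-founded by Foundation because a predecessor is an element.\<close>

lemma omega_iterate:
  assumes a: "a \<in> M" and G: "DM (\<lambda>N s. G N (s 0) (s 1))"
    and un: "\<And>v. v \<in> M \<Longrightarrow> \<exists>!w. w \<in> M \<and> G M v w"
  shows "\<exists>F. is_fun M F (omega M) \<and>
    (\<forall>z\<in>ext M (omega M). ext M z = {} \<longrightarrow> app M F z = a) \<and>
    (\<forall>n\<in>ext M (omega M). \<forall>m\<in>ext M (omega M). ext M m = insert n (ext M n) \<longrightarrow>
       G M (app M F n) (app M F m))"
proof -
  note Gt = dfn_subst2[OF G]
  let ?R = "\<lambda>N e d. ext N d = insert e (ext N e)"
  \<comment> \<open>The set \<open>S\<close> of earlier values is a singleton at a successor and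
    empty at zero; a singleton is fed to \<open>G\<close>, and anything else gives the initial value
    \<open>a\<close>.\<close>
  let ?\<Gamma> = "\<lambda>N S y. (\<exists>v\<in>N. ext N S = {v} \<and> G N v y) \<or> (\<not> (\<exists>v\<in>N. ext N S = {v}) \<and> y = a)"
  have "\<exists>h. is_fun M h (omega M) \<and> (\<forall>d\<in>ext M (omega M). \<exists>S\<in>M.
    ext M S = app M h ` {e \<in> ext M (omega M). ?R M e d} \<and> ?\<Gamma> M S (app M h d))"
  proof (rule wf_rec[where R = ?R and \<Gamma> = ?\<Gamma>])
    show "DM (\<lambda>N s. ?R N (s 0) (s 1))" by (intro dfn_intros)
    show "DM (\<lambda>N s. ?\<Gamma> N (s 0) (s 1))" by (intro dfn_intros Gt a)
    show "\<exists>d\<in>S. \<forall>e\<in>S. \<not> ?R M e d" if "is_set S" "S \<noteq> {}" for S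
      using foundation_set[OF that] by blast
    show "\<exists>!y. y \<in> M \<and> ?\<Gamma> M S y" if "S \<in> M" for S
    proof (cases "\<exists>v\<in>M. ext M S = {v}")
      case True
      then obtain v where v: "v \<in> M" "ext M S = {v}" by blast
      then have "?\<Gamma> M S y \<longleftrightarrow> G M v y" for y by auto
      then show ?thesis using un[OF v(1)] by simp
    next
      case False
      then show ?thesis using a by auto
    qed
  qed (rule omega_in)
  then obtain h where h: "is_fun M h (omega M)"
    "\<And>d. d \<in> ext M (omega M) \<Longrightarrow> \<exists>S\<in>M. ext M S = app M h ` {e \<in> ext M (omega M). ?R M e d} \<and> ?\<Gamma> M S (app M h d)"
    by blast
  have "app M h z = a" if z: "z \<in> ext M (omega M)" "ext M z = {}" for z
  proof -
    have "{e \<in> ext M (omega M). ?R M e z} = {}" using z(2) by blast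
    then show ?thesis using h(2)[OF z(1)] by auto
  qed
  moreover have "G M (app M h n) (app M h m)"
    if nm: "n \<in> ext M (omega M)" "m \<in> ext M (omega M)" "ext M m = insert n (ext M n)" for n m
  proof -
    have "{e \<in> ext M (omega M). ?R M e m} = {n}"
      using nm succ_inject ext_in by (auto simp del: insert_iff)
    then show ?thesis using h(2)[OF nm(2)] app_in[OF h(1) nm(1)] by auto
  qed
  ultimately show ?thesis using h(1) by blast
qed

section \<open>Transitive sets and epsilon-induction\<close>

lemma transitive_closure:
  assumes a: "a \<in> M" shows "\<exists>T\<in>M. trans_set M T \<and> ext M a \<subseteq> ext M T"
proof -
  let ?G = "\<lambda>N v w. ext N w = {z \<in> N. \<exists>y\<in>ext N v. z \<epsilon> y}"
  have un: "\<exists>!w. w \<in> M \<and> ?G M v w" if "v \<in> M" for v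
  proof -
    have "(\<Union>y\<in>ext M v. ext M y) = {z \<in> M. \<exists>y\<in>ext M v. z \<epsilon> y}" unfolding ext_def by blast
    then have "is_set {z \<in> M. \<exists>y\<in>ext M v. z \<epsilon> y}" using is_set_Union[OF is_set_ext[OF that]] by simp
    then show ?thesis using ext_inject unfolding is_set_def by metis
  qed
  have "\<exists>F. is_fun M F (omega M) \<and>
    (\<forall>z\<in>ext M (omega M). ext M z = {} \<longrightarrow> app M F z = a) \<and>
    (\<forall>n\<in>ext M (omega M). \<forall>m\<in>ext M (omega M). ext M m = insert n (ext M n) \<longrightarrow>
       ?G M (app M F n) (app M F m))"
    by (rule omega_iterate[where G = ?G, OF a]) (intro dfn_intros, rule un)
  then obtain F where F: "is_fun M F (omega M)"
    "\<forall>z\<in>ext M (omega M). ext M z = {} \<longrightarrow> app M F z = a"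
    "\<forall>n\<in>ext M (omega M). \<forall>m\<in>ext M (omega M). ext M m = insert n (ext M n) \<longrightarrow>
       ?G M (app M F n) (app M F m)"
    by (elim exE conjE)
  have "is_set {y \<in> M. \<exists>n\<in>ext M (omega M). maps_to M F n y}"
    by (rule is_set_repl[OF is_set_ext[OF omega_in], where Q = "\<lambda>N n y. maps_to N F n y"])
      (intro dfn_intros is_fun_in[OF F(1)], simp add: maps_to_iff[OF F(1)])
  from is_set_Union[OF this] obtain T where T: "T \<in> M"
    "ext M T = (\<Union>x\<in>{y \<in> M. \<exists>n\<in>ext M (omega M). maps_to M F n y}. ext M x)" by (rule is_setE)
  have T': "x \<in> ext M T \<longleftrightarrow> (\<exists>n\<in>ext M (omega M). x \<in> ext M (app M F n))" for x
    unfolding T(2) maps_to_iff[OF F(1)] using app_in[OF F(1)] by auto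
  have "trans_set M T" unfolding trans_set_def
  proof (intro ballI subsetI)
    fix y z assume "y \<in> ext M T" and z: "z \<in> ext M y"
    then obtain n where n: "n \<in> ext M (omega M)" "y \<in> ext M (app M F n)" unfolding T' by blast
    obtain m where m: "m \<in> ext M (omega M)" "ext M m = insert n (ext M n)" using omega_succ[OF n(1)] by blast
    have "ext M (app M F m) = {z \<in> M. \<exists>y\<in>ext M (app M F n). z \<epsilon> y}" using F(3) n(1) m by blast
    then have "z \<in> ext M (app M F m)" using n(2) z in_ext_iff[of z y] by blast
    then show "z \<in> ext M T" unfolding T' using m(1) by blast
  qed
  moreover have "ext M a \<subseteq> ext M T" using zero_ex F(2) T' by auto
  ultimately show ?thesis using T(1) by blast
qed

lemma transitive_containing:
  assumes a: "a \<in> M" shows "\<exists>T\<in>M. trans_set M T \<and> a \<in> ext M T"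
proof -
  obtain b where "b \<in> M" "ext M b = {a}" using is_set_single[OF a] by (rule is_setE)
  then show ?thesis using transitive_closure[of b] by auto
qed

text \<open>Foundation concerns sets, whereas the counterexamples to \<open>P\<close> may form a
  proper class. Those inside a transitive set containing \<open>x\<close> form a set, and a minimal
  one has no counterexample among its elements.\<close>

lemma eps_induct:
  assumes P: "DM (\<lambda>N s. P N (s 0))"
    and step: "\<And>x. x \<in> M \<Longrightarrow> (\<And>y. y \<in> ext M x \<Longrightarrow> P M y) \<Longrightarrow> P M x"
    and x: "x \<in> M"
  shows "P M x"
proof (rule ccontr)
  assume n: "\<not> P M x"
  obtain T where T: "T \<in> M" "trans_set M T" "x \<in> ext M T" using transitive_containing[OF x] by blast
  have "is_set {y \<in> ext M T. \<not> P M y}"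
    by (rule is_set_sep[OF is_set_ext[OF T(1)]]) (intro dfn_intros P)
  moreover have "{y \<in> ext M T. \<not> P M y} \<noteq> {}" using T(3) n by blast
  ultimately obtain y where y: "y \<in> ext M T" "\<not> P M y" "ext M y \<inter> {y \<in> ext M T. \<not> P M y} = {}"
    using foundation_set by (metis (mono_tags, lifting) mem_Collect_eq)
  have "P M z" if "z \<in> ext M y" for z
    using y(1,3) T(2) that unfolding trans_set_def by blast
  then show False using step[of y] y(1,2) ext_in by blast
qed

text \<open>
  \<open>rk a\<close> is the union of the power sets of \<open>rk b\<close> for \<open>b \<in> a\<close>, that is, the level of the
  cumulative hierarchy at the rank of \<open>a\<close>, obtained without ordinals.
\<close>

definition is_rk :: "'v set \<Rightarrow> 'v \<Rightarrow> 'v \<Rightarrow> bool" where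
  "is_rk N a y \<longleftrightarrow> (\<exists>T\<in>N. \<exists>h\<in>N. trans_set N T \<and> a \<in> ext N T \<and> is_fun N h T \<and>
     (\<forall>d\<in>ext N T. \<forall>v\<in>N. (\<exists>w\<in>N. maps_to N h d w \<and> v \<epsilon> w) \<longleftrightarrow>
        (\<exists>e\<in>ext N d. \<exists>w\<in>N. maps_to N h e w \<and> ext N v \<subseteq> ext N w)) \<and> maps_to N h a y)"

text \<open>The recursion of \<open>is_rk\<close> restated with \<open>app\<close> for a function on
  a transitive set; \<open>is_rk_iff\<close> links this working form with the definable one.\<close>

definition rk_fun :: "'v \<Rightarrow> 'v \<Rightarrow> bool" where
  "rk_fun T h \<longleftrightarrow> T \<in> M \<and> trans_set M T \<and> is_fun M h T \<and>
     (\<forall>d\<in>ext M T. ext M (app M h d) = {v \<in> M. \<exists>e\<in>ext M d. ext M v \<subseteq> ext M (app M h e)})"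

lemma is_rk_iff: "is_rk M a y \<longleftrightarrow> (\<exists>T h. rk_fun T h \<and> a \<in> ext M T \<and> y = app M h a)"
proof -
  have *: "(\<forall>v\<in>M. (\<exists>w\<in>M. maps_to M h d w \<and> v \<epsilon> w) \<longleftrightarrow>
        (\<exists>e\<in>ext M d. \<exists>w\<in>M. maps_to M h e w \<and> ext M v \<subseteq> ext M w)) \<longleftrightarrow>
      ext M (app M h d) = {v \<in> M. \<exists>e\<in>ext M d. ext M v \<subseteq> ext M (app M h e)}"
    if T: "trans_set M T" "is_fun M h T" "d \<in> ext M T" for T h d
  proof -
    have "ext M d \<subseteq> ext M T" using T(1,3) unfolding trans_set_def by blast
    then have 1: "(\<exists>e\<in>ext M d. \<exists>w\<in>M. maps_to M h e w \<and> ext M v \<subseteq> ext M w) \<longleftrightarrow>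
      (\<exists>e\<in>ext M d. ext M v \<subseteq> ext M (app M h e))" for v
      unfolding maps_to_iff[OF T(2)] using app_in[OF T(2)] by blast
    have 2: "(\<exists>w\<in>M. maps_to M h d w \<and> v \<epsilon> w) \<longleftrightarrow> v \<epsilon> app M h d" for v
      unfolding maps_to_iff[OF T(2)] using app_in[OF T(2,3)] T(3) by blast
    show ?thesis unfolding 1 2 ext_def[of M "app M h d"] by blast
  qed
  have "is_rk M a y \<longleftrightarrow> (\<exists>T h. T \<in> M \<and> h \<in> M \<and> trans_set M T \<and> a \<in> ext M T \<and> is_fun M h T \<and>
     (\<forall>d\<in>ext M T. \<forall>v\<in>M. (\<exists>w\<in>M. maps_to M h d w \<and> v \<epsilon> w) \<longleftrightarrow>
        (\<exists>e\<in>ext M d. \<exists>w\<in>M. maps_to M h e w \<and> ext M v \<subseteq> ext M w)) \<and> maps_to M h a y)"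
    unfolding is_rk_def by blast
  also have "\<dots> \<longleftrightarrow> (\<exists>T h. rk_fun T h \<and> a \<in> ext M T \<and> y = app M h a)"
  proof (intro iff_exI)
    fix T h
    show "(T \<in> M \<and> h \<in> M \<and> trans_set M T \<and> a \<in> ext M T \<and> is_fun M h T \<and>
     (\<forall>d\<in>ext M T. \<forall>v\<in>M. (\<exists>w\<in>M. maps_to M h d w \<and> v \<epsilon> w) \<longleftrightarrow>
        (\<exists>e\<in>ext M d. \<exists>w\<in>M. maps_to M h e w \<and> ext M v \<subseteq> ext M w)) \<and> maps_to M h a y) \<longleftrightarrow>
      (rk_fun T h \<and> a \<in> ext M T \<and> y = app M h a)" (is "?l \<longleftrightarrow> _")
    proof (cases "trans_set M T \<and> is_fun M h T")
      case True
      then have T: "trans_set M T" "is_fun M h T" by auto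
      show ?thesis
        unfolding rk_fun_def maps_to_iff[OF T(2), of a] using *[OF T] T is_fun_in[OF T(2)] by auto
    qed (auto simp: rk_fun_def)
  qed
  finally show ?thesis .
qed

lemma dfn_is_rk: "tm M x \<Longrightarrow> tm M y \<Longrightarrow> DM (\<lambda>N s. is_rk N (x s) (y s))"
  by (rule dfn_subst2[where R = is_rk]) (unfold is_rk_def, intro dfn_intros)

lemma rk_fun_agree:
  assumes "rk_fun T h" "rk_fun T' h'" "a \<in> ext M T" "a \<in> ext M T'"
  shows "app M h a = app M h' a"
proof (rule ccontr)
  assume ne: "app M h a \<noteq> app M h' a"
  have T: "T \<in> M" "trans_set M T" "is_fun M h T" "T' \<in> M" "trans_set M T'" "is_fun M h' T'"
    and h: "\<And>d. d \<in> ext M T \<Longrightarrow> ext M (app M h d) = {v \<in> M. \<exists>e\<in>ext M d. ext M v \<subseteq> ext M (app M h e)}"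
    and h': "\<And>d. d \<in> ext M T' \<Longrightarrow> ext M (app M h' d) = {v \<in> M. \<exists>e\<in>ext M d. ext M v \<subseteq> ext M (app M h' e)}"
    using assms unfolding rk_fun_def by auto
  define B where "B = {d \<in> ext M T. d \<in> ext M T' \<and> app M h d \<noteq> app M h' d}"
  have "is_set B"
    by (rule is_set_sub[OF is_set_ext[OF T(1)], where P = "\<lambda>N d. d \<in> ext N T' \<and>
        (\<exists>y\<in>N. \<exists>y'\<in>N. maps_to N h d y \<and> maps_to N h' d y' \<and> y \<noteq> y')"])
      (intro dfn_intros T is_fun_in[OF T(3)] is_fun_in[OF T(6)],
        auto simp: B_def maps_to_iff[OF T(3)] maps_to_iff[OF T(6)] app_in[OF T(3)] app_in[OF T(6)])
  then obtain d where d: "d \<in> B" "ext M d \<inter> B = {}" using foundation_set[of B] assms ne unfolding B_def by blast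
  then have dT: "d \<in> ext M T" "d \<in> ext M T'" "app M h d \<noteq> app M h' d" unfolding B_def by auto
  have "app M h e = app M h' e" if "e \<in> ext M d" for e
    using that d(2) T(2,5) dT unfolding B_def trans_set_def by blast
  then have "ext M (app M h d) = ext M (app M h' d)" unfolding h[OF dT(1)] h'[OF dT(2)] by simp
  then show False using dT ext_inject app_in T(3,6) by blast
qed

lemma is_set_Union_Pow:
  assumes "is_set S" shows "is_set {v \<in> M. \<exists>u\<in>S. ext M v \<subseteq> ext M u}"
proof -
  have "is_set {p \<in> M. \<exists>u\<in>S. ext M p = {v \<in> M. ext M v \<subseteq> ext M u}}"
    by (rule is_set_repl[OF assms, where Q = "\<lambda>N u p. ext N p = {v \<in> N. ext N v \<subseteq> ext N u}"])
      (intro dfn_intros, simp add: ext_inject)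
  then have "is_set (\<Union>p\<in>{p \<in> M. \<exists>u\<in>S. ext M p = {v \<in> M. ext M v \<subseteq> ext M u}}. ext M p)"
    by (rule is_set_Union)
  moreover have "(\<Union>p\<in>{p \<in> M. \<exists>u\<in>S. ext M p = {v \<in> M. ext M v \<subseteq> ext M u}}. ext M p) =
      {v \<in> M. \<exists>u\<in>S. ext M v \<subseteq> ext M u}" (is "?l = ?r")
  proof
    show "?r \<subseteq> ?l"
    proof
      fix v assume "v \<in> ?r"
      then obtain u where u: "v \<in> M" "u \<in> S" "ext M v \<subseteq> ext M u" by blast
      have "is_set {v \<in> M. ext M v \<subseteq> ext M u}"
        using is_set_Pow is_set_ext is_set_in[OF assms u(2)] by blast
      then obtain p where "p \<in> M" "ext M p = {v \<in> M. ext M v \<subseteq> ext M u}" by (rule is_setE)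
      then show "v \<in> ?l" using u by blast
    qed
  qed auto
  ultimately show ?thesis by simp
qed

lemma rk_fun_ex:
  assumes T: "T \<in> M" "trans_set M T" shows "\<exists>h. rk_fun T h"
proof -
  let ?\<Gamma> = "\<lambda>N S y. ext N y = {v \<in> N. \<exists>u\<in>ext N S. ext N v \<subseteq> ext N u}"
  have "\<exists>h. is_fun M h T \<and> (\<forall>d\<in>ext M T. \<exists>S\<in>M.
    ext M S = app M h ` {e \<in> ext M T. e \<epsilon> d} \<and> ?\<Gamma> M S (app M h d))"
  proof (rule wf_rec[where R = "\<lambda>N e d. e \<epsilon> d" and \<Gamma> = ?\<Gamma>])
    show "DM (\<lambda>N s. s 0 \<epsilon> s 1)" by (intro dfn_intros)
    show "DM (\<lambda>N s. ?\<Gamma> N (s 0) (s 1))" by (intro dfn_intros)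
    show "\<exists>d\<in>S. \<forall>e\<in>S. \<not> e \<epsilon> d" if "is_set S" "S \<noteq> {}" for S
      using foundation_set[OF that] is_set_in[OF that(1)] unfolding ext_def by blast
    show "\<exists>!y. y \<in> M \<and> ?\<Gamma> M S y" if "S \<in> M" for S
      using is_set_Union_Pow[OF is_set_ext[OF that]] ext_inject unfolding is_set_def by metis
  qed (rule T)
  then obtain h where h: "is_fun M h T" "\<forall>d\<in>ext M T. \<exists>S\<in>M.
    ext M S = app M h ` {e \<in> ext M T. e \<epsilon> d} \<and> ?\<Gamma> M S (app M h d)" by (elim exE conjE)
  have "ext M (app M h d) = {v \<in> M. \<exists>e\<in>ext M d. ext M v \<subseteq> ext M (app M h e)}" if d: "d \<in> ext M T" for d
  proof -
    have "{e \<in> ext M T. e \<epsilon> d} = ext M d" using T(2) d unfolding trans_set_def ext_def by blast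
    then obtain S where "S \<in> M" "ext M S = app M h ` ext M d" "?\<Gamma> M S (app M h d)" using h(2) d by auto
    then show ?thesis by simp
  qed
  then show ?thesis using h(1) T unfolding rk_fun_def by blast
qed

definition rk :: "'v \<Rightarrow> 'v" where
  "rk a = (THE y. is_rk M a y)"

lemma rk_app: "rk_fun T h \<Longrightarrow> a \<in> ext M T \<Longrightarrow> rk a = app M h a"
  unfolding rk_def is_rk_iff using rk_fun_agree by (intro the_equality) blast+

lemma is_rk_rk: "a \<in> M \<Longrightarrow> is_rk M a y \<longleftrightarrow> y = rk a"
  using transitive_containing[of a] rk_fun_ex rk_app unfolding is_rk_iff by metis

lemma rk_in: "a \<in> M \<Longrightarrow> rk a \<in> M"
  using is_rk_rk[of a "rk a"] unfolding is_rk_def using maps_to_in by blast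

lemma ext_rk: "a \<in> M \<Longrightarrow> ext M (rk a) = {v \<in> M. \<exists>b\<in>ext M a. ext M v \<subseteq> ext M (rk b)}"
proof -
  assume "a \<in> M"
  then obtain T where T: "T \<in> M" "trans_set M T" "a \<in> ext M T" using transitive_containing by blast
  obtain h where h: "rk_fun T h" using rk_fun_ex[OF T(1,2)] by blast
  have "rk b = app M h b" if "b \<in> ext M a" for b
    using that T h rk_app unfolding trans_set_def by blast
  then show ?thesis using h rk_app[OF h T(3)] T(3) unfolding rk_fun_def by simp
qed

lemma rk_mono: "a \<in> M \<Longrightarrow> b \<in> ext M a \<Longrightarrow> ext M (rk b) \<subseteq> ext M (rk a)"
proof -
  let ?P = "\<lambda>N a. \<forall>b\<in>ext N a. \<exists>u\<in>N. \<exists>w\<in>N. is_rk N b u \<and> is_rk N a w \<and> ext N u \<subseteq> ext N w"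
  assume a: "a \<in> M" and b: "b \<in> ext M a"
  have "?P M a"
  proof (rule eps_induct[where P = ?P, OF _ _ a])
    show "DM (\<lambda>N s. ?P N (s 0))" by (intro dfn_intros dfn_is_rk)
    fix a assume a: "a \<in> M" and IH: "\<And>b. b \<in> ext M a \<Longrightarrow> ?P M b"
    show "?P M a"
    proof
      fix b assume b: "b \<in> ext M a"
      have "ext M (rk b) \<subseteq> ext M (rk a)"
      proof
        fix v assume v: "v \<in> ext M (rk b)"
        then obtain c where c: "c \<in> ext M b" "ext M v \<subseteq> ext M (rk c)" using ext_rk[OF ext_in[OF b]] by blast
        have "ext M (rk c) \<subseteq> ext M (rk b)" using IH[OF b] c(1) is_rk_rk ext_in b by metis
        then show "v \<in> ext M (rk a)" using c(2) b v ext_in[OF v] unfolding ext_rk[OF a] by blast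
      qed
      then show "\<exists>u\<in>M. \<exists>w\<in>M. is_rk M b u \<and> is_rk M a w \<and> ext M u \<subseteq> ext M w"
        using a b ext_in is_rk_rk rk_in by metis
    qed
  qed
  then show ?thesis using a b is_rk_rk ext_in by metis
qed

lemma rk_elem_subset: "a \<in> M \<Longrightarrow> v \<in> ext M (rk a) \<Longrightarrow> ext M v \<subseteq> ext M (rk a)"
  using ext_rk rk_mono by blast

lemma subset_rk: "a \<in> M \<Longrightarrow> ext M a \<subseteq> ext M (rk a)"
proof -
  let ?P = "\<lambda>N a. \<exists>w\<in>N. is_rk N a w \<and> ext N a \<subseteq> ext N w"
  assume a: "a \<in> M"
  have "?P M a"
  proof (rule eps_induct[where P = ?P, OF _ _ a])
    show "DM (\<lambda>N s. ?P N (s 0))" by (intro dfn_intros dfn_is_rk)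
    fix a assume a: "a \<in> M" and IH: "\<And>b. b \<in> ext M a \<Longrightarrow> ?P M b"
    have "ext M b \<subseteq> ext M (rk b)" if "b \<in> ext M a" for b
      using IH[OF that] by (simp add: is_rk_rk[OF ext_in[OF that]])
    then have "ext M a \<subseteq> ext M (rk a)"
      using ext_in unfolding ext_rk[OF a] by blast
    then show "?P M a" using a is_rk_rk rk_in by metis
  qed
  then show ?thesis using a is_rk_rk by metis
qed

lemma rk_dichotomy:
  assumes z: "z \<in> M" and b: "b \<in> M"
  shows "(\<forall>v\<in>M. ext M v \<subseteq> ext M (rk z) \<longrightarrow> v \<in> ext M (rk b)) \<or> ext M (rk b) \<subseteq> ext M (rk z)"
proof -
  let ?D = "\<lambda>N z b. \<exists>u\<in>N. \<exists>w\<in>N. is_rk N z u \<and> is_rk N b w \<and>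
    ((\<forall>v\<in>N. ext N v \<subseteq> ext N u \<longrightarrow> v \<in> ext N w) \<or> ext N w \<subseteq> ext N u)"
  define D where "D z b \<longleftrightarrow>
    (\<forall>v\<in>M. ext M v \<subseteq> ext M (rk z) \<longrightarrow> v \<in> ext M (rk b)) \<or> ext M (rk b) \<subseteq> ext M (rk z)" for z b
  have D: "?D M z b \<longleftrightarrow> D z b" if "z \<in> M" "b \<in> M" for z b
    using that rk_in by (simp add: is_rk_rk D_def)
  have "\<forall>b\<in>M. ?D M z b"
  proof (rule eps_induct[where P = "\<lambda>N z. \<forall>b\<in>N. ?D N z b", OF _ _ z])
    show "DM (\<lambda>N s. \<forall>b\<in>N. ?D N (s 0) b)" by (intro dfn_intros dfn_is_rk)
    fix z assume z: "z \<in> M" and "\<And>x. x \<in> ext M z \<Longrightarrow> \<forall>b\<in>M. ?D M x b"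
    then have IH1: "D x b" if "x \<in> ext M z" "b \<in> M" for x b using that D[OF ext_in] by metis
    show "\<forall>b\<in>M. ?D M z b"
    proof
      fix b assume b: "b \<in> M"
      show "?D M z b"
      proof (rule eps_induct[where P = "\<lambda>N b. ?D N z b", OF _ _ b])
        show "DM (\<lambda>N s. ?D N z (s 0))" by (intro dfn_intros dfn_is_rk z)
        fix b assume b: "b \<in> M" and "\<And>y. y \<in> ext M b \<Longrightarrow> ?D M z y"
        then have IH2: "D z y" if "y \<in> ext M b" for y using that D[OF z ext_in] by metis
        have "D z b" unfolding D_def
        proof (rule disjCI)
          assume "\<not> ext M (rk b) \<subseteq> ext M (rk z)"
          then obtain v where v: "v \<in> ext M (rk b)" "v \<notin> ext M (rk z)" by blast
          obtain y where y: "y \<in> ext M b" "ext M v \<subseteq> ext M (rk y)" using v(1) ext_rk[OF b] by blast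
          have yM: "y \<in> M" using y(1) ext_in by blast
          have yb: "ext M (rk y) \<subseteq> ext M (rk b)" using rk_mono[OF b y(1)] .
          from IH2[OF y(1)] show "\<forall>v\<in>M. ext M v \<subseteq> ext M (rk z) \<longrightarrow> v \<in> ext M (rk b)"
            unfolding D_def
          proof
            assume "ext M (rk y) \<subseteq> ext M (rk z)"
            \<comment> \<open>An element \<open>w\<close> of \<open>rk z\<close> outside
              \<open>rk y\<close> appears at some \<open>rk x\<close> with \<open>x\<close> in
              \<open>z\<close>. The outer induction hypothesis puts \<open>rk y\<close> inside
              \<open>rk x\<close>, and then \<open>v\<close> would be in \<open>rk z\<close>. So
              \<open>rk z\<close> and \<open>rk y\<close> have the same elements, and
              \<open>y\<close> in \<open>b\<close> gives the first alternative.\<close>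
            have "ext M (rk z) \<subseteq> ext M (rk y)"
            proof (rule ccontr)
              assume "\<not> ext M (rk z) \<subseteq> ext M (rk y)"
              then obtain w where w: "w \<in> ext M (rk z)" "w \<notin> ext M (rk y)" by blast
              obtain x where x: "x \<in> ext M z" "ext M w \<subseteq> ext M (rk x)" using w(1) ext_rk[OF z] by blast
              have "ext M (rk y) \<subseteq> ext M (rk x)"
                using IH1[OF x(1) yM] w x(2) ext_in[OF w(1)] unfolding D_def by blast
              then have "v \<in> ext M (rk z)" using y(2) x(1) ext_in[OF v(1)] unfolding ext_rk[OF z] by blast
              then show False using v(2) by blast
            qed
            then show ?thesis using y(1) unfolding ext_rk[OF b] by blast
          qed (use yb in blast)
        qed
        then show "?D M z b" using D z b by blast
      qed
    qed
  qed
  then show ?thesis using b z D unfolding D_def by blast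
qed

text \<open>Scott's trick.\<close>

lemma collection:
  assumes X: "X \<in> M" and Q: "DM (\<lambda>N s. Q N (s 0) (s 1))"
    and ex: "\<And>x. x \<in> ext M X \<Longrightarrow> \<exists>y\<in>M. Q M x y"
  shows "\<exists>B\<in>M. \<forall>x\<in>ext M X. \<exists>y\<in>ext M B. Q M x y"
proof -
  note Qt = dfn_subst2[OF Q]
  define mn where "mn x = {y \<in> M. Q M x y \<and> (\<forall>y'\<in>M. Q M x y' \<longrightarrow> ext M (rk y) \<subseteq> ext M (rk y'))}" for x
  define le where "le N y y' \<longleftrightarrow> (\<exists>r\<in>N. \<exists>r'\<in>N. is_rk N y r \<and> is_rk N y' r' \<and> ext N r \<subseteq> ext N r')" for N y y'
  have "DM (\<lambda>N s. le N (s 0) (s 1))" unfolding le_def by (intro dfn_intros dfn_is_rk)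
  note dfn_le = dfn_subst2[OF this]
  have le: "le M y y' \<longleftrightarrow> ext M (rk y) \<subseteq> ext M (rk y')" if "y \<in> M" "y' \<in> M" for y y'
    using that rk_in by (simp add: is_rk_rk le_def)
  have mn: "mn x \<noteq> {} \<and> is_set (mn x)" if x: "x \<in> ext M X" for x
  proof -
    have xM: "x \<in> M" using x ext_in by blast
    obtain y0 where y0: "y0 \<in> M" "Q M x y0" using ex[OF x] by blast
    \<comment> \<open>Foundation yields an element-minimal level among those of witnesses below the
      level of \<open>y0\<close>; by \<open>rk_dichotomy\<close> it is least under inclusion among
      the levels of all witnesses.\<close>
    define S where "S = {r \<in> M. ext M r \<subseteq> ext M (rk y0) \<and> (\<exists>y\<in>M. r = rk y \<and> Q M x y)}"
    have "is_set S"
      by (rule is_set_sub[OF is_set_Pow[OF is_set_ext[OF rk_in[OF y0(1)]]], where P =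
          "\<lambda>N r. \<exists>y\<in>N. is_rk N y r \<and> Q N x y"])
        (intro dfn_intros Qt dfn_is_rk xM, auto simp: S_def is_rk_rk)
    moreover have "rk y0 \<in> S" using y0 rk_in unfolding S_def by blast
    ultimately obtain r where r: "r \<in> S" "ext M r \<inter> S = {}" using foundation_set by blast
    then obtain y where y: "y \<in> M" "r = rk y" "Q M x y" "ext M (rk y) \<subseteq> ext M (rk y0)" unfolding S_def by blast
    have min: "ext M (rk y) \<subseteq> ext M (rk y')" if y': "y' \<in> M" "Q M x y'" for y'
    proof (rule ccontr)
      assume "\<not> ext M (rk y) \<subseteq> ext M (rk y')"
      then have "rk y' \<in> ext M (rk y)" using rk_dichotomy[OF y'(1) y(1)] rk_in[OF y'(1)] by blast
      moreover then have "rk y' \<in> S"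
        using y(4) rk_elem_subset[OF y0(1)] y' rk_in unfolding S_def by blast
      ultimately show False using r(2) y(2) by blast
    qed
    have "is_set (mn x)"
    proof (rule is_set_sub[OF is_set_Pow[OF is_set_ext[OF rk_in[OF y(1)]]], where P =
          "\<lambda>N y. Q N x y \<and> (\<forall>y'\<in>N. Q N x y' \<longrightarrow> le N y y')"])
      show "DM (\<lambda>N s. Q N x (s 0) \<and> (\<forall>y'\<in>N. Q N x y' \<longrightarrow>
          le N (s 0) y'))"
        by (intro dfn_intros Qt dfn_le xM)
      fix z
      have "z \<in> mn x \<longrightarrow> ext M z \<subseteq> ext M (rk y)" using subset_rk y unfolding mn_def by blast
      then show "(z \<in> mn x) = (z \<in> {v \<in> M. ext M v \<subseteq> ext M (rk y)} \<and> Q M x z \<and>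
          (\<forall>y'\<in>M. Q M x y' \<longrightarrow> le M z y'))"
        unfolding mn_def by (auto simp add: le cong: ball_cong conj_cong)
    qed
    then show ?thesis using min y unfolding mn_def by blast
  qed
  let ?Q = "\<lambda>N x W. ext N W = {y \<in> N. Q N x y \<and>
    (\<forall>y'\<in>N. Q N x y' \<longrightarrow> le N y y')}"
  have Q': "?Q M x W \<longleftrightarrow> ext M W = mn x" for x W
  proof -
    have "{y \<in> M. Q M x y \<and> (\<forall>y'\<in>M. Q M x y' \<longrightarrow> le M y y')} = mn x"
      unfolding mn_def by (auto simp add: le cong: ball_cong conj_cong)
    then show ?thesis by simp
  qed
  have "is_set {W \<in> M. \<exists>x\<in>ext M X. ?Q M x W}"
  proof (rule is_set_repl[OF is_set_ext[OF X], where Q = ?Q])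
    show "DM (\<lambda>N s. ?Q N (s 0) (s 1))" by (intro dfn_intros Qt dfn_le)
  qed (simp only: Q' ext_inject)
  from is_set_Union[OF this[unfolded Q']] obtain B where B: "B \<in> M"
    "ext M B = (\<Union>W\<in>{W \<in> M. \<exists>x\<in>ext M X. ext M W = mn x}. ext M W)" by (rule is_setE)
  have "\<exists>y\<in>ext M B. Q M x y" if x: "x \<in> ext M X" for x
  proof -
    obtain W where "W \<in> M" "ext M W = mn x" using mn[OF x] unfolding is_set_def by blast
    moreover obtain y where "y \<in> mn x" using mn[OF x] by blast
    moreover then have "Q M x y" unfolding mn_def by blast
    ultimately show ?thesis unfolding B(2) using x by blast
  qed
  then show ?thesis using B(1) by blast
qed

text \<open>Collection confines the witnesses to a set \<open>B\<close>. The axiom of choice here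
  needs pairwise disjoint families, so the witnesses for \<open>x\<close> are tagged as pairs with
  first component \<open>x\<close>; a selector for these sets is the graph of a choice
  function.\<close>

lemma choice_fun:
  assumes X: "X \<in> M" and Q: "DM (\<lambda>N s. Q N (s 0) (s 1))"
    and ex: "\<And>x. x \<in> ext M X \<Longrightarrow> \<exists>y\<in>M. Q M x y"
  shows "\<exists>f. is_fun M f X \<and> (\<forall>x\<in>ext M X. Q M x (app M f x))"
proof -
  note Qt = dfn_subst2[OF Q]
  obtain B where B: "B \<in> M" "\<And>x. x \<in> ext M X \<Longrightarrow> \<exists>y\<in>ext M B. Q M x y"
    using collection[OF X Q ex] by blast
  define Y where "Y N x = {p \<in> N. \<exists>y\<in>ext N B. Q N x y \<and> is_opair N p x y}" for N x
  have setY: "is_set (Y M x)" if "x \<in> ext M X" for x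
  proof -
    have xM: "x \<in> M" using that ext_in by blast
    show ?thesis unfolding Y_def
      by (rule is_set_repl[OF is_set_ext[OF B(1)], where Q = "\<lambda>N y p. Q N x y \<and> is_opair N p x y"])
        (intro dfn_intros Qt xM, use opair_unique in blast)
  qed
  have "is_set {W \<in> M. \<exists>x\<in>ext M X. ext M W = Y M x}"
    by (rule is_set_repl[OF is_set_ext[OF X], where Q = "\<lambda>N x W. ext N W = Y N x"])
      (unfold Y_def, intro dfn_intros Qt B(1), simp add: ext_inject)
  then obtain F where F: "F \<in> M" "ext M F = {W \<in> M. \<exists>x\<in>ext M X. ext M W = Y M x}" by (rule is_setE)
  have ne: "Y M x \<noteq> {}" if x: "x \<in> ext M X" for x
    using B(2)[OF x] opair_ex ext_in[OF x] ext_in unfolding Y_def by blast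
  have disj: "x = x'" if "p \<in> Y M x" "p \<in> Y M x'" for p x x'
    using that opair_inject unfolding Y_def by blast
  obtain c where c: "c \<in> M" "\<And>W. W \<in> ext M F \<Longrightarrow> \<exists>!z. z \<in> ext M c \<inter> ext M W"
  proof -
    have F': "W \<in> M \<and> (\<exists>x\<in>ext M X. ext M W = Y M x)" if "W \<in> ext M F" for W
      using that unfolding F(2) by blast
    have 1: "\<forall>x\<in>ext M F. ext M x \<noteq> {}" using ne F' by metis
    have "ext M W \<inter> ext M W' = {}" if W: "W \<in> ext M F" "W' \<in> ext M F" "W \<noteq> W'" for W W'
    proof (rule ccontr)
      assume "ext M W \<inter> ext M W' \<noteq> {}"
      then have "ext M W = ext M W'" using F'[OF W(1)] F'[OF W(2)] disj by blast
      then show False using W ext_inject F' by blast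
    qed
    then have 2: "\<forall>x\<in>ext M F. \<forall>y\<in>ext M F. x \<noteq> y \<longrightarrow> ext M x \<inter> ext M y = {}" by blast
    have "choice M" using ZFC_M unfolding ZFC_def by blast
    from this[unfolded choice_def, THEN bspec, OF F(1), THEN mp, OF 1, THEN mp, OF 2]
    show thesis using that by blast
  qed
  let ?Q = "\<lambda>N x y. y \<in> ext N B \<and> Q N x y \<and> (\<exists>p\<in>ext N c. is_opair N p x y)"
  have "\<exists>f. is_fun M f X \<and> (\<forall>x\<in>ext M X. ?Q M x (app M f x))"
  proof (rule mk_fun[OF X, where Q = ?Q])
    show "DM (\<lambda>N s. ?Q N (s 0) (s 1))" by (intro dfn_intros Qt B(1) c(1))
    fix x assume x: "x \<in> ext M X"
    obtain W where W: "W \<in> M" "ext M W = Y M x" using setY[OF x] by (rule is_setE)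
    have "W \<in> ext M F" using W x F(2) by blast
    then obtain z where z: "z \<in> ext M c" "z \<in> Y M x" "\<And>z'. z' \<in> ext M c \<Longrightarrow> z' \<in> Y M x \<Longrightarrow> z' = z"
      using c(2) W(2) by (metis IntE IntI)
    obtain y where y: "y \<in> ext M B" "Q M x y" "is_opair M z x y" using z(2) unfolding Y_def by blast
    show "\<exists>!y. y \<in> M \<and> ?Q M x y"
    proof (rule ex1I[of _ y])
      show "y \<in> M \<and> ?Q M x y" using y z(1) ext_in by blast
      fix y' assume y': "y' \<in> M \<and> ?Q M x y'"
      then obtain p where "p \<in> ext M c" "is_opair M p x y'" by blast
      moreover then have "p = z" using y' z(3) ext_in unfolding Y_def by blast
      ultimately show "y' = y" using y(3) opair_inject by blast
    qed
  qed
  then show ?thesis by blast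
qed

end

section \<open>Ultrafilters and their ultrapowers\<close>

context set_structure
begin

text \<open>Relational forms of the ultrapower notions, free of definite descriptions, hence definable.\<close>

definition is_underlying :: "'v set \<Rightarrow> 'v \<Rightarrow> 'v \<Rightarrow> bool" where
  "is_underlying N U X \<longleftrightarrow> ext N X = {x \<in> N. \<exists>A\<in>ext N U. x \<epsilon> A}"

definition ufn :: "'v set \<Rightarrow> 'v \<Rightarrow> 'v \<Rightarrow> bool" where
  "ufn N U f \<longleftrightarrow> (\<exists>X\<in>N. is_underlying N U X \<and> is_fun N f X)"

definition ueq :: "'v set \<Rightarrow> 'v \<Rightarrow> 'v \<Rightarrow> 'v \<Rightarrow> bool" where
  "ueq N U f g \<longleftrightarrow> (\<exists>X\<in>N. is_underlying N U X \<and> (\<exists>A\<in>ext N U. ext N A = {x \<in> ext N X.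
     \<exists>u\<in>N. maps_to N f x u \<and> maps_to N g x u}))"

definition umem :: "'v set \<Rightarrow> 'v \<Rightarrow> 'v \<Rightarrow> 'v \<Rightarrow> bool" where
  "umem N U f g \<longleftrightarrow> (\<exists>X\<in>N. is_underlying N U X \<and> (\<exists>A\<in>ext N U. ext N A = {x \<in> ext N X.
     \<exists>u\<in>N. \<exists>v\<in>N. maps_to N f x u \<and> maps_to N g x v \<and> u \<epsilon> v}))"

lemma dfn_is_underlying [dfn_intros]:
  "tm A x \<Longrightarrow> tm A y \<Longrightarrow> dfn C A (\<lambda>N s. is_underlying N (x s) (y s))"
  by (rule dfn_subst2[where R = is_underlying]) (unfold is_underlying_def, intro dfn_intros)

lemma dfn_ufn [dfn_intros]: "tm A x \<Longrightarrow> tm A y \<Longrightarrow> dfn C A (\<lambda>N s. ufn N (x s) (y s))"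
  by (rule dfn_subst2[where R = ufn]) (unfold ufn_def, intro dfn_intros)

lemma dfn_ueq [dfn_intros]: "tm A x \<Longrightarrow> tm A y \<Longrightarrow> tm A z \<Longrightarrow> dfn C A (\<lambda>N s. ueq N (x s) (y s) (z s))"
  by (rule dfn_subst3[where R = ueq]) (unfold ueq_def, intro dfn_intros)

lemma dfn_umem [dfn_intros]: "tm A x \<Longrightarrow> tm A y \<Longrightarrow> tm A z \<Longrightarrow> dfn C A (\<lambda>N s. umem N (x s) (y s) (z s))"
  by (rule dfn_subst3[where R = umem]) (unfold umem_def, intro dfn_intros)

end

context zfc_model
begin

lemma omega_induct:
  assumes P: "DM (\<lambda>N s. P N (s 0))"
    and zero: "\<And>z. z \<in> M \<Longrightarrow> ext M z = {} \<Longrightarrow> P M z"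
    and succ: "\<And>n m. n \<in> ext M (omega M) \<Longrightarrow> P M n \<Longrightarrow> m \<in> ext M (omega M) \<Longrightarrow>
      ext M m = insert n (ext M n) \<Longrightarrow> P M m"
    and n: "n \<in> ext M (omega M)"
  shows "P M n"
proof (rule ccontr)
  assume "\<not> P M n"
  have "is_set {n \<in> ext M (omega M). \<not> P M n}"
    by (rule is_set_sep[OF is_set_ext[OF omega_in]]) (intro dfn_intros P)
  then obtain m where m: "m \<in> {n \<in> ext M (omega M). \<not> P M n}" "ext M m \<inter> {n \<in> ext M (omega M). \<not> P M n} = {}"
    using foundation_set[of "{n \<in> ext M (omega M). \<not> P M n}"] n \<open>\<not> P M n\<close> by blast
  have nat: "natural M m" using m(1) in_omega by blast
  then have "m \<in> M" "ext M m = {} \<or> (\<exists>k\<in>M. ext M m = insert k (ext M k))"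
    unfolding natural_def ordinal_def by auto
  then show False
  proof (elim disjE bexE)
    assume "ext M m = {}" then show False using zero[OF \<open>m \<in> M\<close>] m(1) by blast
  next
    fix k assume k: "k \<in> M" "ext M m = insert k (ext M k)"
    then have km: "k \<in> ext M m" by blast
    then have kw: "k \<in> ext M (omega M)" using natural_elem[OF nat] in_omega by blast
    then show False using succ[OF kw _ _ k(2)] m km by blast
  qed
qed

lemma is_set_prod:
  assumes "is_set S" "is_set T"
  shows "is_set {p \<in> M. \<exists>x\<in>S. \<exists>y\<in>T. is_opair M p x y}"
proof -
  obtain b where b: "b \<in> M" "ext M b = T" using assms(2) by (rule is_setE)
  let ?row = "\<lambda>N x. {p \<in> N. \<exists>y\<in>ext N b. is_opair N p x y}"
  have row: "is_set (?row M x)" if "x \<in> M" for x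
    by (rule is_set_repl[OF is_set_ext[OF b(1)], where Q = "\<lambda>N y p. is_opair N p x y"])
      (intro dfn_intros that, use opair_unique in blast)
  have "is_set {r \<in> M. \<exists>x\<in>S. ext M r = ?row M x}"
    by (rule is_set_repl[OF assms(1), where Q = "\<lambda>N x r. ext N r = ?row N x"])
      (intro dfn_intros b(1), simp add: ext_inject)
  from is_set_Union[OF this]
  have "is_set (\<Union>r\<in>{r \<in> M. \<exists>x\<in>S. ext M r = ?row M x}. ext M r)" .
  moreover have "(\<Union>r\<in>{r \<in> M. \<exists>x\<in>S. ext M r = ?row M x}. ext M r) = {p \<in> M. \<exists>x\<in>S. \<exists>y\<in>T. is_opair M p x y}"
    (is "?l = ?r")
  proof
    show "?l \<subseteq> ?r"
    proof
      fix p assume "p \<in> ?l"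
      then obtain r x where "p \<in> ext M r" "x \<in> S" "ext M r = ?row M x" by blast
      then have "p \<in> ?row M x" "x \<in> S" by simp_all
      then show "p \<in> ?r" using b(2) by blast
    qed
    show "?r \<subseteq> ?l"
    proof
      fix p assume "p \<in> ?r"
      then obtain x y where p: "p \<in> M" "x \<in> S" "y \<in> T" "is_opair M p x y" by blast
      obtain r where r: "r \<in> M" "ext M r = ?row M x"
        using row[of x] is_set_in[OF assms(1) p(2)] by (auto elim: is_setE)
      then have "p \<in> ext M r" using p b(2) by blast
      then show "p \<in> ?l" using r p(2) by blast
    qed
  qed
  ultimately show ?thesis by simp
qed

lemma is_set_fun_space:
  assumes X: "X \<in> M" and T: "T \<in> M"
  shows "is_set {f. is_fun M f X \<and> (\<forall>x\<in>ext M X. app M f x \<in> ext M T)}"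
proof -
  let ?P = "{p \<in> M. \<exists>x\<in>ext M X. \<exists>y\<in>ext M T. is_opair M p x y}"
  have "is_set {f \<in> {f \<in> M. ext M f \<subseteq> ?P}. is_fun M f X}"
    by (rule is_set_sep[OF is_set_Pow[OF is_set_prod], where P = "\<lambda>N f. is_fun N f X"])
      (intro is_set_ext X T dfn_intros)+
  moreover have *: "is_fun M f X \<Longrightarrow> ext M f \<subseteq> ?P \<longleftrightarrow> (\<forall>x\<in>ext M X. app M f x \<in> ext M T)" for f
  proof
    assume f: "is_fun M f X" "ext M f \<subseteq> ?P"
    show "\<forall>x\<in>ext M X. app M f x \<in> ext M T"
    proof
      fix x assume "x \<in> ext M X"
      then obtain p where "p \<in> ext M f" "is_opair M p x (app M f x)"
        using app_maps[OF f(1)] unfolding maps_to_def by blast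
      then show "app M f x \<in> ext M T" using f(2) opair_inject by blast
    qed
  next
    assume f: "is_fun M f X" "\<forall>x\<in>ext M X. app M f x \<in> ext M T"
    show "ext M f \<subseteq> ?P"
    proof
      fix p assume p: "p \<in> ext M f"
      then obtain x y where xy: "x \<in> ext M X" "is_opair M p x y" using f(1) unfolding is_fun_def by blast
      then have "maps_to M f x y" using p unfolding maps_to_def by blast
      then have "y = app M f x" using maps_to_iff[OF f(1)] by blast
      then show "p \<in> ?P" using xy f(2) ext_in[OF p] by blast
    qed
  qed
  moreover have "{f \<in> {f \<in> M. ext M f \<subseteq> ?P}. is_fun M f X} =
      {f. is_fun M f X \<and> (\<forall>x\<in>ext M X. app M f x \<in> ext M T)}"
    using * is_fun_in by blast
  ultimately show ?thesis by simp
qed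

lemma is_set_range:
  assumes "is_fun M f X" "X \<in> M" shows "is_set (app M f ` ext M X)"
proof -
  have "is_set {y \<in> M. \<exists>x\<in>ext M X. maps_to M f x y}"
    by (rule is_set_repl[OF is_set_ext[OF assms(2)], where Q = "\<lambda>N x y. maps_to N f x y"])
      (intro dfn_intros is_fun_in[OF assms(1)], simp add: maps_to_iff[OF assms(1)])
  moreover have "{y \<in> M. \<exists>x\<in>ext M X. maps_to M f x y} = app M f ` ext M X"
    using maps_to_iff[OF assms(1)] app_in[OF assms(1)] by auto
  ultimately show ?thesis by simp
qed

lemma const_fun_ex:
  assumes "X \<in> M" "a \<in> M" shows "\<exists>!c. is_fun M c X \<and> (\<forall>x\<in>ext M X. app M c x = a)"
proof -
  have "\<exists>f. is_fun M f X \<and> (\<forall>x\<in>ext M X. app M f x = a)"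
    by (rule mk_fun[OF assms(1), where Q = "\<lambda>N x y. y = a"]) (intro dfn_intros assms(2), use assms(2) in blast)
  then show ?thesis using fun_eqI by metis
qed

lemma id_fun_ex:
  assumes "X \<in> M" shows "\<exists>!c. is_fun M c X \<and> (\<forall>x\<in>ext M X. app M c x = x)"
proof -
  have "\<exists>f. is_fun M f X \<and> (\<forall>x\<in>ext M X. app M f x = x)"
    by (rule mk_fun[OF assms(1), where Q = "\<lambda>N x y. y = x"]) (intro dfn_intros, use ext_in in blast)
  then show ?thesis using fun_eqI by metis
qed

end

locale ultrafilter_model = zfc_model +
  fixes U X
  assumes U: "cc_ultrafilter_on M U X"
begin

lemma U_in: "U \<in> M" and X_in: "X \<in> M"
  using U unfolding cc_ultrafilter_on_def by auto

lemma U_subset: "\<forall>A\<in>ext M U. ext M A \<subseteq> ext M X"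
  and X_in_U: "X \<in> ext M U"
  and U_nonempty: "\<forall>A\<in>ext M U. ext M A \<noteq> {}"
  and U_up: "\<forall>A\<in>ext M U. \<forall>B\<in>M. ext M A \<subseteq> ext M B \<and> ext M B \<subseteq> ext M X \<longrightarrow> B \<in> ext M U"
  and U_ultra: "\<forall>A\<in>M. ext M A \<subseteq> ext M X \<longrightarrow>
        A \<in> ext M U \<or> (\<exists>B\<in>ext M U. ext M B = ext M X - ext M A)"
  and U_complete: "\<forall>F. is_fun M F (omega M) \<and> (\<forall>n\<in>ext M (omega M). app M F n \<in> ext M U) \<longrightarrow>
        (\<exists>B\<in>ext M U. ext M B = (\<Inter>n\<in>ext M (omega M). ext M (app M F n)))"
  using U unfolding cc_ultrafilter_on_def by - (elim conjE, assumption)+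

section \<open>The calculus of large sets\<close>

definition large :: "'a set \<Rightarrow> bool" where
  "large S \<longleftrightarrow> (\<exists>A\<in>ext M U. ext M A = S)"

lemma large_X: "large (ext M X)"
  using X_in_U unfolding large_def by blast

lemma large_subset: "large S \<Longrightarrow> S \<subseteq> ext M X"
  using U_subset unfolding large_def by blast

lemma large_is_set: "large S \<Longrightarrow> is_set S"
  unfolding large_def using ext_in by auto

lemma large_nonempty: "large S \<Longrightarrow> S \<noteq> {}"
  using U_nonempty unfolding large_def by blast

lemma large_mono: "large S \<Longrightarrow> is_set T \<Longrightarrow> S \<subseteq> T \<Longrightarrow> T \<subseteq> ext M X \<Longrightarrow> large T"
  using U_up unfolding large_def is_set_def by blast

lemma large_compl: "is_set S \<Longrightarrow> S \<subseteq> ext M X \<Longrightarrow> large S \<or> large (ext M X - S)"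
  using U_ultra unfolding large_def is_set_def by blast

lemma large_omega:
  assumes "is_fun M F (omega M)" "\<And>n. n \<in> ext M (omega M) \<Longrightarrow> large (ext M (app M F n))"
  shows "large (\<Inter>n\<in>ext M (omega M). ext M (app M F n))"
proof -
  have "app M F n \<in> ext M U" if n: "n \<in> ext M (omega M)" for n
    using assms(2)[OF n] app_in[OF assms(1) n] ext_inject ext_in unfolding large_def by metis
  then show ?thesis using U_complete assms(1) unfolding large_def by blast
qed

text \<open>Binary intersections come from countable completeness, applied to the sequence that is
  \<open>A\<close> at zero and \<open>B\<close> at every other natural.\<close>

lemma large_Int:
  assumes "large S" "large T" shows "large (S \<inter> T)"
proof -
  obtain A B where AB: "A \<in> M" "B \<in> M" "ext M A = S" "ext M B = T"
    using large_is_set[OF assms(1)] large_is_set[OF assms(2)] by (metis is_setE)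
  have "\<exists>F. is_fun M F (omega M) \<and> (\<forall>n\<in>ext M (omega M).
      ext M n = {} \<and> app M F n = A \<or> ext M n \<noteq> {} \<and> app M F n = B)"
    by (rule mk_fun[OF omega_in, where Q = "\<lambda>N n C. ext N n = {} \<and> C = A \<or> ext N n \<noteq> {} \<and> C = B"])
      (intro dfn_intros AB, use AB in blast)
  then obtain F where F: "is_fun M F (omega M)" "\<And>n. n \<in> ext M (omega M) \<Longrightarrow>
      ext M n = {} \<and> app M F n = A \<or> ext M n \<noteq> {} \<and> app M F n = B" by blast
  obtain z where z: "z \<in> ext M (omega M)" "ext M z = {}" using zero_ex by blast
  obtain m where m: "m \<in> ext M (omega M)" "ext M m \<noteq> {}" using omega_succ[OF z(1)] by blast
  have "large (\<Inter>n\<in>ext M (omega M). ext M (app M F n))"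
    by (rule large_omega[OF F(1)]) (use F(2) assms AB in metis)
  moreover have "(\<Inter>n\<in>ext M (omega M). ext M (app M F n)) = S \<inter> T"
  proof
    have "ext M (app M F z) = S" "ext M (app M F m) = T" using F(2)[OF z(1)] F(2)[OF m(1)] z m AB by auto
    then show "(\<Inter>n\<in>ext M (omega M). ext M (app M F n)) \<subseteq> S \<inter> T" using z m by blast
    show "S \<inter> T \<subseteq> (\<Inter>n\<in>ext M (omega M). ext M (app M F n))" using F(2) AB by auto
  qed
  ultimately show ?thesis by simp
qed

lemma large_Diff: "is_set S \<Longrightarrow> S \<subseteq> ext M X \<Longrightarrow> large (ext M X - S) \<longleftrightarrow> \<not> large S"
  using large_compl large_Int[of S "ext M X - S"] large_nonempty by blast

lemma large_Int_iff:
  "is_set S \<Longrightarrow> S \<subseteq> ext M X \<Longrightarrow> is_set T \<Longrightarrow> T \<subseteq> ext M X \<Longrightarrow> large (S \<inter> T) \<longleftrightarrow> large S \<and> large T"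
  using large_Int large_mono[of "S \<inter> T"] by blast

lemma large_Un:
  assumes "large (S \<union> T)" "is_set S" "is_set T" shows "large S \<or> large T"
proof (rule ccontr)
  assume n: "\<not> (large S \<or> large T)"
  have "S \<subseteq> ext M X" "T \<subseteq> ext M X" using large_subset[OF assms(1)] by auto
  then have "large (ext M X - S)" "large (ext M X - T)" using large_Diff assms n by auto
  then have "large ((S \<union> T) \<inter> ((ext M X - S) \<inter> (ext M X - T)))" using large_Int assms(1) by blast
  then show False using large_nonempty by fastforce
qed

lemma underlying_eq: "underlying M U = X"
proof -
  have "ext M X = (\<Union>A\<in>ext M U. ext M A)"
    using X_in_U U_subset by blast
  then show ?thesis unfolding underlying_def using X_in ext_inject by (intro the_equality) auto
qed

lemma is_underlying_iff: "Y \<in> M \<Longrightarrow> is_underlying M U Y \<longleftrightarrow> Y = X"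
proof -
  assume Y: "Y \<in> M"
  have "{x \<in> M. \<exists>A\<in>ext M U. x \<epsilon> A} = (\<Union>A\<in>ext M U. ext M A)" unfolding ext_def by blast
  also have "\<dots> = ext M X" using X_in_U U_subset by blast
  finally show ?thesis unfolding is_underlying_def using Y X_in ext_inject by auto
qed

abbreviation fn :: "'a \<Rightarrow> bool" where "fn f \<equiv> is_fun M f X"

lemma ufuns_iff: "f \<in> ufuns M U \<longleftrightarrow> fn f"
  unfolding ufuns_def underlying_eq by simp

lemma ufn_iff: "ufn M U f \<longleftrightarrow> fn f"
  unfolding ufn_def using is_underlying_iff X_in by auto

lemma ult_eq_iff: "ult_eq M U f g \<longleftrightarrow> large {x \<in> ext M X. app M f x = app M g x}"
  unfolding ult_eq_def large_def underlying_eq ..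

lemma ult_mem_iff: "ult_mem M U f g \<longleftrightarrow> large {x \<in> ext M X. app M f x \<epsilon> app M g x}"
  unfolding ult_mem_def large_def underlying_eq ..

lemma ueq_iff: "fn f \<Longrightarrow> fn g \<Longrightarrow> ueq M U f g \<longleftrightarrow> ult_eq M U f g"
proof -
  assume f: "fn f" and g: "fn g"
  have "ueq M U f g \<longleftrightarrow> large {x \<in> ext M X. \<exists>u\<in>M. maps_to M f x u \<and> maps_to M g x u}"
    unfolding ueq_def large_def using is_underlying_iff X_in by auto
  also have "{x \<in> ext M X. \<exists>u\<in>M. maps_to M f x u \<and> maps_to M g x u} = {x \<in> ext M X. app M f x = app M g x}"
    unfolding maps_to_iff[OF f] maps_to_iff[OF g] using app_in[OF f] by auto
  finally show ?thesis unfolding ult_eq_iff .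
qed

lemma umem_iff: "fn f \<Longrightarrow> fn g \<Longrightarrow> umem M U f g \<longleftrightarrow> ult_mem M U f g"
proof -
  assume f: "fn f" and g: "fn g"
  have "umem M U f g \<longleftrightarrow> large {x \<in> ext M X. \<exists>u\<in>M. \<exists>v\<in>M. maps_to M f x u \<and> maps_to M g x v \<and> u \<epsilon> v}"
    unfolding umem_def large_def using is_underlying_iff X_in by auto
  also have "{x \<in> ext M X. \<exists>u\<in>M. \<exists>v\<in>M. maps_to M f x u \<and> maps_to M g x v \<and> u \<epsilon> v} =
      {x \<in> ext M X. app M f x \<epsilon> app M g x}"
    unfolding maps_to_iff[OF f] maps_to_iff[OF g] using app_in[OF f] app_in[OF g] by auto
  finally show ?thesis unfolding ult_mem_iff .
qed

section \<open>Definability of pointwise satisfaction\<close>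

text \<open>Terms of \<open>dfn\<close> are only variables and constants, but in Los's theorem the
  variables of a formula take values of functions at a point. In the atomic cases such a value is
  replaced by a quantified element together with its definable graph; the quantifier case overrides
  the bound variable by the top of the stack.\<close>

lemma dfn_sat_graph:
  assumes "\<And>n. DM (\<lambda>N s. s 0 = v n (\<lambda>k. s (Suc k)))"
    and "\<And>n s. range s \<subseteq> M \<Longrightarrow> v n s \<in> M"
  shows "DM (\<lambda>N s. sat N p (\<lambda>n. v n s))"
  using assms
proof (induction p arbitrary: v)
  case (FMem i j)
  have vg: "DM (\<lambda>N s. x s = v n (\<lambda>k. s (g k)))" if "tm M x" for x n g
    using dfn_subst[OF FMem(1), of "case_nat x (\<lambda>k s. s (g k))"] that
    by (simp add: tm_var split: nat.split)
  have "DM (\<lambda>N s. \<exists>a\<in>N. a = v i s \<and> (\<exists>b\<in>N. b = v j s \<and> a \<epsilon> b))"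
    by (intro dfn_intros vg)
  then show ?case by (rule dfn_cong) (use FMem(2) in auto)
next
  case (FEq i j)
  have vg: "DM (\<lambda>N s. x s = v n (\<lambda>k. s (g k)))" if "tm M x" for x n g
    using dfn_subst[OF FEq(1), of "case_nat x (\<lambda>k s. s (g k))"] that
    by (simp add: tm_var split: nat.split)
  have "DM (\<lambda>N s. \<exists>a\<in>N. a = v i s \<and> (\<exists>b\<in>N. b = v j s \<and> a = b))"
    by (intro dfn_intros vg)
  then show ?case by (rule dfn_cong) (use FEq(2) in auto)
next
  case (FNeg p)
  then show ?case by (simp add: dfn_not)
next
  case (FConj p q)
  then show ?case by (simp add: dfn_conj)
next
  case (FAll i p)
  have vg: "DM (\<lambda>N s. x s = v n (\<lambda>k. s (g k)))" if "tm M x" for x n g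
    using dfn_subst[OF FAll(2), of "case_nat x (\<lambda>k s. s (g k))"] that
    by (simp add: tm_var split: nat.split)
  define v' where "v' n = (if n = i then (\<lambda>s. s 0) else (\<lambda>s. v n (\<lambda>k. s (Suc k))))" for n
  have "DM (\<lambda>N s. sat N p (\<lambda>n. v' n s))"
  proof (rule FAll(1))
    show "DM (\<lambda>N s. s 0 = v' n (\<lambda>k. s (Suc k)))" for n
      unfolding v'_def by (cases "n = i") (simp_all add: vg dfn_eq tm_var)
    show "v' n s \<in> M" if "range s \<subseteq> M" for n s
      using that FAll(3)[of "\<lambda>k. s (Suc k)"] unfolding v'_def by (auto simp: image_subset_iff)
  qed
  moreover have "(\<lambda>n. v' n s) = (\<lambda>n. v n (\<lambda>k. s (Suc k)))(i := s 0)" for s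
    unfolding v'_def by auto
  ultimately have "DM (\<lambda>N s. \<forall>a\<in>N. sat N p ((\<lambda>n. v n s)(i := a)))"
    by (intro dfn_all) simp
  then show ?case by simp
qed

text \<open>Off the underlying set the value is \<open>X\<close>, an arbitrary element of the model,
  so that the assignment takes values in \<open>M\<close> for every argument from \<open>M\<close>,
  as \<open>dfn_sat_graph\<close> demands.\<close>

definition val :: "(nat \<Rightarrow> 'a) \<Rightarrow> 'a \<Rightarrow> nat \<Rightarrow> 'a" where
  "val F x n = (if x \<in> ext M X then app M (F n) x else X)"

lemma val_eq: "x \<in> ext M X \<Longrightarrow> val F x = (\<lambda>n. app M (F n) x)"
  by (simp add: val_def fun_eq_iff)

lemma dfn_val:
  assumes "\<And>n. fn (F n)" "tm M x" "tm M y"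
  shows "DM (\<lambda>N s. x s = val F (y s) n)"
proof (rule dfn_subst2[where R = "\<lambda>N x y. x = val F y n", OF _ assms(2,3)])
  have "DM (\<lambda>N s. maps_to N (F n) (s 1) (s 0) \<or> s 1 \<notin> ext N X \<and> s 0 = X)"
    by (intro dfn_intros X_in is_fun_in[OF assms(1)])
  then show "DM (\<lambda>N s. s 0 = val F (s 1) n)"
    by (rule dfn_cong) (auto simp: val_def maps_to_iff[OF assms(1)])
qed

lemma val_in: "(\<And>n. fn (F n)) \<Longrightarrow> x \<in> M \<Longrightarrow> val F x n \<in> M"
  unfolding val_def using app_in X_in by auto

lemma dfn_sat_val:
  assumes "\<And>n. fn (F n)"
  shows "DM (\<lambda>N s. sat N p (val F (s 0)))"
  by (rule dfn_sat_graph[where v = "\<lambda>n s. val F (s 0) n"])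
    (intro dfn_val assms dfn_intros, auto intro!: val_in assms)

lemma dfn_sat_val_upd:
  assumes "\<And>n. fn (F n)"
  shows "DM (\<lambda>N s. sat N p ((val F (s 0))(i := s 1)))"
proof -
  have "DM (\<lambda>N s. sat N p (\<lambda>n. if n = i then s 1 else val F (s 0) n))"
  proof (rule dfn_sat_graph[where v = "\<lambda>n s. if n = i then s 1 else val F (s 0) n"])
    show "DM (\<lambda>N s. s 0 = (if n = i then s (Suc 1) else val F (s (Suc 0)) n))" for n
      by (cases "n = i") (auto intro: dfn_intros dfn_val assms)
  qed (auto intro!: val_in assms)
  then show ?thesis unfolding fun_upd_def .
qed

lemma is_set_sat:
  assumes "\<And>n. fn (F n)" shows "is_set {x \<in> ext M X. sat M p (\<lambda>n. app M (F n) x)}"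
  by (rule is_set_sub[OF is_set_ext[OF X_in], where P = "\<lambda>N x. sat N p (val F x)"])
    (rule dfn_sat_val[OF assms], auto simp: val_eq cong: conj_cong)

lemma is_set_eq: "fn f \<Longrightarrow> fn g \<Longrightarrow> is_set {x \<in> ext M X. app M f x = app M g x}"
  using is_set_sat[of "case_nat f (\<lambda>_. g)" "FEq 0 1"] by (simp split: nat.split)

lemma is_set_mem: "fn f \<Longrightarrow> fn g \<Longrightarrow> is_set {x \<in> ext M X. app M f x \<epsilon> app M g x}"
  using is_set_sat[of "case_nat f (\<lambda>_. g)" "FMem 0 1"] by (simp split: nat.split)

section \<open>Equality and membership modulo the ultrafilter, and well-foundedness\<close>

lemma ult_eq_refl: "ult_eq M U f f"
  unfolding ult_eq_iff using large_X by simp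

lemma ult_eq_sym: "ult_eq M U f g \<Longrightarrow> ult_eq M U g f"
  unfolding ult_eq_iff by (simp add: eq_commute)

lemma ult_eq_trans:
  assumes "fn f" "fn h" "ult_eq M U f g" "ult_eq M U g h" shows "ult_eq M U f h"
  unfolding ult_eq_iff
  by (rule large_mono[OF large_Int[OF assms(3,4)[unfolded ult_eq_iff]] is_set_eq[OF assms(1,2)]]) auto

lemma ult_mem_cong:
  assumes "fn f'" "fn g'" "ult_eq M U f f'" "ult_eq M U g g'" "ult_mem M U f g"
  shows "ult_mem M U f' g'"
  unfolding ult_mem_iff
  by (rule large_mono[OF large_Int[OF large_Int[OF assms(3,4)[unfolded ult_eq_iff]] assms(5)[unfolded ult_mem_iff]]
      is_set_mem[OF assms(1,2)]]) auto

text \<open>Otherwise choice yields, inside the model, a descending sequence indexed by omega. Each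
  descent holds on a large set, and by countable completeness some point \<open>x\<close> lies in
  all of them; the values at \<open>x\<close> then form a nonempty set violating Foundation.\<close>

lemma ult_mem_wf:
  assumes S: "is_set S" "S \<noteq> {}" and fns: "\<And>f. f \<in> S \<Longrightarrow> fn f"
  shows "\<exists>d\<in>S. \<forall>e\<in>S. \<not> ult_mem M U e d"
proof (rule ccontr)
  assume "\<not> ?thesis"
  then have desc: "\<exists>e\<in>S. ult_mem M U e d" if "d \<in> S" for d using that by blast
  obtain c where c: "c \<in> M" "ext M c = S" using S(1) by (rule is_setE)
  obtain a where a: "a \<in> S" using S(2) by blast
  have aM: "a \<in> M" using a S(1) is_set_in by blast
  have "\<exists>f. is_fun M f c \<and> (\<forall>x\<in>ext M c. app M f x \<in> ext M c \<and> umem M U (app M f x) x)"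
    by (rule choice_fun[OF c(1), where Q = "\<lambda>N d e. e \<in> ext N c \<and> umem N U e d"])
      (intro dfn_intros c U_in, use desc umem_iff fns c is_set_in[OF S(1)] in metis)
  then obtain G where G: "is_fun M G c" "\<And>d. d \<in> S \<Longrightarrow> app M G d \<in> S \<and> ult_mem M U (app M G d) d"
    using umem_iff fns c(2) by metis
  note GM = is_fun_in[OF G(1)]
  \<comment> \<open>\<open>omega_iterate\<close> asks for a total operation, so outside
    \<open>c\<close> the step relation is the identity; the iterates starting at \<open>a\<close>
    stay in \<open>c\<close>.\<close>
  let ?G = "\<lambda>N v w. maps_to N G v w \<or> v \<notin> ext N c \<and> w = v"
  have "\<exists>F. is_fun M F (omega M) \<and>
    (\<forall>z\<in>ext M (omega M). ext M z = {} \<longrightarrow> app M F z = a) \<and>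
    (\<forall>n\<in>ext M (omega M). \<forall>m\<in>ext M (omega M). ext M m = insert n (ext M n) \<longrightarrow>
       ?G M (app M F n) (app M F m))"
  proof (rule omega_iterate[OF aM])
    show "DM (\<lambda>N s. ?G N (s 0) (s 1))" by (intro dfn_intros c GM)
    show "\<exists>!w. w \<in> M \<and> ?G M v w" if "v \<in> M" for v
      using that app_in[OF G(1)] by (cases "v \<in> ext M c") (auto simp: maps_to_iff[OF G(1)])
  qed
  then obtain F where F: "is_fun M F (omega M)"
    and F0: "\<And>z. z \<in> ext M (omega M) \<Longrightarrow> ext M z = {} \<Longrightarrow> app M F z = a"
    and Fs: "\<And>n m. n \<in> ext M (omega M) \<Longrightarrow> m \<in> ext M (omega M) \<Longrightarrow> ext M m = insert n (ext M n) \<Longrightarrow>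
       ?G M (app M F n) (app M F m)" by blast
  note FM = is_fun_in[OF F]
  have FS: "app M F n \<in> S" if n: "n \<in> ext M (omega M)" for n
  proof -
    have "n \<notin> ext M (omega M) \<or> (\<exists>y\<in>ext M c. maps_to M F n y)"
    proof (rule omega_induct[where P = "\<lambda>N n. n \<notin> ext N (omega M) \<or> (\<exists>y\<in>ext N c. maps_to N F n y)", OF _ _ _ n])
      show "DM (\<lambda>N s. s 0 \<notin> ext N (omega M) \<or> (\<exists>y\<in>ext N c. maps_to N F (s 0) y))"
        by (intro dfn_intros c FM omega_in)
      show "z \<notin> ext M (omega M) \<or> (\<exists>y\<in>ext M c. maps_to M F z y)" if "ext M z = {}" for z
        using F0[OF _ that] a c(2) app_maps[OF F] by metis
      show "m \<notin> ext M (omega M) \<or> (\<exists>y\<in>ext M c. maps_to M F m y)"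
        if "n \<in> ext M (omega M)" "n \<notin> ext M (omega M) \<or> (\<exists>y\<in>ext M c. maps_to M F n y)"
          "m \<in> ext M (omega M)" "ext M m = insert n (ext M n)" for n m
      proof -
        have "app M F n \<in> S" using that(1,2) maps_to_iff[OF F] c(2) by auto
        then have "app M F m \<in> S" using Fs[OF that(1,3,4)] G c(2) maps_to_iff[OF G(1)] by auto
        then show ?thesis using app_maps[OF F that(3)] c(2) by blast
      qed
    qed
    then show ?thesis using n maps_to_iff[OF F] c(2) by auto
  qed
  have FG: "ult_mem M U (app M F m) (app M F n)"
    if "n \<in> ext M (omega M)" "m \<in> ext M (omega M)" "ext M m = insert n (ext M n)" for n m
    using Fs[OF that] FS[OF that(1)] G c(2) maps_to_iff[OF G(1)] by auto
  \<comment> \<open>The definable graph of the sequence that sends \<open>n\<close> to the set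
    \<open>L n m\<close> of points where descent from \<open>n\<close> to its successor
    \<open>m\<close> takes place. Countable completeness needs this sequence as an element of the
    model.\<close>
  define QQ where "QQ N n A \<longleftrightarrow> (\<exists>m\<in>ext N (omega M). ext N m = insert n (ext N n) \<and> (\<exists>f\<in>N. \<exists>f'\<in>N. maps_to N F n f \<and> maps_to N F m f' \<and>
     ext N A = {x \<in> ext N X. \<exists>u\<in>N. \<exists>v\<in>N. maps_to N f' x u \<and> maps_to N f x v \<and> u \<epsilon> v}))" for N n A
  define L where "L n m = {x \<in> ext M X. app M (app M F m) x \<epsilon> app M (app M F n) x}" for n m
  have Q: "QQ M n A \<longleftrightarrow> ext M A = L n m"
    if nm: "n \<in> ext M (omega M)" "m \<in> ext M (omega M)" "ext M m = insert n (ext M n)" for n m A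
  proof -
    have 1: "m' = m" if "m' \<in> ext M (omega M)" "ext M m' = insert n (ext M n)" for m'
      using that nm ext_inject ext_in by metis
    note f = fns[OF FS[OF nm(1)]] fns[OF FS[OF nm(2)]]
    have 2: "{x \<in> ext M X. \<exists>u\<in>M. \<exists>v\<in>M. maps_to M (app M F m) x u \<and> maps_to M (app M F n) x v \<and> u \<epsilon> v} = L n m"
      unfolding L_def maps_to_iff[OF f(1)] maps_to_iff[OF f(2)] using app_in[OF f(1)] app_in[OF f(2)] by auto
    show ?thesis
    proof
      assume "QQ M n A"
      then obtain m' f f' where "m' \<in> ext M (omega M)" "ext M m' = insert n (ext M n)"
        "maps_to M F n f" "maps_to M F m' f'"
        "ext M A = {x \<in> ext M X. \<exists>u\<in>M. \<exists>v\<in>M. maps_to M f' x u \<and> maps_to M f x v \<and> u \<epsilon> v}" unfolding QQ_def by blast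
      moreover then have "m' = m" "f = app M F n" "f' = app M F m'" using 1 maps_to_iff[OF F] by blast+
      ultimately show "ext M A = L n m" using 2 by simp
    next
      assume "ext M A = L n m"
      then show "QQ M n A" using 2 nm unfolding QQ_def maps_to_iff[OF F]
        by (intro bexI[of _ m] conjI bexI[of _ "app M F n"] bexI[of _ "app M F m"]) (auto simp: app_in[OF F])
    qed
  qed
  have "\<exists>H. is_fun M H (omega M) \<and> (\<forall>n\<in>ext M (omega M). QQ M n (app M H n))"
  proof (rule mk_fun[OF omega_in, where Q = QQ])
    show "DM (\<lambda>N s. QQ N (s 0) (s 1))" unfolding QQ_def by (intro dfn_intros omega_in FM X_in)
    fix n assume n: "n \<in> ext M (omega M)"
    then obtain m where m: "m \<in> ext M (omega M)" "ext M m = insert n (ext M n)" using omega_succ by blast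
    have "is_set (L n m)" unfolding L_def
      using is_set_mem[OF fns[OF FS[OF m(1)]] fns[OF FS[OF n]]] .
    then show "\<exists>!A. A \<in> M \<and> QQ M n A" unfolding Q[OF n m] using ext_inject unfolding is_set_def by metis
  qed
  then obtain H where H: "is_fun M H (omega M)" "\<And>n. n \<in> ext M (omega M) \<Longrightarrow> QQ M n (app M H n)" by blast
  have HL: "ext M (app M H n) = L n m" if "n \<in> ext M (omega M)" "m \<in> ext M (omega M)" "ext M m = insert n (ext M n)" for n m
    using Q[OF that] H(2)[OF that(1)] by blast
  have "large (\<Inter>n\<in>ext M (omega M). ext M (app M H n))"
  proof (rule large_omega[OF H(1)])
    fix n assume n: "n \<in> ext M (omega M)"
    then obtain m where m: "m \<in> ext M (omega M)" "ext M m = insert n (ext M n)" using omega_succ by blast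
    show "large (ext M (app M H n))" using FG[OF n m] unfolding HL[OF n m] L_def ult_mem_iff .
  qed
  then obtain x where x: "\<And>n. n \<in> ext M (omega M) \<Longrightarrow> x \<in> ext M (app M H n)"
    using large_nonempty by blast
  have xX: "x \<in> ext M X"
    using zero_ex omega_succ x HL unfolding L_def by (metis (no_types, lifting) mem_Collect_eq)
  have xM: "x \<in> M" using xX ext_in by blast
  \<comment> \<open>The values at the common point \<open>x\<close> of all functions of the
    sequence: below each of them lies the value of the next function.\<close>
  define T where "T = {y \<in> M. \<exists>n\<in>ext M (omega M). y = app M (app M F n) x}"
  have "is_set {y \<in> M. \<exists>n\<in>ext M (omega M). \<exists>f\<in>M. maps_to M F n f \<and> maps_to M f x y}"
    by (rule is_set_repl[OF is_set_ext[OF omega_in], where Q = "\<lambda>N n y. \<exists>f\<in>N. maps_to N F n f \<and> maps_to N f x y"])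
      (intro dfn_intros FM xM, use maps_to_iff[OF F] maps_to_iff[OF fns[OF FS]] in metis)
  moreover have "{y \<in> M. \<exists>n\<in>ext M (omega M). \<exists>f\<in>M. maps_to M F n f \<and> maps_to M f x y} = T"
    unfolding T_def maps_to_iff[OF F] using maps_to_iff[OF fns[OF FS]] app_in[OF F] xX by blast
  ultimately have T: "is_set T" by simp
  have Tn: "app M (app M F n) x \<in> T" if "n \<in> ext M (omega M)" for n
    unfolding T_def using that app_in[OF fns[OF FS[OF that]] xX] by blast
  then have "T \<noteq> {}" using zero_ex by blast
  then obtain y where y: "y \<in> T" "ext M y \<inter> T = {}" using foundation_set[OF T] by blast
  then obtain n where n: "n \<in> ext M (omega M)" "y = app M (app M F n) x" unfolding T_def by blast
  obtain m where m: "m \<in> ext M (omega M)" "ext M m = insert n (ext M n)" using omega_succ[OF n(1)] by blast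
  have "x \<in> L n m" using x[OF n(1)] HL[OF n(1) m] by blast
  then have "app M (app M F m) x \<in> ext M y"
    using n(2) app_in[OF fns[OF FS[OF m(1)]] xX] unfolding L_def ext_def by blast
  then show False using y(2) Tn[OF m(1)] by blast
qed

section \<open>The transitive collapse of the ultrapower\<close>

text \<open>The predecessors of a function modulo the ultrafilter form a proper class, because their
  values on small sets are arbitrary. A transitive \<open>T\<close> that contains all values of
  \<open>f\<close> and \<open>g\<close> cuts this down to the set of functions into
  \<open>T\<close>, which represents every predecessor up to equality modulo \<open>U\<close>; on it
  \<open>wf_rec\<close> applies.\<close>

lemma attempt_ex:
  assumes f: "fn f" and g: "fn g"
  shows "\<exists>D h. collapse_attempt M U D h \<and> f \<in> ext M D \<and> g \<in> ext M D"
proof -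
  obtain a where a: "a \<in> M" "ext M a = app M f ` ext M X \<union> app M g ` ext M X"
    using is_set_Un[OF is_set_range[OF f X_in] is_set_range[OF g X_in]] by (rule is_setE)
  obtain T where T: "T \<in> M" "trans_set M T" "a \<in> ext M T" using transitive_containing[OF a(1)] by blast
  have "is_set {f. fn f \<and> (\<forall>x\<in>ext M X. app M f x \<in> ext M T)}" by (rule is_set_fun_space[OF X_in T(1)])
  then obtain D where D: "D \<in> M" "ext M D = {f. fn f \<and> (\<forall>x\<in>ext M X. app M f x \<in> ext M T)}" by (rule is_setE)
  have fg: "f \<in> ext M D" "g \<in> ext M D"
    using f g T(2,3) a(2) unfolding D(2) trans_set_def by blast+
  have fD: "fn d" if "d \<in> ext M D" for d using that D(2) by blast
  have "\<exists>h. is_fun M h D \<and> (\<forall>d\<in>ext M D. \<exists>S\<in>M.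
    ext M S = app M h ` {e \<in> ext M D. umem M U e d} \<and> app M h d = S)"
  proof (rule wf_rec[OF D(1), where R = "\<lambda>N e d. umem N U e d" and \<Gamma> = "\<lambda>N S y. y = S"])
    show "DM (\<lambda>N s. umem N U (s 0) (s 1))" by (intro dfn_intros U_in)
    show "DM (\<lambda>N s. s 1 = s 0)" by (intro dfn_intros)
    show "\<exists>d\<in>S. \<forall>e\<in>S. \<not> umem M U e d" if S: "is_set S" "S \<subseteq> ext M D" "S \<noteq> {}" for S
    proof -
      have "fn f" if "f \<in> S" for f using that S(2) fD by blast
      then show ?thesis using ult_mem_wf[OF S(1,3)] umem_iff by blast
    qed
  qed auto
  then obtain h where h: "is_fun M h D" "\<forall>d\<in>ext M D. \<exists>S\<in>M.
    ext M S = app M h ` {e \<in> ext M D. umem M U e d} \<and> app M h d = S" by (elim exE conjE)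
  have "collapse_attempt M U D h"
    unfolding collapse_attempt_def
  proof (intro conjI ballI impI)
    show "D \<in> M" "is_fun M h D" by fact+
    show "ext M D \<subseteq> ufuns M U" using fD ufuns_iff by blast
    fix d assume d: "d \<in> ext M D"
    have "{e \<in> ext M D. umem M U e d} = {e \<in> ext M D. ult_mem M U e d}" using umem_iff fD d by blast
    then show "ext M (app M h d) = app M h ` {f \<in> ext M D. ult_mem M U f d}" using h(2) d by force
    fix e assume e: "e \<in> ufuns M U" "ult_mem M U e d"
    then have fe: "fn e" using ufuns_iff by blast
    \<comment> \<open>Where \<open>e\<close> takes a value in \<open>T\<close> it is kept, elsewhere
      it is redefined to be \<open>a\<close>. The former happens on a large set, since there the
      value of \<open>e\<close> belongs to that of \<open>d\<close> and \<open>T\<close> is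
      transitive.\<close>
    have "\<exists>e'. is_fun M e' X \<and> (\<forall>x\<in>ext M X. app M e' x \<in> ext M T \<and>
      (maps_to M e x (app M e' x) \<or> app M e' x = a \<and> \<not> (\<exists>y\<in>ext M T. maps_to M e x y)))"
    proof (rule mk_fun[OF X_in, where Q = "\<lambda>N x y. y \<in> ext N T \<and> (maps_to N e x y \<or> y = a \<and> \<not> (\<exists>y\<in>ext N T. maps_to N e x y))"])
      show "DM (\<lambda>N s. s 1 \<in> ext N T \<and> (maps_to N e (s 0) (s 1) \<or> s 1 = a \<and> \<not> (\<exists>y\<in>ext N T. maps_to N e (s 0) y)))"
        by (intro dfn_intros T a is_fun_in[OF fe])
      fix x assume x: "x \<in> ext M X"
      show "\<exists>!y. y \<in> M \<and> y \<in> ext M T \<and> (maps_to M e x y \<or> y = a \<and> \<not> (\<exists>y\<in>ext M T. maps_to M e x y))"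
        using T(3) a(1) x app_in[OF fe x] unfolding maps_to_iff[OF fe] by (cases "app M e x \<in> ext M T") blast+
    qed
    then obtain e' where e': "fn e'" "\<And>x. x \<in> ext M X \<Longrightarrow> app M e' x \<in> ext M T \<and>
      (maps_to M e x (app M e' x) \<or> app M e' x = a \<and> \<not> (\<exists>y\<in>ext M T. maps_to M e x y))" by blast
    have "e' \<in> ext M D" using e' D(2) by blast
    moreover have "ult_eq M U e' e"
      unfolding ult_eq_iff
    proof (rule large_mono[OF e(2)[unfolded ult_mem_iff] is_set_eq[OF e'(1) fe]])
      show "{x \<in> ext M X. app M e x \<epsilon> app M d x} \<subseteq> {x \<in> ext M X. app M e' x = app M e x}"
      proof
        fix x assume "x \<in> {x \<in> ext M X. app M e x \<epsilon> app M d x}"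
        then have x: "x \<in> ext M X" "app M e x \<in> ext M (app M d x)" using app_in[OF fe] unfolding ext_def by auto
        have "app M d x \<in> ext M T" using d D(2) x(1) by blast
        then have "app M e x \<in> ext M T" using x(2) T(2) unfolding trans_set_def by blast
        then show "x \<in> {x \<in> ext M X. app M e' x = app M e x}" using e'(2)[OF x(1)] x(1) maps_to_iff[OF fe] by auto
      qed
    qed blast
    ultimately show "\<exists>f'\<in>ext M D. ult_eq M U f' e" by blast
  qed
  then show ?thesis using fg by blast
qed

lemma attemptD:
  assumes "collapse_attempt M U D h"
  shows "D \<in> M" "is_fun M h D"
    and "\<And>f. f \<in> ext M D \<Longrightarrow> fn f"
    and "\<And>g f. g \<in> ext M D \<Longrightarrow> fn f \<Longrightarrow> ult_mem M U f g \<Longrightarrow> \<exists>f'\<in>ext M D. ult_eq M U f' f"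
    and "\<And>g. g \<in> ext M D \<Longrightarrow> ext M (app M h g) = app M h ` {f \<in> ext M D. ult_mem M U f g}"
  using assms ufuns_iff unfolding collapse_attempt_def by blast+

text \<open>Allowing two functions equal modulo \<open>U\<close> instead of one makes the same
  minimal counterexample argument yield both that \<open>ult_class\<close> is well defined and that
  it respects equality modulo \<open>U\<close>.\<close>

lemma attempt_agree:
  assumes 1: "collapse_attempt M U D h" and 2: "collapse_attempt M U D' h'"
    and f: "f \<in> ext M D" "f' \<in> ext M D'" "ult_eq M U f f'"
  shows "app M h f = app M h' f'"
proof (rule ccontr)
  assume ne: "app M h f \<noteq> app M h' f'"
  note A = attemptD[OF 1] and A' = attemptD[OF 2]
  note hM = is_fun_in[OF A(2)] is_fun_in[OF A'(2)]
  define S where "S = {f \<in> ext M D. \<exists>f'\<in>ext M D'. ult_eq M U f f' \<and> app M h f \<noteq> app M h' f'}"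
  have "is_set S"
    by (rule is_set_sub[OF is_set_ext[OF A(1)], where P = "\<lambda>N f. \<exists>f'\<in>ext N D'. ueq N U f f' \<and>
        (\<exists>y\<in>N. \<exists>y'\<in>N. maps_to N h f y \<and> maps_to N h' f' y' \<and> y \<noteq> y')"])
      (intro dfn_intros U_in A(1) A'(1) hM, auto simp: S_def ueq_iff A(3) A'(3)
        maps_to_iff[OF A(2)] maps_to_iff[OF A'(2)] app_in[OF A(2)] app_in[OF A'(2)])
  then obtain d where d: "d \<in> S" and min: "\<And>e. e \<in> S \<Longrightarrow> \<not> ult_mem M U e d"
    using ult_mem_wf[of S] ne f A(3) unfolding S_def by blast
  then obtain d' where dd: "d \<in> ext M D" "d' \<in> ext M D'" "ult_eq M U d d'" "app M h d \<noteq> app M h' d'"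
    unfolding S_def by blast
  have sub: "app M h e = app M h' e'" if "e \<in> ext M D" "e' \<in> ext M D'" "ult_eq M U e e'" "ult_mem M U e d" for e e'
    using min that unfolding S_def by blast
  have "ext M (app M h d) = ext M (app M h' d')"
  proof
    show "ext M (app M h d) \<subseteq> ext M (app M h' d')"
    proof
      fix z assume "z \<in> ext M (app M h d)"
      then obtain e where e: "e \<in> ext M D" "ult_mem M U e d" "z = app M h e" unfolding A(5)[OF dd(1)] by blast
      have "ult_mem M U e d'" using ult_mem_cong[OF A(3)[OF e(1)] A'(3)[OF dd(2)] ult_eq_refl dd(3) e(2)] .
      then obtain e' where e': "e' \<in> ext M D'" "ult_eq M U e' e" using A'(4)[OF dd(2) A(3)[OF e(1)]] by blast
      have "ult_mem M U e' d'"
        using ult_mem_cong[OF A'(3)[OF e'(1)] A'(3)[OF dd(2)] ult_eq_sym[OF e'(2)] dd(3) e(2)] .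
      then show "z \<in> ext M (app M h' d')"
        using sub[OF e(1) e'(1) ult_eq_sym[OF e'(2)] e(2)] e(3) e'(1) unfolding A'(5)[OF dd(2)] by blast
    qed
    show "ext M (app M h' d') \<subseteq> ext M (app M h d)"
    proof
      fix z assume "z \<in> ext M (app M h' d')"
      then obtain e' where e': "e' \<in> ext M D'" "ult_mem M U e' d'" "z = app M h' e'" unfolding A'(5)[OF dd(2)] by blast
      have "ult_mem M U e' d"
        using ult_mem_cong[OF A'(3)[OF e'(1)] A(3)[OF dd(1)] ult_eq_refl ult_eq_sym[OF dd(3)] e'(2)] .
      then obtain e where e: "e \<in> ext M D" "ult_eq M U e e'" using A(4)[OF dd(1) A'(3)[OF e'(1)]] by blast
      have "ult_mem M U e d"
        using ult_mem_cong[OF A(3)[OF e(1)] A(3)[OF dd(1)] ult_eq_sym[OF e(2)] ult_eq_sym[OF dd(3)] e'(2)] .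
      then show "z \<in> ext M (app M h d)"
        using sub[OF e(1) e'(1) e(2)] e(1) e'(3) unfolding A(5)[OF dd(1)] by force
    qed
  qed
  then show False using dd ext_inject app_in A(2) A'(2) by metis
qed

abbreviation cls :: "'a \<Rightarrow> 'a" where "cls \<equiv> ult_class M U"

lemma cls_eq: "collapse_attempt M U D h \<Longrightarrow> f \<in> ext M D \<Longrightarrow> cls f = app M h f"
  unfolding ult_class_def using attempt_agree ult_eq_refl by (intro the_equality) blast+

lemma cls_iff: "fn f \<Longrightarrow> z = cls f \<longleftrightarrow> (\<exists>D h. collapse_attempt M U D h \<and> f \<in> ext M D \<and> z = app M h f)"
  using attempt_ex[of f f] cls_eq by metis

lemma cls_in: "fn f \<Longrightarrow> cls f \<in> M"
  using attempt_ex[of f f] cls_eq app_in attemptD(2) by metis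

lemma cls_cong: "fn f \<Longrightarrow> fn g \<Longrightarrow> ult_eq M U f g \<Longrightarrow> cls f = cls g"
  using attempt_ex[of f g] cls_eq attempt_agree by metis

text \<open>The domain of an attempt represents every predecessor of \<open>g\<close> up to equality
  modulo \<open>U\<close>, so the image over this set equals the image over all functions.\<close>

lemma ext_cls: "fn g \<Longrightarrow> ext M (cls g) = cls ` {f. fn f \<and> ult_mem M U f g}"
proof -
  assume g: "fn g"
  obtain D h where Dh: "collapse_attempt M U D h" "g \<in> ext M D" using attempt_ex[OF g g] by blast
  note A = attemptD[OF Dh(1)]
  have "app M h ` {f \<in> ext M D. ult_mem M U f g} = cls ` {f. fn f \<and> ult_mem M U f g}"
  proof
    show "app M h ` {f \<in> ext M D. ult_mem M U f g} \<subseteq> cls ` {f. fn f \<and> ult_mem M U f g}"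
      using cls_eq[OF Dh(1)] A(3) by force
    show "cls ` {f. fn f \<and> ult_mem M U f g} \<subseteq> app M h ` {f \<in> ext M D. ult_mem M U f g}"
    proof
      fix z assume "z \<in> cls ` {f. fn f \<and> ult_mem M U f g}"
      then obtain f where f: "fn f" "ult_mem M U f g" "z = cls f" by blast
      obtain f' where f': "f' \<in> ext M D" "ult_eq M U f' f" using A(4)[OF Dh(2) f(1,2)] by blast
      have "ult_mem M U f' g" using ult_mem_cong[OF A(3)[OF f'(1)] g ult_eq_sym[OF f'(2)] ult_eq_refl f(2)] .
      moreover have "z = app M h f'" using cls_cong[OF A(3)[OF f'(1)] f(1) f'(2)] cls_eq[OF Dh(1) f'(1)] f(3) by simp
      ultimately show "z \<in> app M h ` {f \<in> ext M D. ult_mem M U f g}" using f'(1) by blast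
    qed
  qed
  then show ?thesis using A(5)[OF Dh(2)] cls_eq[OF Dh] by simp
qed

text \<open>Extensionality of the ultrapower together with well-foundedness. Take a minimal
  \<open>d\<close> that shares its class with an inequivalent \<open>d'\<close>. On a large set one
  of the two has an element missing from the other; choosing such elements gives a function
  \<open>e\<close> whose class lies in both, and by minimality \<open>e\<close> is equivalent to a
  predecessor on the other side, a contradiction.\<close>

lemma cls_inj:
  assumes f: "fn f" and g: "fn g" and eq: "cls f = cls g"
  shows "ult_eq M U f g"
proof (rule ccontr)
  assume ne: "\<not> ult_eq M U f g"
  obtain D h where Dh: "collapse_attempt M U D h" "f \<in> ext M D" "g \<in> ext M D" using attempt_ex[OF f g] by blast
  note A = attemptD[OF Dh(1)] and hM = is_fun_in[OF attemptD(2)[OF Dh(1)]] and c = cls_eq[OF Dh(1)]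
  define S where "S = {f \<in> ext M D. \<exists>g\<in>ext M D. app M h f = app M h g \<and> \<not> ult_eq M U f g}"
  have "is_set S"
    by (rule is_set_sub[OF is_set_ext[OF A(1)], where P = "\<lambda>N f. \<exists>g\<in>ext N D. \<not> ueq N U f g \<and>
        (\<exists>y\<in>N. maps_to N h f y \<and> maps_to N h g y)"])
      (intro dfn_intros U_in A(1) hM, auto simp: S_def ueq_iff A(3) maps_to_iff[OF A(2)] app_in[OF A(2)])
  moreover have "f \<in> S" using Dh(2,3) eq ne c unfolding S_def by auto
  ultimately obtain d where d: "d \<in> S" and min: "\<And>e. e \<in> S \<Longrightarrow> \<not> ult_mem M U e d"
    using ult_mem_wf[of S] A(3) unfolding S_def by blast
  then obtain d' where dd: "d \<in> ext M D" "d' \<in> ext M D" "\<not> ult_eq M U d d'" "app M h d = app M h d'"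
    unfolding S_def by blast
  note fd = A(3)[OF dd(1)] A(3)[OF dd(2)]
  \<comment> \<open>Minimality of \<open>d\<close> in usable form: below \<open>d\<close>, equality
    of classes is equality modulo \<open>U\<close>. Arbitrary functions are first replaced by
    representatives in the domain \<open>D\<close>.\<close>
  have key: "ult_eq M U e1 e2"
    if e: "fn e1" "fn e2" "ult_mem M U e1 d" "ult_mem M U e2 d'" "cls e1 = cls e2" for e1 e2
  proof -
    obtain e1' where e1': "e1' \<in> ext M D" "ult_eq M U e1' e1" using A(4)[OF dd(1) e(1,3)] by blast
    obtain e2' where e2': "e2' \<in> ext M D" "ult_eq M U e2' e2" using A(4)[OF dd(2) e(2,4)] by blast
    note fe = A(3)[OF e1'(1)] A(3)[OF e2'(1)]
    have "ult_mem M U e1' d" using ult_mem_cong[OF fe(1) fd(1) ult_eq_sym[OF e1'(2)] ult_eq_refl e(3)] .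
    then have "e1' \<notin> S" using min by blast
    moreover have "app M h e1' = app M h e2'"
      using cls_cong[OF fe(1) e(1) e1'(2)] cls_cong[OF fe(2) e(2) e2'(2)] e(5) c[OF e1'(1)] c[OF e2'(1)] by simp
    ultimately have "ult_eq M U e1' e2'" using e1'(1) e2'(1) unfolding S_def by blast
    then show ?thesis
      using ult_eq_trans[OF e(1) e(2) ult_eq_sym[OF e1'(2)] ult_eq_trans[OF fe(1) e(2) _ e2'(2)]] by blast
  qed
  have eqc: "cls d = cls d'" using dd c by simp
  define W where "W a b = {x \<in> ext M X. \<exists>z\<in>ext M (app M a x). z \<notin> ext M (app M b x)}" for a b
  have W_set: "is_set (W a b)" if "fn a" "fn b" for a b
  proof -
    \<comment> \<open>The formula says that some \<open>z\<close> (variable 2) belongs to variable 0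
      and not to variable 1, which are read as the values of \<open>a\<close> and
      \<open>b\<close>.\<close>
    have "is_set {x \<in> ext M X. sat M (FNeg (FAll 2 (FNeg (FConj (FMem 2 0) (FNeg (FMem 2 1)))))) (\<lambda>n. app M (case_nat a (\<lambda>_. b) n) x)}"
      by (rule is_set_sat) (use that in \<open>auto split: nat.split\<close>)
    then show ?thesis unfolding W_def by (simp add: ext_def numeral_2_eq_2 Bex_def conj_assoc cong: conj_cong)
  qed
  have wit: "\<exists>e. fn e \<and> ult_mem M U e a \<and> \<not> ult_mem M U e b" if ab: "fn a" "fn b" "large (W a b)" for a b
  proof -
    have "\<exists>e. is_fun M e X \<and> (\<forall>x\<in>ext M X. \<forall>u\<in>M. \<forall>v\<in>M. maps_to M a x u \<longrightarrow> maps_to M b x v \<longrightarrow>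
        (app M e x \<in> ext M u \<and> app M e x \<notin> ext M v) \<or> (\<forall>z\<in>ext M u. z \<in> ext M v))"
    proof (rule choice_fun[OF X_in, where Q = "\<lambda>N x y. \<forall>u\<in>N. \<forall>v\<in>N. maps_to N a x u \<longrightarrow> maps_to N b x v \<longrightarrow>
        (y \<in> ext N u \<and> y \<notin> ext N v) \<or> (\<forall>z\<in>ext N u. z \<in> ext N v)"])
      show "DM (\<lambda>N s. \<forall>u\<in>N. \<forall>v\<in>N. maps_to N a (s 0) u \<longrightarrow> maps_to N b (s 0) v \<longrightarrow>
        (s 1 \<in> ext N u \<and> s 1 \<notin> ext N v) \<or> (\<forall>z\<in>ext N u. z \<in> ext N v))"
        by (intro dfn_intros is_fun_in[OF ab(1)] is_fun_in[OF ab(2)])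
      fix x assume "x \<in> ext M X"
      show "\<exists>y\<in>M. \<forall>u\<in>M. \<forall>v\<in>M. maps_to M a x u \<longrightarrow> maps_to M b x v \<longrightarrow>
        (y \<in> ext M u \<and> y \<notin> ext M v) \<or> (\<forall>z\<in>ext M u. z \<in> ext M v)"
      proof (cases "\<exists>z\<in>ext M (app M a x). z \<notin> ext M (app M b x)")
        case True
        then show ?thesis using ext_in unfolding maps_to_iff[OF ab(1)] maps_to_iff[OF ab(2)] by blast
      next
        case False
        then show ?thesis using X_in unfolding maps_to_iff[OF ab(1)] maps_to_iff[OF ab(2)] by blast
      qed
    qed
    then obtain e where e: "fn e" and "\<forall>x\<in>ext M X. \<forall>u\<in>M. \<forall>v\<in>M. maps_to M a x u \<longrightarrow> maps_to M b x v \<longrightarrow>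
        (app M e x \<in> ext M u \<and> app M e x \<notin> ext M v) \<or> (\<forall>z\<in>ext M u. z \<in> ext M v)" by (elim exE conjE)
    then have eW: "app M e x \<in> ext M (app M a x) \<and> app M e x \<notin> ext M (app M b x)" if "x \<in> W a b" for x
      using that app_maps[OF ab(1)] app_maps[OF ab(2)] app_in[OF ab(1)] app_in[OF ab(2)] unfolding W_def by blast
    have "ult_mem M U e a"
      unfolding ult_mem_iff by (rule large_mono[OF ab(3) is_set_mem[OF e ab(1)]])
        (use eW in \<open>auto simp: W_def in_ext_iff\<close>)
    moreover have "\<not> ult_mem M U e b"
    proof
      assume "ult_mem M U e b"
      then have "large (W a b \<inter> {x \<in> ext M X. app M e x \<epsilon> app M b x})"
        unfolding ult_mem_iff using large_Int ab(3) by blast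
      then obtain x where "x \<in> W a b" "x \<in> ext M X" "app M e x \<epsilon> app M b x" using large_nonempty by blast
      then show False using eW app_in[OF e] unfolding ext_def by blast
    qed
    ultimately show ?thesis using e by blast
  qed
  have "ext M X = {x \<in> ext M X. app M d x = app M d' x} \<union> (W d d' \<union> W d' d)"
    unfolding W_def using ext_inject app_in[OF fd(1)] app_in[OF fd(2)] by blast
  then have "large (W d d' \<union> W d' d)"
    using large_Un[of "{x \<in> ext M X. app M d x = app M d' x}" "W d d' \<union> W d' d"] large_X dd(3)
      is_set_eq[OF fd] is_set_Un[OF W_set[OF fd] W_set[OF fd(2,1)]] unfolding ult_eq_iff by auto
  then consider "large (W d d')" | "large (W d' d)"
    using large_Un W_set fd by blast
  then show False
  proof cases
    case 1
    then obtain e where e: "fn e" "ult_mem M U e d" "\<not> ult_mem M U e d'" using wit fd by blast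
    have "cls e \<in> ext M (cls d')" using e ext_cls[OF fd(1)] eqc by auto
    then obtain e' where e': "fn e'" "ult_mem M U e' d'" "cls e = cls e'" unfolding ext_cls[OF fd(2)] by auto
    have "ult_eq M U e e'" using key[OF e(1) e'(1) e(2) e'(2,3)] .
    then show False using ult_mem_cong[OF e(1) fd(2) ult_eq_sym ult_eq_refl e'(2)] e(3) by blast
  next
    case 2
    then obtain e where e: "fn e" "ult_mem M U e d'" "\<not> ult_mem M U e d" using wit fd by blast
    have "cls e \<in> ext M (cls d)" using e ext_cls[OF fd(2)] eqc by auto
    then obtain e' where e': "fn e'" "ult_mem M U e' d" "cls e = cls e'" unfolding ext_cls[OF fd(1)] by auto
    have "ult_eq M U e' e" using key[OF e'(1) e(1) e'(2) e(2) e'(3)[symmetric]] .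
    then show False using ult_mem_cong[OF e(1) fd(1) _ ult_eq_refl e'(2)] e(3) by blast
  qed
qed

lemma cls_eq_iff: "fn f \<Longrightarrow> fn g \<Longrightarrow> cls f = cls g \<longleftrightarrow> ult_eq M U f g"
  using cls_inj cls_cong by blast

lemma cls_mem_iff: "fn f \<Longrightarrow> fn g \<Longrightarrow> cls f \<epsilon> cls g \<longleftrightarrow> ult_mem M U f g"
proof -
  assume f: "fn f" and g: "fn g"
  have "cls f \<epsilon> cls g \<longleftrightarrow> cls f \<in> ext M (cls g)" using cls_in[OF f] by (simp add: ext_def)
  also have "\<dots> \<longleftrightarrow> (\<exists>f'. fn f' \<and> ult_mem M U f' g \<and> cls f = cls f')" unfolding ext_cls[OF g] by blast
  also have "\<dots> \<longleftrightarrow> ult_mem M U f g"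
    using cls_eq_iff[OF f] ult_mem_cong[OF f g ult_eq_sym ult_eq_refl] f by blast
  finally show ?thesis .
qed

abbreviation K :: "'a set" where "K \<equiv> Ult M U"

lemma K_iff: "z \<in> K \<longleftrightarrow> (\<exists>f. fn f \<and> z = cls f)"
  unfolding Ult_def using ufuns_iff by blast

lemma K_subset: "K \<subseteq> M"
  by (auto simp: K_iff cls_in)

lemma K_transitive: "x \<in> ext M y \<Longrightarrow> y \<in> K \<Longrightarrow> x \<in> K"
  unfolding K_iff using ext_cls by blast

section \<open>Los's theorem\<close>

theorem los:
  assumes F: "\<And>n. fn (F n)"
  shows "sat K p (\<lambda>n. cls (F n)) \<longleftrightarrow> large {x \<in> ext M X. sat M p (\<lambda>n. app M (F n) x)}"
  using F
proof (induction p arbitrary: F)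
  case (FMem i j)
  then show ?case by (simp add: cls_mem_iff ult_mem_iff)
next
  case (FEq i j)
  then show ?case by (simp add: cls_eq_iff ult_eq_iff)
next
  case (FNeg p)
  have "{x \<in> ext M X. sat M (FNeg p) (\<lambda>n. app M (F n) x)} = ext M X - {x \<in> ext M X. sat M p (\<lambda>n. app M (F n) x)}"
    by auto
  then show ?case using large_Diff[OF is_set_sat[OF FNeg(2), of p]] FNeg(1)[OF FNeg(2)] by auto
next
  case (FConj p q)
  have "{x \<in> ext M X. sat M (FConj p q) (\<lambda>n. app M (F n) x)} =
    {x \<in> ext M X. sat M p (\<lambda>n. app M (F n) x)} \<inter> {x \<in> ext M X. sat M q (\<lambda>n. app M (F n) x)}" by auto
  then show ?case
    using large_Int_iff[OF is_set_sat[OF FConj(3), of p] _ is_set_sat[OF FConj(3), of q]]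
      FConj(1)[OF FConj(3)] FConj(2)[OF FConj(3)] by auto
next
  case (FAll i p)
  define Y where "Y = {x \<in> ext M X. \<forall>a\<in>M. sat M p ((\<lambda>n. app M (F n) x)(i := a))}"
  define Z where "Z G = {x \<in> ext M X. sat M p ((\<lambda>n. app M (F n) x)(i := app M G x))}" for G
  have upd: "(\<lambda>n. app M ((F(i := G)) n) x) = (\<lambda>n. app M (F n) x)(i := app M G x)" for G x by auto
  have IH: "sat K p ((\<lambda>n. cls (F n))(i := cls G)) \<longleftrightarrow> large (Z G)" if "fn G" for G
  proof -
    have "fn ((F(i := G)) n)" for n using FAll(2) that by simp
    from FAll(1)[of "F(i := G)", OF this] have "sat K p (\<lambda>n. cls ((F(i := G)) n)) \<longleftrightarrow> large (Z G)" unfolding Z_def upd .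
    moreover have "(\<lambda>n. cls ((F(i := G)) n)) = (\<lambda>n. cls (F n))(i := cls G)" by auto
    ultimately show ?thesis by simp
  qed
  have setZ: "is_set (Z G)" if "fn G" for G
    using is_set_sat[of "F(i := G)" p] that FAll(2) unfolding Z_def upd by simp
  have setY: "is_set Y" using is_set_sat[OF FAll(2), of "FAll i p"] unfolding Y_def by simp
  have "sat K (FAll i p) (\<lambda>n. cls (F n)) \<longleftrightarrow> (\<forall>G. fn G \<longrightarrow> large (Z G))"
    using IH K_iff by (auto simp: Ball_def)
  also have "\<dots> \<longleftrightarrow> large Y"
  proof
    assume "large Y"
    moreover have "Y \<subseteq> Z G" if "fn G" for G using app_in[OF that] unfolding Y_def Z_def by blast
    ultimately show "\<forall>G. fn G \<longrightarrow> large (Z G)" using large_mono[OF _ setZ] unfolding Z_def by blast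
  next
    assume all: "\<forall>G. fn G \<longrightarrow> large (Z G)"
    \<comment> \<open>By choice, \<open>G\<close> picks a counterexample to \<open>p\<close>
      wherever the universal formula fails. Hence the set where \<open>p\<close> holds at
      \<open>G\<close> is included in \<open>Y\<close>.\<close>
    have "\<exists>G. is_fun M G X \<and> (\<forall>x\<in>ext M X. \<not> sat M p ((val F x)(i := app M G x)) \<or> sat M (FAll i p) (val F x))"
      by (rule choice_fun[OF X_in, where Q = "\<lambda>N x a. \<not> sat N p ((val F x)(i := a)) \<or> sat N (FAll i p) (val F x)"])
        (intro dfn_disj dfn_not dfn_sat_val_upd dfn_sat_val FAll(2), use X_in in auto)
    then obtain G where G: "fn G" "\<And>x. x \<in> ext M X \<Longrightarrow>
      \<not> sat M p ((val F x)(i := app M G x)) \<or> sat M (FAll i p) (val F x)" by blast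
    have "Z G \<subseteq> Y" using G(2) unfolding Z_def Y_def by (auto simp: val_eq)
    then show "large Y" using large_mono[OF _ setY] all G(1) unfolding Y_def by blast
  qed
  finally show ?case unfolding Y_def by simp
qed

section \<open>The ultrapower embedding, the seed and transfer of definable properties\<close>

definition const :: "'a \<Rightarrow> 'a" where
  "const a = (THE c. fn c \<and> (\<forall>x\<in>ext M X. app M c x = a))"

lemma const: "a \<in> M \<Longrightarrow> fn (const a)" "a \<in> M \<Longrightarrow> x \<in> ext M X \<Longrightarrow> app M (const a) x = a"
  using theI'[OF const_fun_ex[OF X_in, of a]] unfolding const_def by blast+

lemma const_unique: "fn c \<Longrightarrow> (\<And>x. x \<in> ext M X \<Longrightarrow> app M c x = a) \<Longrightarrow> a \<in> M \<Longrightarrow> c = const a"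
  by (rule fun_eqI) (auto simp: const)

abbreviation emb :: "'a \<Rightarrow> 'a" where "emb \<equiv> ult_emb M U"

lemma emb_eq: "emb a = cls (const a)"
  unfolding ult_emb_def const_def ufuns_iff underlying_eq ..

lemma emb_in: "a \<in> M \<Longrightarrow> emb a \<in> K"
  unfolding emb_eq K_iff using const(1) by blast

definition idf :: "'a" where
  "idf = (THE c. fn c \<and> (\<forall>x\<in>ext M X. app M c x = x))"

lemma idf: "fn idf" "x \<in> ext M X \<Longrightarrow> app M idf x = x"
  using theI'[OF id_fun_ex[OF X_in]] unfolding idf_def by blast+

lemma seed_eq: "seed M U = cls idf"
  unfolding seed_def idf_def ufuns_iff underlying_eq ..

lemma seed_in: "seed M U \<in> K"
  unfolding seed_eq K_iff using idf by blast

text \<open>With an empty parameter set every term is a variable, and with \<open>M\<close> and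
  \<open>K\<close> both in \<open>C\<close> the same formula defines \<open>R\<close> over both; so
  Los's theorem can be applied to notions without exhibiting their formulas.\<close>

lemma los_dfn:
  assumes R: "dfn C {} R" and C: "M \<in> C" "K \<in> C" and F: "\<And>n. fn (F n)"
  shows "R K (\<lambda>n. cls (F n)) \<longleftrightarrow> large {x \<in> ext M X. R M (\<lambda>n. app M (F n) x)}"
proof -
  from R obtain p \<tau> where \<tau>: "\<And>n. tm {} (\<tau> n)"
    and p: "\<And>N s. N \<in> C \<Longrightarrow> {} \<subseteq> N \<Longrightarrow> range s \<subseteq> N \<Longrightarrow> R N s = sat N p (\<lambda>n. \<tau> n s)" by (rule dfnE) blast
  obtain i where i: "\<And>n. \<tau> n = (\<lambda>s. s (i n))" using \<tau> unfolding tm_def by (metis empty_iff)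
  have "range (\<lambda>n. cls (F n)) \<subseteq> K" using F K_iff by blast
  then have "R K (\<lambda>n. cls (F n)) \<longleftrightarrow> sat K p (\<lambda>n. cls (F (i n)))" using p[OF C(2)] i by simp
  also have "\<dots> \<longleftrightarrow> large {x \<in> ext M X. sat M p (\<lambda>n. app M (F (i n)) x)}" by (rule los) (rule F)
  also have "{x \<in> ext M X. sat M p (\<lambda>n. app M (F (i n)) x)} = {x \<in> ext M X. R M (\<lambda>n. app M (F n) x)}"
  proof (rule Collect_cong, rule conj_cong[OF refl])
    fix x assume "x \<in> ext M X"
    then have "range (\<lambda>n. app M (F n) x) \<subseteq> M" using app_in[OF F] by blast
    from p[OF C(1) _ this] show "sat M p (\<lambda>n. app M (F (i n)) x) = R M (\<lambda>n. app M (F n) x)" using i by simp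
  qed
  finally show ?thesis .
qed

lemma emb_dfn:
  assumes R: "dfn C {} R" and C: "M \<in> C" "K \<in> C" and s: "range s \<subseteq> M"
  shows "R K (\<lambda>n. emb (s n)) \<longleftrightarrow> R M s"
proof -
  have sM: "s n \<in> M" for n using s by blast
  have eq: "{x \<in> ext M X. R M (\<lambda>n. app M (const (s n)) x)} = (if R M s then ext M X else {})"
    using const(2)[OF sM] by (auto cong: conj_cong)
  have "R K (\<lambda>n. cls (const (s n))) \<longleftrightarrow> large (if R M s then ext M X else {})"
    unfolding eq[symmetric] by (rule los_dfn[OF R C]) (rule const(1)[OF sM])
  then show ?thesis unfolding emb_eq using large_X large_nonempty[of "{}"] by auto
qed

lemma sentence_transfer:
  assumes R: "dfn UNIV {} (\<lambda>N s. R N)" and "R M" shows "R K"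
  using emb_dfn[OF R, of "\<lambda>_. X"] X_in assms(2) by auto

text \<open>Meant for instances of schemes, whose parameters form an assignment into
  \<open>K\<close>: each parameter is the class of a function, and the instance holds in
  \<open>M\<close> at the values of these functions at every point.\<close>

lemma sentence_family_transfer:
  assumes R: "dfn UNIV {} R" and "\<And>s. range s \<subseteq> M \<Longrightarrow> R M s" and s: "range s \<subseteq> K"
  shows "R K s"
proof -
  have "\<exists>f. fn f \<and> s n = cls f" for n using s K_iff by blast
  then obtain F where F: "\<And>n. fn (F n)" "\<And>n. s n = cls (F n)" by metis
  have "R M (\<lambda>n. app M (F n) x)" if "x \<in> ext M X" for x
    by (rule assms(2)) (use app_in[OF F(1) that] in auto)
  then have "{x \<in> ext M X. R M (\<lambda>n. app M (F n) x)} = ext M X" by blast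
  then have "R K (\<lambda>n. cls (F n))" using los_dfn[OF R _ _ F(1)] large_X by simp
  moreover have "s = (\<lambda>n. cls (F n))" using F(2) by auto
  ultimately show ?thesis by simp
qed

end

context set_structure
begin

section \<open>The axioms of ZFC in the ultrapower\<close>

lemma dfn_sat_upd1: "dfn C A (\<lambda>N s. sat N p ((\<lambda>n. s (g n))(0 := s i)))"
proof -
  define v where "v n = (if n = 0 then (\<lambda>s :: nat \<Rightarrow> 'v. s i) else (\<lambda>s. s (g n)))" for n
  have "dfn C A (\<lambda>N s. sat N p (\<lambda>n. v n s))"
    by (rule dfn_sat) (simp add: v_def tm_var)
  moreover have "(\<lambda>n. v n s) = (\<lambda>n. s (g n))(0 := s i)" for s :: "nat \<Rightarrow> 'v"
    by (auto simp: v_def)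
  ultimately show ?thesis by (simp only:)
qed

lemma dfn_sat_upd2: "dfn C A (\<lambda>N s. sat N p ((\<lambda>n. s (g n))(0 := s i, 1 := s j)))"
proof -
  define v where "v n = (if n = 1 then (\<lambda>s :: nat \<Rightarrow> 'v. s j) else if n = 0 then (\<lambda>s. s i) else (\<lambda>s. s (g n)))" for n
  have "dfn C A (\<lambda>N s. sat N p (\<lambda>n. v n s))"
    by (rule dfn_sat) (simp add: v_def tm_var)
  moreover have "(\<lambda>n. v n s) = (\<lambda>n. s (g n))(0 := s i, 1 := s j)" for s :: "nat \<Rightarrow> 'v"
    by (auto simp: v_def)
  ultimately show ?thesis by (simp only:)
qed

lemma dfn_foundation: "dfn C A (\<lambda>N s. foundation N)"
proof -
  have "dfn C A (\<lambda>N s. \<forall>x\<in>N. ext N x \<noteq> {} \<longrightarrow> (\<exists>y\<in>ext N x. \<forall>z\<in>ext N y. z \<notin> ext N x))"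
    by (intro dfn_intros)
  moreover have "(\<forall>z\<in>ext N y. z \<notin> ext N x) \<longleftrightarrow> ext N y \<inter> ext N x = {}" for N x y by blast
  ultimately show ?thesis unfolding foundation_def by simp
qed

lemma dfn_extensionality: "dfn C A (\<lambda>N s. extensionality N)"
proof -
  have "dfn C A (\<lambda>N s. \<forall>x\<in>N. \<forall>y\<in>N. ext N x \<subseteq> ext N y \<and> ext N y \<subseteq> ext N x \<longrightarrow> x = y)"
    by (intro dfn_intros)
  then show ?thesis by (rule dfn_cong) (auto simp: extensionality_def)
qed

lemma dfn_pairing: "dfn C A (\<lambda>N s. pairing N)"
  unfolding pairing_def by (intro dfn_intros)

lemma dfn_union: "dfn C A (\<lambda>N s. union_axiom N)"
proof -
  have "dfn C A (\<lambda>N s. \<forall>a\<in>N. \<exists>u\<in>N. ext N u = {z \<in> N. \<exists>x\<in>ext N a. z \<epsilon> x})"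
    by (intro dfn_intros)
  moreover have "{z \<in> N. \<exists>x\<in>ext N a. z \<epsilon> x} = (\<Union>x\<in>ext N a. ext N x)" for N a
    unfolding ext_def by blast
  ultimately show ?thesis unfolding union_axiom_def by simp
qed

lemma dfn_power_set: "dfn C A (\<lambda>N s. power_set N)"
  unfolding power_set_def by (intro dfn_intros)

lemma dfn_infinity: "dfn C A (\<lambda>N s. infinity N)"
  unfolding infinity_def by (intro dfn_intros)

lemma dfn_choice: "dfn C A (\<lambda>N s. choice N)"
proof -
  have "dfn C A (\<lambda>N s. \<forall>a\<in>N.
        (\<forall>x\<in>ext N a. ext N x \<noteq> {}) \<longrightarrow>
        (\<forall>x\<in>ext N a. \<forall>y\<in>ext N a. x \<noteq> y \<longrightarrow> (\<forall>z\<in>ext N x. z \<notin> ext N y)) \<longrightarrow>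
        (\<exists>c\<in>N. \<forall>x\<in>ext N a. \<exists>!z. z \<in> N \<and> (z \<epsilon> c \<and> z \<epsilon> x)))"
    by (intro dfn_intros)
  moreover have eq1: "z \<in> ext N c \<inter> ext N x \<longleftrightarrow> z \<in> N \<and> (z \<epsilon> c \<and> z \<epsilon> x)" for z c x N
    unfolding ext_def by blast
  moreover have eq2: "ext N x \<inter> ext N y = {} \<longleftrightarrow> (\<forall>z\<in>ext N x. z \<notin> ext N y)" for N x y by blast
  ultimately show ?thesis unfolding choice_def eq1 eq2 by blast
qed

text \<open>A scheme quantifies over formulas and is transferred one instance at a time: with
  \<open>p\<close> fixed, the instance is a single formula whose parameters are the variables of the
  environment.\<close>

lemma dfn_separation_instance:
  "dfn C A (\<lambda>N s. \<forall>a\<in>N. \<exists>b\<in>N. ext N b = {x \<in> ext N a. sat N p (s(0 := x))})"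
  by (intro dfn_intros dfn_sat_upd1)

lemma dfn_replacement_instance:
  "dfn C A (\<lambda>N s. \<forall>a\<in>N.
           (\<forall>x\<in>ext N a. \<forall>y\<in>N. \<forall>y'\<in>N.
              sat N p (s(0 := x, 1 := y)) \<longrightarrow> sat N p (s(0 := x, 1 := y')) \<longrightarrow> y = y') \<longrightarrow>
           (\<exists>b\<in>N. ext N b = {y \<in> N. \<exists>x\<in>ext N a. sat N p (s(0 := x, 1 := y))}))"
  by (intro dfn_intros dfn_sat_upd2)

end

context ultrafilter_model
begin

theorem ZFC_K: "ZFC K"
proof -
  note Z = ZFC_M[unfolded ZFC_def]
  have "separation K"
    unfolding separation_def
    by (intro allI impI, rule sentence_family_transfer[OF dfn_separation_instance])
      (use Z in \<open>auto simp: separation_def\<close>)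
  moreover have "replacement K"
    unfolding replacement_def
  proof (intro allI impI, rule sentence_family_transfer[OF dfn_replacement_instance])
    fix p and s :: "nat \<Rightarrow> 'a" assume s: "range s \<subseteq> M"
    have "replacement M" using Z by blast
    from this[unfolded replacement_def, THEN spec, of p, THEN spec, of s, THEN mp, OF s]
    show "\<forall>a\<in>M. (\<forall>x\<in>ext M a. \<forall>y\<in>M. \<forall>y'\<in>M.
        sat M p (s(0 := x, 1 := y)) \<longrightarrow> sat M p (s(0 := x, 1 := y')) \<longrightarrow> y = y') \<longrightarrow>
      (\<exists>b\<in>M. ext M b = {y \<in> M. \<exists>x\<in>ext M a. sat M p (s(0 := x, 1 := y))})" .
  qed
  ultimately show ?thesis
    unfolding ZFC_def
    using Z dfn_foundation dfn_extensionality dfn_pairing dfn_union dfn_power_set dfn_infinity dfn_choice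
    by (blast intro: sentence_transfer)
qed

lemma K_model: "zfc_model E K"
  by unfold_locales (rule ZFC_K)

text \<open>Countable completeness makes a function into the naturals constant on a large set.\<close>

lemma emb_omega:
  assumes m: "m \<in> K" "m \<epsilon> emb (omega M)"
  shows "\<exists>n\<in>ext M (omega M). m = emb n"
proof (rule ccontr)
  assume no: "\<not> ?thesis"
  obtain f where f: "fn f" "m = cls f" using m(1) K_iff by blast
  note fM = is_fun_in[OF f(1)]
  have "ult_mem M U f (const (omega M))" using m(2) f cls_mem_iff const(1)[OF omega_in] unfolding emb_eq by blast
  then have L: "large {x \<in> ext M X. app M f x \<epsilon> omega M}"
    unfolding ult_mem_iff by (simp add: const(2)[OF omega_in] cong: conj_cong)
  have nl: "\<not> large {x \<in> ext M X. app M f x = n}" if n: "n \<in> ext M (omega M)" for n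
  proof -
    have nM: "n \<in> M" using n ext_in by blast
    have "\<not> ult_eq M U f (const n)" using no f n cls_eq_iff[OF f(1) const(1)[OF nM]] unfolding emb_eq by blast
    then show ?thesis unfolding ult_eq_iff by (simp add: const(2)[OF nM] cong: conj_cong)
  qed
  have set: "is_set {x \<in> ext M X. app M f x = n}" if "n \<in> M" for n
    using is_set_eq[OF f(1) const(1)[OF that]] by (simp add: const(2)[OF that] cong: conj_cong)
  \<comment> \<open>The sequence of complements of the fibres of \<open>f\<close> over the naturals.
    If \<open>m\<close> is no \<open>emb n\<close>, all of them are large, and so is their
    intersection with the set where \<open>f\<close> takes a natural value, which is empty.\<close>
  have "\<exists>H. is_fun M H (omega M) \<and> (\<forall>n\<in>ext M (omega M). ext M (app M H n) = {x \<in> ext M X. \<not> maps_to M f x n})"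
  proof (rule mk_fun[OF omega_in, where Q = "\<lambda>N n A. ext N A = {x \<in> ext N X. \<not> maps_to N f x n}"])
    show "DM (\<lambda>N s. ext N (s 1) = {x \<in> ext N X. \<not> maps_to N f x (s 0)})" by (intro dfn_intros X_in fM)
    fix n assume n: "n \<in> ext M (omega M)"
    have "is_set {x \<in> ext M X. \<not> maps_to M f x n}"
      by (rule is_set_sep[OF is_set_ext[OF X_in]]) (intro dfn_intros fM ext_in[OF n])
    then show "\<exists>!A. A \<in> M \<and> ext M A = {x \<in> ext M X. \<not> maps_to M f x n}"
      using ext_inject unfolding is_set_def by metis
  qed
  then obtain H where H: "is_fun M H (omega M)"
    "\<And>n. n \<in> ext M (omega M) \<Longrightarrow> ext M (app M H n) = {x \<in> ext M X. \<not> maps_to M f x n}" by blast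
  have H': "ext M (app M H n) = ext M X - {x \<in> ext M X. app M f x = n}" if "n \<in> ext M (omega M)" for n
    unfolding H(2)[OF that] maps_to_iff[OF f(1)] by blast
  have "large (\<Inter>n\<in>ext M (omega M). ext M (app M H n))"
  proof (rule large_omega[OF H(1)])
    fix n assume n: "n \<in> ext M (omega M)"
    show "large (ext M (app M H n))"
      unfolding H'[OF n] using large_Diff[OF set[OF ext_in[OF n]]] nl[OF n] by blast
  qed
  from large_nonempty[OF large_Int[OF this L]]
  obtain x where x: "x \<in> ext M X" "app M f x \<epsilon> omega M" "\<And>n. n \<in> ext M (omega M) \<Longrightarrow> x \<in> ext M (app M H n)" by blast
  have "app M f x \<in> ext M (omega M)" using x(2) app_in[OF f(1) x(1)] unfolding ext_def by blast
  then show False using x(3) H' by blast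
qed

end

section \<open>Definability of ultrapowers and the Ultrapower Axiom\<close>

context set_structure
begin

abbreviation ZFCs :: "'v set set" where "ZFCs \<equiv> Collect ZFC"

text \<open>Trades the description \<open>omega\<close> for a first-order characterisation, so that
  a definition can quantify over it instead of naming it.\<close>

lemma omega_unique: "ZFC N \<Longrightarrow> w \<in> N \<and> ext N w = {n \<in> N. natural N n} \<longleftrightarrow> w = omega N"
proof -
  assume "ZFC N"
  then interpret zfc_model E N by unfold_locales
  have "{n \<in> N. natural N n} = {n. natural N n}" unfolding natural_def ordinal_def by blast
  then show ?thesis using omega_spec ext_inject by auto
qed

lemma omega_nonempty: "ZFC N \<Longrightarrow> ext N (omega N) \<noteq> {}"
proof -
  assume "ZFC N"
  then interpret zfc_model E N by unfold_locales
  show ?thesis using zero_ex by blast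
qed

section \<open>Definability of countably complete ultrafilters\<close>

text \<open>The clause is written with an unbounded \<open>F\<close>, with \<open>omega\<close>,
  with \<open>app\<close> and with a HOL intersection. A bounded quantifier, the defining property
  of omega, \<open>maps_to\<close> and a comprehension bounded by \<open>N\<close> replace these;
  agreement rests on \<open>N\<close> being a model of ZFC.\<close>

lemma dfn_complete:
  assumes C: "C \<subseteq> ZFCs" and u: "tm A u"
  shows "dfn C A (\<lambda>N s. \<forall>F. is_fun N F (omega N) \<and> (\<forall>n\<in>ext N (omega N). app N F n \<in> ext N (u s)) \<longrightarrow>
        (\<exists>B\<in>ext N (u s). ext N B = (\<Inter>n\<in>ext N (omega N). ext N (app N F n))))"
proof (rule dfn_subst1[OF _ u, where R = "\<lambda>N U. \<forall>F. is_fun N F (omega N) \<and> (\<forall>n\<in>ext N (omega N). app N F n \<in> ext N U) \<longrightarrow>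
        (\<exists>B\<in>ext N U. ext N B = (\<Inter>n\<in>ext N (omega N). ext N (app N F n)))"])
  have "dfn C A (\<lambda>N s. \<forall>w\<in>N. ext N w = {n \<in> N. natural N n} \<longrightarrow>
    (\<forall>F\<in>N. is_fun N F w \<and> (\<forall>n\<in>ext N w. \<exists>A\<in>ext N (s 0). maps_to N F n A) \<longrightarrow>
      (\<exists>B\<in>ext N (s 0). ext N B = {z \<in> N. \<forall>n\<in>ext N w. \<exists>A\<in>N. maps_to N F n A \<and> z \<epsilon> A})))"
    by (intro dfn_intros)
  then show "dfn C A (\<lambda>N s. \<forall>F. is_fun N F (omega N) \<and> (\<forall>n\<in>ext N (omega N). app N F n \<in> ext N (s 0)) \<longrightarrow>
        (\<exists>B\<in>ext N (s 0). ext N B = (\<Inter>n\<in>ext N (omega N). ext N (app N F n))))"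
  proof (rule dfn_cong)
    fix N and s :: "nat \<Rightarrow> 'v" assume "N \<in> C"
    then have Z: "ZFC N" using C by blast
    interpret zfc_model E N using Z by unfold_locales
    have w: "w \<in> N \<and> ext N w = {n \<in> N. natural N n} \<longleftrightarrow> w = omega N" for w by (rule omega_unique[OF Z])
    have F: "(is_fun N F (omega N) \<and> (\<forall>n\<in>ext N (omega N). app N F n \<in> ext N (s 0)) \<longrightarrow>
        (\<exists>B\<in>ext N (s 0). ext N B = (\<Inter>n\<in>ext N (omega N). ext N (app N F n)))) \<longleftrightarrow>
      (F \<in> N \<longrightarrow> is_fun N F (omega N) \<and> (\<forall>n\<in>ext N (omega N). \<exists>A\<in>ext N (s 0). maps_to N F n A) \<longrightarrow>
      (\<exists>B\<in>ext N (s 0). ext N B = {z \<in> N. \<forall>n\<in>ext N (omega N). \<exists>A\<in>N. maps_to N F n A \<and> z \<epsilon> A}))" for F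
    proof (cases "is_fun N F (omega N)")
      case True
      \<comment> \<open>Nonemptiness of omega matters: over an empty index set the HOL intersection
        is the whole type, while the comprehension is \<open>N\<close>.\<close>
      have "{z \<in> N. \<forall>n\<in>ext N (omega N). \<exists>A\<in>N. maps_to N F n A \<and> z \<epsilon> A} = (\<Inter>n\<in>ext N (omega N). ext N (app N F n))"
        unfolding maps_to_iff[OF True] using app_in[OF True] omega_nonempty[OF Z] by (auto simp: in_ext_iff)
      moreover have "(\<exists>A\<in>ext N (s 0). maps_to N F n A) \<longleftrightarrow> app N F n \<in> ext N (s 0)" if "n \<in> ext N (omega N)" for n
        unfolding maps_to_iff[OF True] using that by blast
      ultimately show ?thesis using is_fun_in[OF True] by simp
    qed simp
    define P where "P w F \<longleftrightarrow> (is_fun N F w \<and> (\<forall>n\<in>ext N w. \<exists>A\<in>ext N (s 0). maps_to N F n A) \<longrightarrow>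
      (\<exists>B\<in>ext N (s 0). ext N B = {z \<in> N. \<forall>n\<in>ext N w. \<exists>A\<in>N. maps_to N F n A \<and> z \<epsilon> A}))" for w F
    have P: "(\<forall>F. F \<in> N \<longrightarrow> P (omega N) F) \<longleftrightarrow>
      (\<forall>w\<in>N. ext N w = {n \<in> N. natural N n} \<longrightarrow> (\<forall>F\<in>N. P w F))"
      using w by metis
    show "(\<forall>F. is_fun N F (omega N) \<and> (\<forall>n\<in>ext N (omega N). app N F n \<in> ext N (s 0)) \<longrightarrow>
        (\<exists>B\<in>ext N (s 0). ext N B = (\<Inter>n\<in>ext N (omega N). ext N (app N F n)))) =
      (\<forall>w\<in>N. ext N w = {n \<in> N. natural N n} \<longrightarrow>
    (\<forall>F\<in>N. is_fun N F w \<and> (\<forall>n\<in>ext N w. \<exists>A\<in>ext N (s 0). maps_to N F n A) \<longrightarrow>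
      (\<exists>B\<in>ext N (s 0). ext N B = {z \<in> N. \<forall>n\<in>ext N w. \<exists>A\<in>N. maps_to N F n A \<and> z \<epsilon> A})))"
      using P unfolding F P_def by blast
  qed
qed

lemma dfn_cc_on:
  assumes C: "C \<subseteq> ZFCs" and u: "tm A u" and x: "tm A x"
  shows "dfn C A (\<lambda>N s. cc_ultrafilter_on N (u s) (x s))"
proof (rule dfn_subst2[where R = cc_ultrafilter_on, OF _ u x])
  have "dfn C A (\<lambda>N s. (\<forall>A\<in>ext N (s 0). ext N A \<subseteq> ext N (s 1)) \<and>
     s 1 \<in> ext N (s 0) \<and>
     (\<forall>A\<in>ext N (s 0). ext N A \<noteq> {}) \<and>
     (\<forall>A\<in>ext N (s 0). \<forall>B\<in>N. ext N A \<subseteq> ext N B \<and> ext N B \<subseteq> ext N (s 1) \<longrightarrow> B \<in> ext N (s 0)) \<and>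
     (\<forall>A\<in>N. ext N A \<subseteq> ext N (s 1) \<longrightarrow>
        A \<in> ext N (s 0) \<or> (\<exists>B\<in>ext N (s 0). ext N B = {z \<in> ext N (s 1). z \<notin> ext N A})) \<and>
     (\<forall>F. is_fun N F (omega N) \<and> (\<forall>n\<in>ext N (omega N). app N F n \<in> ext N (s 0)) \<longrightarrow>
        (\<exists>B\<in>ext N (s 0). ext N B = (\<Inter>n\<in>ext N (omega N). ext N (app N F n)))))"
    by (intro dfn_intros dfn_complete[OF C])
  then show "dfn C A (\<lambda>N s. cc_ultrafilter_on N (s 0) (s 1))"
    by (rule dfn_cong) (simp add: cc_ultrafilter_on_def image_subset_iff set_diff_eq)
qed

lemma dfn_cc:
  assumes C: "C \<subseteq> ZFCs" and u: "tm A u"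
  shows "dfn C A (\<lambda>N s. cc_ultrafilter N (u s))"
proof (rule dfn_subst1[where R = cc_ultrafilter, OF _ u])
  have "dfn C A (\<lambda>N s. \<exists>X\<in>N. cc_ultrafilter_on N (s 0) X)"
    by (intro dfn_intros dfn_cc_on[OF C])
  then show "dfn C A (\<lambda>N s. cc_ultrafilter N (s 0))"
    by (rule dfn_cong) (auto simp: cc_ultrafilter_def cc_ultrafilter_on_def)
qed

lemma cc_model:
  assumes "ZFC N" "cc_ultrafilter N U"
  obtains X where "ultrafilter_model E N U X"
proof -
  obtain X where "cc_ultrafilter_on N U X" using assms(2) unfolding cc_ultrafilter_def by blast
  then have "ultrafilter_model E N U X" using assms(1) by unfold_locales
  then show thesis by (rule that)
qed

section \<open>The ultrapower and its embedding in first-order form\<close>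

text \<open>\<open>collapse_attempt\<close> with \<open>app\<close>, \<open>ult_eq\<close> and
  \<open>ult_mem\<close> replaced by \<open>maps_to\<close>, \<open>ueq\<close> and
  \<open>umem\<close>. Through it \<open>is_class\<close> and \<open>is_emb\<close> become formulas,
  which makes membership in \<open>Ult\<close> and the graph of \<open>ult_emb\<close>
  definable.\<close>

definition is_attempt :: "'v set \<Rightarrow> 'v \<Rightarrow> 'v \<Rightarrow> 'v \<Rightarrow> bool" where
  "is_attempt N U D h \<longleftrightarrow> (\<forall>f\<in>ext N D. ufn N U f) \<and> is_fun N h D \<and>
     (\<forall>g\<in>ext N D. \<forall>f\<in>N. ufn N U f \<and> umem N U f g \<longrightarrow> (\<exists>f'\<in>ext N D. ueq N U f' f)) \<and>
     (\<forall>g\<in>ext N D. \<forall>v\<in>N. (\<exists>w\<in>N. maps_to N h g w \<and> v \<epsilon> w) \<longleftrightarrow> (\<exists>f\<in>ext N D. umem N U f g \<and> maps_to N h f v))"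

definition is_class :: "'v set \<Rightarrow> 'v \<Rightarrow> 'v \<Rightarrow> 'v \<Rightarrow> bool" where
  "is_class N U f z \<longleftrightarrow> (\<exists>D\<in>N. \<exists>h\<in>N. is_attempt N U D h \<and> f \<in> ext N D \<and> maps_to N h f z)"

definition is_emb :: "'v set \<Rightarrow> 'v \<Rightarrow> 'v \<Rightarrow> 'v \<Rightarrow> bool" where
  "is_emb N U a z \<longleftrightarrow> (\<exists>X\<in>N. \<exists>c\<in>N. is_underlying N U X \<and> is_fun N c X \<and>
     (\<forall>x\<in>ext N X. maps_to N c x a) \<and> is_class N U c z)"

lemma dfn_is_attempt [dfn_intros]:
  "tm A u \<Longrightarrow> tm A x \<Longrightarrow> tm A y \<Longrightarrow> dfn C A (\<lambda>N s. is_attempt N (u s) (x s) (y s))"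
  by (rule dfn_subst3[where R = is_attempt]) (unfold is_attempt_def, intro dfn_intros)

lemma dfn_is_class [dfn_intros]:
  "tm A u \<Longrightarrow> tm A x \<Longrightarrow> tm A y \<Longrightarrow> dfn C A (\<lambda>N s. is_class N (u s) (x s) (y s))"
  by (rule dfn_subst3[where R = is_class]) (unfold is_class_def, intro dfn_intros)

lemma dfn_is_emb [dfn_intros]:
  "tm A u \<Longrightarrow> tm A x \<Longrightarrow> tm A y \<Longrightarrow> dfn C A (\<lambda>N s. is_emb N (u s) (x s) (y s))"
  by (rule dfn_subst3[where R = is_emb]) (unfold is_emb_def, intro dfn_intros)

end

context ultrafilter_model
begin

lemma is_attempt_iff: "D \<in> M \<Longrightarrow> is_attempt M U D h \<longleftrightarrow> collapse_attempt M U D h"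
proof (cases "is_fun M h D \<and> (\<forall>f\<in>ext M D. fn f)")
  case True
  assume D: "D \<in> M"
  from True have h: "is_fun M h D" and f: "\<And>f. f \<in> ext M D \<Longrightarrow> fn f" by auto
  have 1: "(\<forall>f\<in>M. ufn M U f \<and> umem M U f g \<longrightarrow> (\<exists>f'\<in>ext M D. ueq M U f' f)) \<longleftrightarrow>
    (\<forall>f\<in>ufuns M U. ult_mem M U f g \<longrightarrow> (\<exists>f'\<in>ext M D. ult_eq M U f' f))" if g: "g \<in> ext M D" for g
  proof -
    have "(f' \<in> M \<longrightarrow> ufn M U f' \<and> umem M U f' g \<longrightarrow> (\<exists>f''\<in>ext M D. ueq M U f'' f')) \<longleftrightarrow>
      (f' \<in> ufuns M U \<longrightarrow> ult_mem M U f' g \<longrightarrow> (\<exists>f''\<in>ext M D. ult_eq M U f'' f'))" for f'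
    proof (cases "fn f'")
      case True
      then show ?thesis using is_fun_in[OF True] umem_iff[OF True f[OF g]] ueq_iff[OF f True]
        by (simp add: ufn_iff ufuns_iff)
    qed (simp add: ufn_iff ufuns_iff)
    then show ?thesis unfolding Ball_def by simp
  qed
  have 2: "(\<forall>v\<in>M. (\<exists>w\<in>M. maps_to M h g w \<and> v \<epsilon> w) \<longleftrightarrow> (\<exists>f\<in>ext M D. umem M U f g \<and> maps_to M h f v)) \<longleftrightarrow>
    ext M (app M h g) = app M h ` {f \<in> ext M D. ult_mem M U f g}" if g: "g \<in> ext M D" for g
  proof -
    have "(\<exists>w\<in>M. maps_to M h g w \<and> v \<epsilon> w) \<longleftrightarrow> v \<epsilon> app M h g" for v
      unfolding maps_to_iff[OF h] using g app_in[OF h g] by blast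
    moreover have "(\<exists>f\<in>ext M D. umem M U f g \<and> maps_to M h f v) \<longleftrightarrow> v \<in> app M h ` {f \<in> ext M D. ult_mem M U f g}" for v
      unfolding maps_to_iff[OF h] using umem_iff[OF f f[OF g]] by blast
    moreover have "app M h ` {f \<in> ext M D. ult_mem M U f g} \<subseteq> M" using app_in[OF h] by blast
    ultimately show ?thesis by (auto simp: ext_def)
  qed
  show ?thesis
    unfolding is_attempt_def collapse_attempt_def using 1 2 D h f by (auto simp: ufn_iff ufuns_iff)
next
  case False
  then show ?thesis unfolding is_attempt_def collapse_attempt_def by (auto simp: ufn_iff ufuns_iff)
qed

lemma is_class_iff: "fn f \<Longrightarrow> is_class M U f z \<longleftrightarrow> z = cls f"
proof -
  assume f: "fn f"
  have "is_class M U f z \<longleftrightarrow> (\<exists>D h. collapse_attempt M U D h \<and> f \<in> ext M D \<and> maps_to M h f z)"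
    unfolding is_class_def using is_attempt_iff attemptD(1,2) is_fun_in by blast
  also have "\<dots> \<longleftrightarrow> z = cls f" unfolding cls_iff[OF f] using maps_to_iff attemptD(2) by blast
  finally show ?thesis .
qed

lemma is_emb_iff: "a \<in> M \<Longrightarrow> is_emb M U a z \<longleftrightarrow> z = emb a"
proof -
  assume a: "a \<in> M"
  have c: "is_fun M c X \<and> (\<forall>x\<in>ext M X. maps_to M c x a) \<longleftrightarrow> c = const a" for c
    using const_unique[of c a] const[OF a] a maps_to_iff by metis
  have "is_emb M U a z \<longleftrightarrow> (\<exists>c\<in>M. (is_fun M c X \<and> (\<forall>x\<in>ext M X. maps_to M c x a)) \<and> is_class M U c z)"
    unfolding is_emb_def using is_underlying_iff X_in by blast
  also have "\<dots> \<longleftrightarrow> z = emb a"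
    unfolding c emb_eq using is_class_iff[OF const(1)[OF a]] is_fun_in[OF const(1)[OF a]] by blast
  finally show ?thesis .
qed

lemma in_K_iff: "z \<in> K \<longleftrightarrow> (\<exists>f\<in>M. ufn M U f \<and> is_class M U f z)"
  unfolding K_iff ufn_iff using is_class_iff is_fun_in by blast

end

context set_structure
begin

section \<open>Relativization to an ultrapower\<close>

text \<open>\<open>Ult N U\<close> is built from descriptions that are meaningful when
  \<open>U\<close> is a countably complete ultrafilter. This condition is therefore made part of the
  relation shown definable, here and in the lemmas that follow.\<close>

lemma dfn_in_Ult:
  assumes C: "C \<subseteq> ZFCs" and "tm A u" and "tm A x"
  shows "dfn C A (\<lambda>N s. cc_ultrafilter N (u s) \<and> x s \<in> Ult N (u s))"
proof (rule dfn_subst2[where R = "\<lambda>N U z. cc_ultrafilter N U \<and> z \<in> Ult N U", OF _ assms(2,3)])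
  have "dfn C A (\<lambda>N s. cc_ultrafilter N (s 0) \<and> (\<exists>f\<in>N. ufn N (s 0) f \<and> is_class N (s 0) f (s 1)))"
    by (intro dfn_intros dfn_cc[OF C])
  then show "dfn C A (\<lambda>N s. cc_ultrafilter N (s 0) \<and> s 1 \<in> Ult N (s 0))"
  proof (rule dfn_cong)
    fix N and s :: "nat \<Rightarrow> 'v" assume "N \<in> C"
    then have "ZFC N" using C by blast
    then show "(cc_ultrafilter N (s 0) \<and> s 1 \<in> Ult N (s 0)) =
      (cc_ultrafilter N (s 0) \<and> (\<exists>f\<in>N. ufn N (s 0) f \<and> is_class N (s 0) f (s 1)))"
      using ultrafilter_model.in_K_iff cc_model by metis
  qed
qed

lemma dfn_is_ult_emb:
  assumes C: "C \<subseteq> ZFCs" and "tm A u" and "tm A x" and "tm A y"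
  shows "dfn C A (\<lambda>N s. cc_ultrafilter N (u s) \<and> y s = ult_emb N (u s) (x s))"
proof (rule dfn_subst3[where R = "\<lambda>N U a z. cc_ultrafilter N U \<and> z = ult_emb N U a", OF _ assms(2,3,4)])
  have "dfn C A (\<lambda>N s. cc_ultrafilter N (s 0) \<and> is_emb N (s 0) (s 1) (s 2))"
    by (intro dfn_intros dfn_cc[OF C])
  then show "dfn C A (\<lambda>N s. cc_ultrafilter N (s 0) \<and> s 2 = ult_emb N (s 0) (s 1))"
  proof (rule dfn_cong)
    fix N and s :: "nat \<Rightarrow> 'v" assume "N \<in> C" and s: "range s \<subseteq> N"
    then have "ZFC N" "s 1 \<in> N" using C by blast+
    then show "(cc_ultrafilter N (s 0) \<and> s 2 = ult_emb N (s 0) (s 1)) =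
      (cc_ultrafilter N (s 0) \<and> is_emb N (s 0) (s 1) (s 2))"
      using ultrafilter_model.is_emb_iff cc_model by metis
  qed
qed

text \<open>Induction on the formula: its quantifiers get bounded by the definable class
  \<open>Ult N U\<close>. The ultrafilter condition is repeated at every subformula to keep the
  induction hypothesis applicable.\<close>

lemma dfn_relativized_sat:
  assumes C: "C \<subseteq> ZFCs" and "tm A u" and "\<And>n. tm A (v n)"
  shows "dfn C A (\<lambda>N s. cc_ultrafilter N (u s) \<and> sat (Ult N (u s)) p (\<lambda>n. v n s))"
  using assms(2,3)
proof (induction p arbitrary: u v)
  case (FMem i j)
  then show ?case by (simp add: dfn_conj dfn_mem dfn_cc[OF C])
next
  case (FEq i j)
  then show ?case by (simp add: dfn_conj dfn_eq dfn_cc[OF C])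
next
  case (FNeg p)
  have "dfn C A (\<lambda>N s. cc_ultrafilter N (u s) \<and> \<not> (cc_ultrafilter N (u s) \<and> sat (Ult N (u s)) p (\<lambda>n. v n s)))"
    by (intro dfn_conj dfn_not FNeg dfn_cc[OF C])
  then show ?case by (rule dfn_cong) auto
next
  case (FConj p q)
  have "dfn C A (\<lambda>N s. (cc_ultrafilter N (u s) \<and> sat (Ult N (u s)) p (\<lambda>n. v n s)) \<and>
      (cc_ultrafilter N (u s) \<and> sat (Ult N (u s)) q (\<lambda>n. v n s)))"
    by (intro dfn_conj FConj)
  then show ?case by (rule dfn_cong) auto
next
  case (FAll i p)
  define v' where "v' n = (if n = i then (\<lambda>s. s 0) else (\<lambda>s. v n (\<lambda>k. s (Suc k))))" for n
  have v': "tm A (v' n)" for n unfolding v'_def using tm_shift[OF FAll(3)] tm_var by auto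
  have v'_eq: "(\<lambda>n. v' n s) = (\<lambda>n. v n (\<lambda>k. s (Suc k)))(i := s 0)" for s
    unfolding v'_def by auto
  have "dfn C A (\<lambda>N s. cc_ultrafilter N (u (\<lambda>k. s (Suc k))) \<and> sat (Ult N (u (\<lambda>k. s (Suc k)))) p (\<lambda>n. v' n s))"
    by (rule FAll(1)[OF tm_shift[OF FAll(2)] v'])
  note * = this[unfolded v'_eq]
  have "dfn C A (\<lambda>N s. cc_ultrafilter N (u s) \<and> (\<forall>a\<in>N. cc_ultrafilter N (u s) \<and> a \<in> Ult N (u s) \<longrightarrow>
      cc_ultrafilter N (u s) \<and> sat (Ult N (u s)) p ((\<lambda>n. v n s)(i := a))))"
    by (rule dfn_conj[OF dfn_cc[OF C FAll(2)]], rule dfn_all, rule dfn_imp[OF _ *],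
        rule dfn_in_Ult[OF C tm_shift[OF FAll(2)] tm_var])
  then show ?case
  proof (rule dfn_cong)
    fix N and s :: "nat \<Rightarrow> 'v" assume "N \<in> C"
    then have Z: "ZFC N" using C by blast
    have "Ult N (u s) \<subseteq> N" if "cc_ultrafilter N (u s)"
      using cc_model[OF Z that] ultrafilter_model.K_subset by metis
    then show "(cc_ultrafilter N (u s) \<and> sat (Ult N (u s)) (FAll i p) (\<lambda>n. v n s)) =
      (cc_ultrafilter N (u s) \<and> (\<forall>a\<in>N. cc_ultrafilter N (u s) \<and> a \<in> Ult N (u s) \<longrightarrow>
      cc_ultrafilter N (u s) \<and> sat (Ult N (u s)) p ((\<lambda>n. v n s)(i := a))))"
      by auto
  qed
qed

text \<open>\<open>Ult N U\<close> is again a model of ZFC, so the formula that defines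
  \<open>R\<close> over \<open>ZFCs\<close> is also correct there, and its relativization is
  definable over \<open>N\<close>. The three membership conditions make the assignment one into
  \<open>Ult N U\<close>.\<close>

lemma dfn_relativize:
  assumes C: "C \<subseteq> ZFCs" and R: "dfn ZFCs {} (\<lambda>N s. R N (s 0) (s 1) (s 2))"
    and u: "tm A u" and xyz: "tm A x" "tm A y" "tm A z"
  shows "dfn C A (\<lambda>N s. cc_ultrafilter N (u s) \<and>
    (x s \<in> Ult N (u s) \<and> y s \<in> Ult N (u s) \<and> z s \<in> Ult N (u s)) \<and> R (Ult N (u s)) (x s) (y s) (z s))"
proof -
  from R obtain p \<tau> where \<tau>: "\<And>n. tm {} (\<tau> n)"
    and p: "\<And>N s. N \<in> ZFCs \<Longrightarrow> {} \<subseteq> N \<Longrightarrow> range s \<subseteq> N \<Longrightarrow> R N (s 0) (s 1) (s 2) = sat N p (\<lambda>n. \<tau> n s)"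
    by (rule dfnE) blast
  define v where "v n = (if n = 0 then x else if n = 1 then y else z)" for n :: nat
  have v: "tm A (v n)" for n unfolding v_def using xyz by simp
  obtain i where i: "\<And>n. \<tau> n = (\<lambda>s. s (i n))" using \<tau> unfolding tm_def by (metis empty_iff)
  have "dfn C A (\<lambda>N s. (cc_ultrafilter N (u s) \<and> x s \<in> Ult N (u s)) \<and> (cc_ultrafilter N (u s) \<and> y s \<in> Ult N (u s)) \<and>
    (cc_ultrafilter N (u s) \<and> z s \<in> Ult N (u s)) \<and>
    (cc_ultrafilter N (u s) \<and> sat (Ult N (u s)) p (\<lambda>n. v (i n) s)))"
    by (intro dfn_conj dfn_in_Ult[OF C] dfn_relativized_sat[OF C] u xyz v)
  then show ?thesis
  proof (rule dfn_cong)
    fix N and s :: "nat \<Rightarrow> 'v" assume "N \<in> C"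
    then have Z: "ZFC N" using C by blast
    have "R (Ult N (u s)) (x s) (y s) (z s) = sat (Ult N (u s)) p (\<lambda>n. v (i n) s)"
      if cc: "cc_ultrafilter N (u s)" and "x s \<in> Ult N (u s)" "y s \<in> Ult N (u s)" "z s \<in> Ult N (u s)"
    proof -
      obtain Y where "ultrafilter_model E N (u s) Y" using cc_model[OF Z cc] .
      then have "Ult N (u s) \<in> ZFCs" using ultrafilter_model.ZFC_K by simp
      moreover have "range (\<lambda>n. v n s) \<subseteq> Ult N (u s)" using that unfolding v_def by auto
      ultimately have "R (Ult N (u s)) (v 0 s) (v 1 s) (v 2 s) = sat (Ult N (u s)) p (\<lambda>n. \<tau> n (\<lambda>n. v n s))"
        by (intro p) auto
      then show ?thesis unfolding i by (simp add: v_def)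
    qed
    then show "(cc_ultrafilter N (u s) \<and> (x s \<in> Ult N (u s) \<and> y s \<in> Ult N (u s) \<and> z s \<in> Ult N (u s)) \<and>
      R (Ult N (u s)) (x s) (y s) (z s)) =
      ((cc_ultrafilter N (u s) \<and> x s \<in> Ult N (u s)) \<and> (cc_ultrafilter N (u s) \<and> y s \<in> Ult N (u s)) \<and>
    (cc_ultrafilter N (u s) \<and> z s \<in> Ult N (u s)) \<and>
    (cc_ultrafilter N (u s) \<and> sat (Ult N (u s)) p (\<lambda>n. v (i n) s)))" by blast
  qed
qed

section \<open>Comparisons and the Ultrapower Axiom as formulas\<close>

text \<open>The repeated conjunct gives the body the exact shape produced by the three-place
  \<open>dfn_relativize\<close>, with \<open>W\<close> in all three places; the next definition
  repeats \<open>z\<close> for the same reason.\<close>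

definition inner_cc :: "'v set \<Rightarrow> 'v \<Rightarrow> 'v \<Rightarrow> bool" where
  "inner_cc N U W \<longleftrightarrow> cc_ultrafilter N U \<and> (W \<in> Ult N U \<and> W \<in> Ult N U \<and> W \<in> Ult N U) \<and> cc_ultrafilter (Ult N U) W"

definition inner_Ult :: "'v set \<Rightarrow> 'v \<Rightarrow> 'v \<Rightarrow> 'v \<Rightarrow> bool" where
  "inner_Ult N U W z \<longleftrightarrow> cc_ultrafilter N U \<and> (W \<in> Ult N U \<and> z \<in> Ult N U \<and> z \<in> Ult N U) \<and>
     cc_ultrafilter (Ult N U) W \<and> z \<in> Ult (Ult N U) W"

definition inner_emb :: "'v set \<Rightarrow> 'v \<Rightarrow> 'v \<Rightarrow> 'v \<Rightarrow> 'v \<Rightarrow> bool" where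
  "inner_emb N U W a z \<longleftrightarrow> cc_ultrafilter N U \<and> (W \<in> Ult N U \<and> a \<in> Ult N U \<and> z \<in> Ult N U) \<and>
     cc_ultrafilter (Ult N U) W \<and> z = ult_emb (Ult N U) W a"

lemma dfn_inner_cc: "C \<subseteq> ZFCs \<Longrightarrow> tm A u \<Longrightarrow> tm A w \<Longrightarrow> dfn C A (\<lambda>N s. inner_cc N (u s) (w s))"
  unfolding inner_cc_def
  by (rule dfn_relativize[where R = "\<lambda>N W _ _. cc_ultrafilter N W"]) (auto intro: dfn_cc tm_var)

lemma dfn_inner_Ult:
  "C \<subseteq> ZFCs \<Longrightarrow> tm A u \<Longrightarrow> tm A w \<Longrightarrow> tm A z \<Longrightarrow> dfn C A (\<lambda>N s. inner_Ult N (u s) (w s) (z s))"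
  unfolding inner_Ult_def
  by (rule dfn_relativize[where R = "\<lambda>N W z _. cc_ultrafilter N W \<and> z \<in> Ult N W"]) (auto intro: dfn_in_Ult tm_var)

lemma dfn_inner_emb:
  "C \<subseteq> ZFCs \<Longrightarrow> tm A u \<Longrightarrow> tm A w \<Longrightarrow> tm A x \<Longrightarrow> tm A z \<Longrightarrow> dfn C A (\<lambda>N s. inner_emb N (u s) (w s) (x s) (z s))"
  unfolding inner_emb_def
  by (rule dfn_relativize[where R = "\<lambda>N W a z. cc_ultrafilter N W \<and> z = ult_emb N W a"])
    (auto intro: dfn_is_ult_emb tm_var)

text \<open>Equality of the two iterated ultrapowers, which are proper classes, is expressed
  elementwise; bounding \<open>z\<close> by \<open>N\<close> loses nothing because both classes are
  contained in \<open>N\<close>. Commutation is stated through explicit intermediate values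
  \<open>b0\<close>, \<open>b1\<close> and \<open>c\<close>.\<close>

definition is_comparison :: "'v set \<Rightarrow> 'v \<Rightarrow> 'v \<Rightarrow> 'v \<Rightarrow> 'v \<Rightarrow> bool" where
  "is_comparison N U0 U1 W0 W1 \<longleftrightarrow> inner_cc N U0 W0 \<and> inner_cc N U1 W1 \<and>
     (\<forall>z\<in>N. inner_Ult N U0 W0 z \<longleftrightarrow> inner_Ult N U1 W1 z) \<and>
     (\<forall>a\<in>N. \<exists>b0\<in>N. \<exists>b1\<in>N. \<exists>c\<in>N. is_emb N U0 a b0 \<and> is_emb N U1 a b1 \<and>
        inner_emb N U0 W0 b0 c \<and> inner_emb N U1 W1 b1 c)"

lemma inner_Ult_iff:
  assumes "ZFC N" "inner_cc N U W"
  shows "inner_Ult N U W z \<longleftrightarrow> z \<in> Ult (Ult N U) W" and "Ult (Ult N U) W \<subseteq> N"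
proof -
  have cc: "cc_ultrafilter N U" "cc_ultrafilter (Ult N U) W" "W \<in> Ult N U" using assms(2) unfolding inner_cc_def by auto
  have "ZFC (Ult N U)" "Ult N U \<subseteq> N"
    using cc_model[OF assms(1) cc(1)] ultrafilter_model.ZFC_K ultrafilter_model.K_subset by metis+
  moreover from this have "Ult (Ult N U) W \<subseteq> Ult N U"
    using cc_model[OF _ cc(2)] ultrafilter_model.K_subset by metis
  ultimately show "inner_Ult N U W z \<longleftrightarrow> z \<in> Ult (Ult N U) W" "Ult (Ult N U) W \<subseteq> N"
    using cc unfolding inner_Ult_def by auto
qed

lemma inner_emb_iff:
  assumes Z: "ZFC N" and cc: "inner_cc N U W" and a: "a \<in> N"
  shows "b \<in> N \<and> is_emb N U a b \<and> inner_emb N U W b c \<longleftrightarrow>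
    b = ult_emb N U a \<and> c = ult_emb (Ult N U) W b" and "ult_emb N U a \<in> N" and "ult_emb (Ult N U) W (ult_emb N U a) \<in> N"
proof -
  have c: "cc_ultrafilter N U" "cc_ultrafilter (Ult N U) W" "W \<in> Ult N U" using cc unfolding inner_cc_def by auto
  obtain X where X: "ultrafilter_model E N U X" using cc_model[OF Z c(1)] .
  interpret m: ultrafilter_model E N U X by (rule X)
  obtain Y where Y: "ultrafilter_model E (Ult N U) W Y" using cc_model[OF m.ZFC_K c(2)] .
  interpret k: ultrafilter_model E "Ult N U" W Y by (rule Y)
  have 1: "ult_emb N U a \<in> Ult N U" by (rule m.emb_in[OF a])
  have 2: "ult_emb (Ult N U) W (ult_emb N U a) \<in> Ult N U" using k.emb_in[OF 1] k.K_subset by blast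
  show "ult_emb N U a \<in> N" "ult_emb (Ult N U) W (ult_emb N U a) \<in> N" using 1 2 m.K_subset by auto
  show "b \<in> N \<and> is_emb N U a b \<and> inner_emb N U W b c \<longleftrightarrow>
    b = ult_emb N U a \<and> c = ult_emb (Ult N U) W b"
    unfolding m.is_emb_iff[OF a] inner_emb_def using c 1 2 m.K_subset by auto
qed

lemma is_comparison_iff:
  assumes Z: "ZFC N" and cc: "cc_ultrafilter N U0" "cc_ultrafilter N U1"
  shows "is_comparison N U0 U1 W0 W1 \<longleftrightarrow> comparison N U0 U1 W0 W1"
proof (cases "inner_cc N U0 W0 \<and> inner_cc N U1 W1")
  case True
  then have i: "inner_cc N U0 W0" "inner_cc N U1 W1" by auto
  have "(\<forall>z\<in>N. inner_Ult N U0 W0 z \<longleftrightarrow> inner_Ult N U1 W1 z) \<longleftrightarrow> Ult (Ult N U0) W0 = Ult (Ult N U1) W1"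
    using inner_Ult_iff[OF Z i(1)] inner_Ult_iff[OF Z i(2)] by blast
  moreover have "(\<exists>b0\<in>N. \<exists>b1\<in>N. \<exists>c\<in>N. is_emb N U0 a b0 \<and> is_emb N U1 a b1 \<and>
        inner_emb N U0 W0 b0 c \<and> inner_emb N U1 W1 b1 c) \<longleftrightarrow>
      ult_emb (Ult N U0) W0 (ult_emb N U0 a) = ult_emb (Ult N U1) W1 (ult_emb N U1 a)" if "a \<in> N" for a
    using inner_emb_iff[OF Z i(1) that] inner_emb_iff[OF Z i(2) that] by metis
  ultimately show ?thesis
    using True unfolding is_comparison_def comparison_def inner_cc_def by auto
next
  case False
  then show ?thesis using cc unfolding is_comparison_def comparison_def inner_cc_def by blast
qed

text \<open>The witnesses of a comparison lie in ultrapowers contained in \<open>N\<close>, so their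
  existential quantifiers can be bounded by \<open>N\<close>; what remains is the formula
  \<open>is_comparison\<close>. Being without parameters, the axiom then passes to
  ultrapowers.\<close>

lemma dfn_ultrapower_axiom: "dfn ZFCs {} (\<lambda>N s. ultrapower_axiom N)"
proof -
  have "dfn ZFCs {} (\<lambda>N s. \<forall>U0\<in>N. \<forall>U1\<in>N. cc_ultrafilter N U0 \<and> cc_ultrafilter N U1 \<longrightarrow>
      (\<exists>W0\<in>N. \<exists>W1\<in>N. is_comparison N U0 U1 W0 W1))"
    unfolding is_comparison_def
    by (intro dfn_intros dfn_inner_cc dfn_inner_Ult dfn_inner_emb dfn_cc) simp_all
  then show ?thesis
  proof (rule dfn_cong)
    fix N :: "'v set" assume "N \<in> ZFCs"
    then have Z: "ZFC N" by simp
    have "W0 \<in> N \<and> W1 \<in> N"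
      if "cc_ultrafilter N U0" "cc_ultrafilter N U1" "comparison N U0 U1 W0 W1" for U0 U1 W0 W1
      using that cc_model[OF Z] ultrafilter_model.K_subset unfolding comparison_def by (metis subsetD)
    then show "ultrapower_axiom N = (\<forall>U0\<in>N. \<forall>U1\<in>N. cc_ultrafilter N U0 \<and> cc_ultrafilter N U1 \<longrightarrow>
      (\<exists>W0\<in>N. \<exists>W1\<in>N. is_comparison N U0 U1 W0 W1))"
      unfolding ultrapower_axiom_def using is_comparison_iff[OF Z] by blast
  qed
qed

end

lemma (in ultrafilter_model) ultrapower_axiom_K:
  assumes "ultrapower_axiom M" shows "ultrapower_axiom K"
  using emb_dfn[OF dfn_ultrapower_axiom, of "\<lambda>_. X"] ZFC_M ZFC_K X_in assms by auto

section \<open>Iterated ultrapowers and the seed order\<close>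

context set_structure
begin

section \<open>Absoluteness for transitive classes\<close>

definition transitive_in :: "'v set \<Rightarrow> 'v set \<Rightarrow> bool" where
  "transitive_in N M \<longleftrightarrow> N \<subseteq> M \<and> (\<forall>y\<in>N. ext M y \<subseteq> N)"

lemma transitive_in_ext: "transitive_in N M \<Longrightarrow> y \<in> N \<Longrightarrow> ext N y = ext M y"
  unfolding transitive_in_def ext_def by blast

lemma transitive_in_trans: "transitive_in N M \<Longrightarrow> transitive_in M V \<Longrightarrow> transitive_in N V"
  unfolding transitive_in_def ext_def by blast

lemma is_opair_abs: "transitive_in N M \<Longrightarrow> p \<in> N \<Longrightarrow> is_opair N p x y \<longleftrightarrow> is_opair M p x y"
proof -
  assume N: "transitive_in N M" and p: "p \<in> N"
  have sub: "N \<subseteq> M" "ext M p \<subseteq> N" using N p unfolding transitive_in_def by auto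
  note eq = transitive_in_ext[OF N]
  show ?thesis
  proof
    assume "is_opair N p x y"
    then obtain u v where "u \<in> N" "v \<in> N" "ext N u = {x}" "ext N v = {x, y}" "ext N p = {u, v}"
      unfolding is_opair_def by blast
    moreover from this have "ext M u = {x}" "ext M v = {x, y}" "ext M p = {u, v}" "u \<in> M" "v \<in> M"
      using eq p sub(1) by auto
    ultimately show "is_opair M p x y" unfolding is_opair_def by blast
  next
    assume "is_opair M p x y"
    then obtain u v where uv: "ext M u = {x}" "ext M v = {x, y}" "ext M p = {u, v}"
      unfolding is_opair_def by blast
    then have "u \<in> N" "v \<in> N" using sub(2) by auto
    moreover from this have "ext N u = {x}" "ext N v = {x, y}" "ext N p = {u, v}" using eq p uv by auto
    ultimately show "is_opair N p x y" unfolding is_opair_def by blast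
  qed
qed

lemma maps_to_abs: "transitive_in N M \<Longrightarrow> f \<in> N \<Longrightarrow> maps_to N f x y \<longleftrightarrow> maps_to M f x y"
  unfolding maps_to_def using is_opair_abs[of N M] transitive_in_ext[of N M f]
  by (metis (no_types, lifting) subsetD transitive_in_def)

lemma trans_set_abs: "transitive_in N M \<Longrightarrow> x \<in> N \<Longrightarrow> trans_set N x \<longleftrightarrow> trans_set M x"
proof -
  assume N: "transitive_in N M" and x: "x \<in> N"
  have "ext M x \<subseteq> N" using N x unfolding transitive_in_def by blast
  then show ?thesis unfolding trans_set_def transitive_in_ext[OF N x] using transitive_in_ext[OF N] by blast
qed

lemma ordinal_abs: "transitive_in N M \<Longrightarrow> x \<in> N \<Longrightarrow> ordinal N x \<longleftrightarrow> ordinal M x"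
proof -
  assume N: "transitive_in N M" and x: "x \<in> N"
  have "ext M x \<subseteq> N" "x \<in> M" using N x unfolding transitive_in_def by blast+
  then show ?thesis
    unfolding ordinal_def transitive_in_ext[OF N x] using trans_set_abs[OF N] x by blast
qed

lemma finset_le_abs: "transitive_in N M \<Longrightarrow> a \<in> N \<Longrightarrow> b \<in> N \<Longrightarrow> finset_le N a b \<longleftrightarrow> finset_le M a b"
  unfolding finset_le_def finset_less_def by (simp add: transitive_in_ext)

text \<open>Elements of the two sets must be comparable for \<open>finset_le\<close> to be
  transitive. Being a set of ordinals ensures this, is absolute for transitive classes and is
  preserved by the embeddings.\<close>

definition ordinal_set :: "'v set \<Rightarrow> 'v \<Rightarrow> bool" where
  "ordinal_set N a \<longleftrightarrow> (\<forall>x\<in>ext N a. ordinal N x)"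

lemma dfn_ordinal_set: "tm A x \<Longrightarrow> dfn C A (\<lambda>N s. ordinal_set N (x s))"
  by (rule dfn_subst1[where R = ordinal_set]) (unfold ordinal_set_def, intro dfn_intros)

lemma ordinal_set_abs: "transitive_in N M \<Longrightarrow> a \<in> N \<Longrightarrow> ordinal_set N a \<longleftrightarrow> ordinal_set M a"
proof -
  assume N: "transitive_in N M" and a: "a \<in> N"
  have "ext M a \<subseteq> N" using N a unfolding transitive_in_def by blast
  then show ?thesis unfolding ordinal_set_def transitive_in_ext[OF N a] using ordinal_abs[OF N] by blast
qed

lemma dfn_finset_le: "tm A x \<Longrightarrow> tm A y \<Longrightarrow> dfn C A (\<lambda>N s. finset_le N (x s) (y s))"
proof (rule dfn_subst2[where R = finset_le])
  have "dfn C A (\<lambda>N s. (\<exists>\<xi>\<in>N. (\<xi> \<epsilon> s 0 \<or> \<xi> \<epsilon> s 1) \<and> \<not> (\<xi> \<epsilon> s 0 \<and> \<xi> \<epsilon> s 1) \<and>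
    (\<forall>\<eta>\<in>N. (\<eta> \<epsilon> s 0 \<or> \<eta> \<epsilon> s 1) \<and> \<not> (\<eta> \<epsilon> s 0 \<and> \<eta> \<epsilon> s 1) \<longrightarrow> \<eta> = \<xi> \<or> \<eta> \<epsilon> \<xi>) \<and> \<xi> \<epsilon> s 1) \<or> s 0 = s 1)"
    by (intro dfn_intros)
  then show "dfn C A (\<lambda>N s. finset_le N (s 0) (s 1))"
    by (rule dfn_cong) (auto simp: finset_le_def finset_less_def ext_def)
qed

end

context zfc_model
begin

section \<open>The order on finite sets of ordinals\<close>

lemma ordinal_elem: "ordinal M a \<Longrightarrow> x \<in> ext M a \<Longrightarrow> ordinal M x"
  unfolding ordinal_def trans_set_def using ext_in by blast

text \<open>Double epsilon-induction: if neither of \<open>a\<close> and \<open>b\<close> is an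
  element of the other, the hypotheses for their elements put each element of one into the other,
  and extensionality makes them equal.\<close>

lemma ordinal_linear:
  assumes "ordinal M a" "ordinal M b" shows "a \<epsilon> b \<or> a = b \<or> b \<epsilon> a"
proof -
  define P where "P N a b \<longleftrightarrow> (ordinal N a \<longrightarrow> ordinal N b \<longrightarrow> a \<epsilon> b \<or> a = b \<or> b \<epsilon> a)" for N a b
  have "DM (\<lambda>N s. P N (s 0) (s 1))" unfolding P_def by (intro dfn_intros)
  note Pt = dfn_subst2[OF this]
  have M: "a \<in> M" "b \<in> M" using assms unfolding ordinal_def by auto
  have "\<forall>b\<in>M. P M a b"
  proof (rule eps_induct[where P = "\<lambda>N a. \<forall>b\<in>N. P N a b", OF _ _ M(1)])
    show "DM (\<lambda>N s. \<forall>b\<in>N. P N (s 0) b)" by (intro dfn_intros Pt)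
    fix a assume a: "a \<in> M" and IH1: "\<And>x. x \<in> ext M a \<Longrightarrow> \<forall>b\<in>M. P M x b"
    show "\<forall>b\<in>M. P M a b"
    proof
      fix b assume b: "b \<in> M"
      show "P M a b"
      proof (rule eps_induct[where P = "\<lambda>N b. P N a b", OF _ _ b])
        show "DM (\<lambda>N s. P N a (s 0))" by (intro dfn_intros Pt a)
        fix b assume b: "b \<in> M" and IH2: "\<And>y. y \<in> ext M b \<Longrightarrow> P M a y"
        show "P M a b" unfolding P_def
        proof (intro impI, rule ccontr)
          assume o: "ordinal M a" "ordinal M b" and n: "\<not> (a \<epsilon> b \<or> a = b \<or> b \<epsilon> a)"
          have "x \<in> ext M b" if x: "x \<in> ext M a" for x
          proof -
            have "x \<epsilon> b \<or> x = b \<or> b \<epsilon> x"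
              using IH1[OF x] b ordinal_elem[OF o(1) x] o(2) unfolding P_def by blast
            moreover have "ext M x \<subseteq> ext M a" using o(1) x unfolding ordinal_def trans_set_def by blast
            ultimately show ?thesis using x n b unfolding in_ext_iff by (auto simp: ext_def)
          qed
          moreover have "y \<in> ext M a" if y: "y \<in> ext M b" for y
          proof -
            have "a \<epsilon> y \<or> a = y \<or> y \<epsilon> a"
              using IH2[OF y] ordinal_elem[OF o(2) y] o(1) unfolding P_def by blast
            moreover have "ext M y \<subseteq> ext M b" using o(2) y unfolding ordinal_def trans_set_def by blast
            ultimately show ?thesis using y n a unfolding in_ext_iff by (auto simp: ext_def)
          qed
          ultimately show False using n ext_inject[OF a b] by blast
        qed
      qed
    qed
  qed
  then show ?thesis using assms M(2) unfolding P_def by blast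
qed

text \<open>Let \<open>\<xi>\<close> and \<open>\<eta>\<close> be the largest points of difference
  of \<open>a, b\<close> and of \<open>b, c\<close>. They are distinct, as \<open>\<xi>\<close> lies
  in \<open>b\<close> and \<open>\<eta>\<close> does not. The larger of the two is the largest point
  of difference of \<open>a, c\<close> and lies in \<open>c\<close>: every such point is one for
  \<open>a, b\<close> or for \<open>b, c\<close>.\<close>

lemma finset_less_trans:
  assumes o: "ordinal_set M a" "ordinal_set M b" "ordinal_set M c"
    and ab: "finset_less M a b" and bc: "finset_less M b c"
  shows "finset_less M a c"
proof -
  let ?A = "ext M a" and ?B = "ext M b" and ?C = "ext M c"
  obtain \<xi> where \<xi>: "\<xi> \<in> ?B" "\<xi> \<notin> ?A"
    "\<And>\<eta>. \<eta> \<in> (?A \<union> ?B) - (?A \<inter> ?B) \<Longrightarrow> \<eta> = \<xi> \<or> \<eta> \<in> ext M \<xi>"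
    using ab ext_in unfolding finset_less_def ext_def by blast
  obtain \<eta> where \<eta>: "\<eta> \<in> ?C" "\<eta> \<notin> ?B"
    "\<And>\<zeta>. \<zeta> \<in> (?B \<union> ?C) - (?B \<inter> ?C) \<Longrightarrow> \<zeta> = \<eta> \<or> \<zeta> \<in> ext M \<eta>"
    using bc ext_in unfolding finset_less_def ext_def by blast
  have ord: "ordinal M \<xi>" "ordinal M \<eta>" using o \<xi>(1) \<eta>(1) unfolding ordinal_set_def by auto
  then have tr: "\<And>y. y \<in> ext M \<xi> \<Longrightarrow> ext M y \<subseteq> ext M \<xi>" "\<And>y. y \<in> ext M \<eta> \<Longrightarrow> ext M y \<subseteq> ext M \<eta>"
    unfolding ordinal_def trans_set_def by auto
  have M: "\<xi> \<in> M" "\<eta> \<in> M" using \<xi>(1) \<eta>(1) ext_in by auto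
  have intro: "finset_less M a c" if "\<zeta> \<in> ?C" "\<zeta> \<notin> ?A"
    "\<And>\<eta>. \<eta> \<in> (?A \<union> ?C) - (?A \<inter> ?C) \<Longrightarrow> \<eta> = \<zeta> \<or> \<eta> \<in> ext M \<zeta>" for \<zeta>
    using that in_ext_iff unfolding finset_less_def by blast
  have split: "\<zeta> \<in> (?A \<union> ?B) - (?A \<inter> ?B) \<or> \<zeta> \<in> (?B \<union> ?C) - (?B \<inter> ?C)"
    if "\<zeta> \<in> (?A \<union> ?C) - (?A \<inter> ?C)" for \<zeta> using that by blast
  from ordinal_linear[OF ord] M consider "\<xi> = \<eta>" | "\<xi> \<in> ext M \<eta>" | "\<eta> \<in> ext M \<xi>"
    unfolding in_ext_iff by blast
  then show ?thesis
  proof cases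
    case 1
    then show ?thesis using \<xi> \<eta> by blast
  next
    case 2
    have "\<eta> \<notin> ?A" using \<xi>(3)[of \<eta>] \<eta>(2) 2 mem_asym mem_irrefl M by blast
    then show ?thesis
      by (rule intro[OF \<eta>(1)]) (use split \<xi>(3) \<eta>(3) 2 tr in blast)
  next
    case 3
    have "\<xi> \<in> ?C" using \<eta>(3)[of \<xi>] \<xi>(1) 3 mem_asym mem_irrefl M by blast
    then show ?thesis
      by (rule intro[OF _ \<xi>(2)]) (use split \<xi>(3) \<eta>(3) 3 tr in blast)
  qed
qed

lemma finset_le_trans:
  "ordinal_set M a \<Longrightarrow> ordinal_set M b \<Longrightarrow> ordinal_set M c \<Longrightarrow> finset_le M a b \<Longrightarrow> finset_le M b c \<Longrightarrow>
    finset_le M a c"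
  unfolding finset_le_def using finset_less_trans by blast

text \<open>The ultrafilter is the one derived from \<open>j\<close> and \<open>t\<close>, namely \<open>{A \<subseteq> B. t \<in> j(A)}\<close>.\<close>

theorem derived_ultrapower:
  fixes j :: "'v \<Rightarrow> 'v"
  assumes K: "ZFC K" and tr: "transitive_in K M"
    and jK: "\<And>a. a \<in> M \<Longrightarrow> j a \<in> K"
    and el: "\<And>R s. dfn ZFCs {} R \<Longrightarrow> range s \<subseteq> M \<Longrightarrow> R K (\<lambda>n. j (s n)) \<longleftrightarrow> R M s"
    and gr: "DM (\<lambda>N s. s 1 = j (s 0))"
    and om: "\<And>m. m \<in> K \<Longrightarrow> m \<epsilon> j (omega M) \<Longrightarrow> \<exists>n\<in>ext M (omega M). m = j n"
    and B: "B \<in> M" and t: "t \<in> K" "t \<epsilon> j B"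
    and gen: "\<And>z. z \<in> K \<Longrightarrow> \<exists>f. is_fun M f B \<and> maps_to K (j f) t z"
  shows "\<exists>Z\<in>M. cc_ultrafilter M Z \<and> Ult M Z = K \<and> (\<forall>a\<in>M. ult_emb M Z a = j a)"
proof -
  interpret k: zfc_model E K using K by unfold_locales
  have KM: "K \<subseteq> M" using tr unfolding transitive_in_def by blast
  have tM: "t \<in> M" using t KM by blast
  have el4: "R K (j a) (j b) (j c) (j d) \<longleftrightarrow> R M a b c d"
    if R: "dfn ZFCs {} (\<lambda>N s. R N (s 0) (s 1) (s 2) (s 3))" and "a \<in> M" "b \<in> M" "c \<in> M" "d \<in> M"
    for R :: "'v set \<Rightarrow> 'v \<Rightarrow> 'v \<Rightarrow> 'v \<Rightarrow> 'v \<Rightarrow> bool" and a b c d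
    using el[OF R, of "\<lambda>n. if n = 0 then a else if n = 1 then b else if n = 2 then c else d"] that by auto
  note jt = dfn_subst2[OF gr]
  \<comment> \<open>Definability of \<open>j\<close>, assumed in \<open>gr\<close>, is what makes
    the derived ultrafilter a set of the model.\<close>
  have "is_set {A \<in> {A \<in> M. ext M A \<subseteq> ext M B}. \<exists>w\<in>M. w = j A \<and> t \<epsilon> w}"
    by (rule is_set_sep[OF is_set_Pow[OF is_set_ext[OF B]], where P = "\<lambda>N A. \<exists>w\<in>N. w = j A \<and> t \<epsilon> w"])
      (intro dfn_intros jt tM)
  then obtain Z where Z: "Z \<in> M" and "ext M Z = {A \<in> {A \<in> M. ext M A \<subseteq> ext M B}. \<exists>w\<in>M. w = j A \<and> t \<epsilon> w}"
    by (rule is_setE)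
  then have Z_iff: "A \<in> ext M Z \<longleftrightarrow> A \<in> M \<and> ext M A \<subseteq> ext M B \<and> t \<epsilon> j A" for A using jK KM by auto
  have tK: "t \<in> ext K (j A) \<longleftrightarrow> t \<epsilon> j A" for A using t(1) unfolding ext_def by blast
  have tB: "t \<in> ext K (j B)" using t tK by blast
  have "cc_ultrafilter_on M Z B"
    unfolding cc_ultrafilter_on_def
  proof (intro conjI ballI allI impI)
    show "Z \<in> M" "B \<in> M" by fact+
    show "B \<in> ext M Z" using Z_iff B t by blast
    show "ext M A \<subseteq> ext M B" if "A \<in> ext M Z" for A using that Z_iff by blast
    show "ext M A \<noteq> {}" if A: "A \<in> ext M Z" for A
    proof
      assume "ext M A = {}"
      then have "ext K (j A) = {}"
        using el4[where R = "\<lambda>N a b c d. ext N a = {}" and a = A and b = A and c = A and d = A] A Z_iff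
        by (simp add: dfn_intros)
      then show False using A Z_iff tK by blast
    qed
    show "A' \<in> ext M Z" if A: "A \<in> ext M Z" "A' \<in> M" "ext M A \<subseteq> ext M A' \<and> ext M A' \<subseteq> ext M B" for A A'
    proof -
      have "ext K (j A) \<subseteq> ext K (j A')"
        using el4[where R = "\<lambda>N a b c d. ext N a \<subseteq> ext N b" and a = A and b = A' and c = A and d = A] A Z_iff
        by (simp add: dfn_intros)
      then show ?thesis using A Z_iff tK by blast
    qed
    show "A \<in> ext M Z \<or> (\<exists>D\<in>ext M Z. ext M D = ext M B - ext M A)"
      if A: "A \<in> M" "ext M A \<subseteq> ext M B" for A
    proof -
      obtain D where D: "D \<in> M" "ext M D = ext M B - ext M A"
        using is_set_Diff[OF is_set_ext[OF B] is_set_ext[OF A(1)]] by (rule is_setE)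
      have "\<forall>x\<in>ext M B. x \<epsilon> A \<or> x \<epsilon> D" using D unfolding ext_def by blast
      moreover have "dfn ZFCs {} (\<lambda>N s. \<forall>x\<in>ext N (s 0). x \<epsilon> s 1 \<or> x \<epsilon> s 2)" by (intro dfn_intros)
      ultimately have "\<forall>x\<in>ext K (j B). x \<epsilon> j A \<or> x \<epsilon> j D"
        using el4[where R = "\<lambda>N b a d c. \<forall>x\<in>ext N b. x \<epsilon> a \<or> x \<epsilon> d" and a = B and b = A and c = D and d = D] A(1) B D(1)
        by blast
      then have "t \<epsilon> j A \<or> t \<epsilon> j D" using tB by blast
      then show ?thesis using Z_iff A D by blast
    qed
    show "\<exists>D\<in>ext M Z. ext M D = (\<Inter>n\<in>ext M (omega M). ext M (app M F n))"
      if F: "is_fun M F (omega M) \<and> (\<forall>n\<in>ext M (omega M). app M F n \<in> ext M Z)" for F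
    proof -
      have Ff: "is_fun M F (omega M)" and FM: "F \<in> M" using F is_fun_in by auto
      have "is_set {x \<in> ext M B. \<forall>n\<in>ext M (omega M). \<exists>A\<in>M. maps_to M F n A \<and> x \<epsilon> A}"
        by (rule is_set_sep[OF is_set_ext[OF B], where P = "\<lambda>N x. \<forall>n\<in>ext N (omega M). \<exists>A\<in>N. maps_to N F n A \<and> x \<epsilon> A"])
          (intro dfn_intros FM omega_in)
      then obtain D where D: "D \<in> M" "ext M D = {x \<in> ext M B. \<forall>n\<in>ext M (omega M). \<exists>A\<in>M. maps_to M F n A \<and> x \<epsilon> A}"
        by (rule is_setE)
      have D_eq: "ext M D = (\<Inter>n\<in>ext M (omega M). ext M (app M F n))"
      proof
        show "ext M D \<subseteq> (\<Inter>n\<in>ext M (omega M). ext M (app M F n))"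
          unfolding D(2) maps_to_iff[OF Ff] using ext_in unfolding ext_def by blast
        show "(\<Inter>n\<in>ext M (omega M). ext M (app M F n)) \<subseteq> ext M D"
        proof
          fix x assume x: "x \<in> (\<Inter>n\<in>ext M (omega M). ext M (app M F n))"
          obtain z where "z \<in> ext M (omega M)" using zero_ex by blast
          then have "x \<in> ext M B" using x F Z_iff by blast
          moreover have "\<exists>A\<in>M. maps_to M F n A \<and> x \<epsilon> A" if n: "n \<in> ext M (omega M)" for n
            using x n app_maps[OF Ff n] app_in[OF Ff n] unfolding ext_def by blast
          ultimately show "x \<in> ext M D" unfolding D(2) by blast
        qed
      qed
      have "dfn ZFCs {} (\<lambda>N s. \<forall>x\<in>ext N (s 0). x \<epsilon> s 1 \<or> (\<exists>n\<in>ext N (s 2). \<exists>A\<in>N. maps_to N (s 3) n A \<and> \<not> x \<epsilon> A))"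
        by (intro dfn_intros)
      moreover have "\<forall>x\<in>ext M B. x \<epsilon> D \<or> (\<exists>n\<in>ext M (omega M). \<exists>A\<in>M. maps_to M F n A \<and> \<not> x \<epsilon> A)"
        using D(2) app_maps[OF Ff] app_in[OF Ff] in_ext_iff[of _ D] by blast
      ultimately have "\<forall>x\<in>ext K (j B). x \<epsilon> j D \<or> (\<exists>n\<in>ext K (j (omega M)). \<exists>A\<in>K. maps_to K (j F) n A \<and> \<not> x \<epsilon> A)"
        using el4[where R = "\<lambda>N b d w f. \<forall>x\<in>ext N b. x \<epsilon> d \<or> (\<exists>n\<in>ext N w. \<exists>A\<in>N. maps_to N f n A \<and> \<not> x \<epsilon> A)"
            and a = B and b = D and c = "omega M" and d = F] B D(1) omega_in FM by blast
      \<comment> \<open>By elementarity \<open>t\<close> lies in \<open>j D\<close> unless it is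
        missed by some term of the sequence \<open>j F\<close>. By \<open>om\<close> every index
        below \<open>j (omega M)\<close> is some \<open>j n\<close>, so that term is the image of
        \<open>app M F n\<close>, which is in the ultrafilter. This is where countable completeness
        comes from.\<close>
      moreover have "\<not> (\<exists>n\<in>ext K (j (omega M)). \<exists>A\<in>K. maps_to K (j F) n A \<and> \<not> t \<epsilon> A)"
      proof
        assume "\<exists>n\<in>ext K (j (omega M)). \<exists>A\<in>K. maps_to K (j F) n A \<and> \<not> t \<epsilon> A"
        then obtain n' A where n': "n' \<in> K" "n' \<epsilon> j (omega M)" "maps_to K (j F) n' A" "\<not> t \<epsilon> A"
          unfolding ext_def by blast
        then obtain n where n: "n \<in> ext M (omega M)" "n' = j n" using om by blast
        have "maps_to K (j F) (j n) (j (app M F n))"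
          using el4[where R = "\<lambda>N f x y _. maps_to N f x y" and a = F and b = n and c = "app M F n" and d = F]
            app_maps[OF Ff n(1)] app_in[OF Ff n(1)] FM ext_in[OF n(1)] by (simp add: dfn_intros)
        moreover have "is_fun K (j F) (j (omega M))"
          using el4[where R = "\<lambda>N f x y _. is_fun N f x" and a = F and b = "omega M" and c = F and d = F]
            Ff FM omega_in by (simp add: dfn_intros)
        ultimately have "A = j (app M F n)" using n'(3) n(2) k.maps_to_iff by metis
        then show False using F n(1) n'(4) Z_iff by blast
      qed
      ultimately have "t \<epsilon> j D" using tB by blast
      then have "D \<in> ext M Z" using D Z_iff by blast
      then show ?thesis using D_eq by blast
    qed
  qed
  then interpret z: ultrafilter_model E M Z B by unfold_locales
  \<comment> \<open>The factor map from the ultrapower by \<open>Z\<close> to \<open>K\<close>,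
    which sends the class of \<open>f\<close> to \<open>j(f)(t)\<close>. It preserves and reflects
    membership and equality modulo \<open>Z\<close> by elementarity, and is onto by
    \<open>gen\<close>.\<close>
  define v where "v f = app K (j f) t" for f
  have v: "maps_to K (j f) t y \<longleftrightarrow> y = v f" if f: "z.fn f" for f y
  proof -
    have "is_fun K (j f) (j B)"
      using el4[where R = "\<lambda>N f x y _. is_fun N f x" and a = f and b = B and c = B and d = B] f B is_fun_in[OF f]
      by (simp add: dfn_intros)
    then show ?thesis unfolding v_def using k.maps_to_iff tB by blast
  qed
  have vK: "v f \<in> K" if "z.fn f" for f using v[OF that] k.maps_to_in by blast
  have large: "z.large S \<longleftrightarrow> t \<epsilon> j A" if "A \<in> M" "ext M A = S" "S \<subseteq> ext M B" for A S
  proof -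
    have "z.large S \<longleftrightarrow> A \<in> ext M Z" using that ext_inject ext_in unfolding z.large_def by metis
    then show ?thesis using that Z_iff by blast
  qed
  have v_mem: "v f \<epsilon> v g \<longleftrightarrow> ult_mem M Z f g" if f: "z.fn f" and g: "z.fn g" for f g
  proof -
    obtain A where A: "A \<in> M" "ext M A = {x \<in> ext M B. app M f x \<epsilon> app M g x}"
      using z.is_set_mem[OF f g] by (rule is_setE)
    let ?R = "\<lambda>N b a f g. \<forall>x\<in>ext N b. x \<epsilon> a \<longleftrightarrow> (\<exists>u\<in>N. \<exists>w\<in>N. maps_to N f x u \<and> maps_to N g x w \<and> u \<epsilon> w)"
    have "?R M B A f g"
    proof
      fix x assume x: "x \<in> ext M B"
      have "x \<epsilon> A \<longleftrightarrow> x \<in> ext M A" using ext_in[OF x] unfolding ext_def by blast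
      then show "x \<epsilon> A \<longleftrightarrow> (\<exists>u\<in>M. \<exists>w\<in>M. maps_to M f x u \<and> maps_to M g x w \<and> u \<epsilon> w)"
        unfolding A(2) maps_to_iff[OF f] maps_to_iff[OF g] using x app_in[OF f x] app_in[OF g x] by blast
    qed
    moreover have "dfn ZFCs {} (\<lambda>N s. ?R N (s 0) (s 1) (s 2) (s 3))" by (intro dfn_intros)
    ultimately have "?R K (j B) (j A) (j f) (j g)"
      using el4[where R = ?R and a = B and b = A and c = f and d = g] B A(1) is_fun_in[OF f] is_fun_in[OF g] by blast
    then have "t \<epsilon> j A \<longleftrightarrow> (\<exists>u\<in>K. \<exists>w\<in>K. maps_to K (j f) t u \<and> maps_to K (j g) t w \<and> u \<epsilon> w)" using tB by blast
    then have "t \<epsilon> j A \<longleftrightarrow> v f \<epsilon> v g" unfolding v[OF f] v[OF g] using vK[OF f] vK[OF g] by blast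
    then show ?thesis unfolding z.ult_mem_iff using large[OF A] by blast
  qed
  have v_eq: "v f = v g \<longleftrightarrow> ult_eq M Z f g" if f: "z.fn f" and g: "z.fn g" for f g
  proof -
    obtain A where A: "A \<in> M" "ext M A = {x \<in> ext M B. app M f x = app M g x}"
      using z.is_set_eq[OF f g] by (rule is_setE)
    let ?R = "\<lambda>N b a f g. \<forall>x\<in>ext N b. x \<epsilon> a \<longleftrightarrow> (\<exists>u\<in>N. maps_to N f x u \<and> maps_to N g x u)"
    have "?R M B A f g"
    proof
      fix x assume x: "x \<in> ext M B"
      have "x \<epsilon> A \<longleftrightarrow> x \<in> ext M A" using ext_in[OF x] unfolding ext_def by blast
      then show "x \<epsilon> A \<longleftrightarrow> (\<exists>u\<in>M. maps_to M f x u \<and> maps_to M g x u)"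
        unfolding A(2) maps_to_iff[OF f] maps_to_iff[OF g] using x app_in[OF f x] app_in[OF g x] by auto
    qed
    moreover have "dfn ZFCs {} (\<lambda>N s. ?R N (s 0) (s 1) (s 2) (s 3))" by (intro dfn_intros)
    ultimately have "?R K (j B) (j A) (j f) (j g)"
      using el4[where R = ?R and a = B and b = A and c = f and d = g] B A(1) is_fun_in[OF f] is_fun_in[OF g] by blast
    then have "t \<epsilon> j A \<longleftrightarrow> (\<exists>u\<in>K. maps_to K (j f) t u \<and> maps_to K (j g) t u)" using tB by blast
    then have "t \<epsilon> j A \<longleftrightarrow> v f = v g" unfolding v[OF f] v[OF g] using vK[OF f] by auto
    then show ?thesis unfolding z.ult_eq_iff using large[OF A] by blast
  qed
  have surj: "\<exists>f. z.fn f \<and> y = v f" if "y \<in> K" for y using gen[OF that] v by blast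
  \<comment> \<open>An isomorphism between transitive classes is the identity. The argument runs
    along membership modulo \<open>Z\<close> on the domain of an attempt: a minimal function whose
    collapse differs from \<open>v\<close> has the same elements on both sides.\<close>
  have cls: "z.cls f = v f" if f: "z.fn f" for f
  proof (rule ccontr)
    assume ne: "z.cls f \<noteq> v f"
    obtain D h where Dh: "collapse_attempt M Z D h" "f \<in> ext M D" using z.attempt_ex[OF f f] by blast
    note At = z.attemptD[OF Dh(1)]
    define S where "S = {d \<in> ext M D. app M h d \<noteq> v d}"
    have "is_set S"
    \<comment> \<open>\<open>v\<close> evaluates \<open>j d\<close> inside \<open>K\<close>, yet the
      set of disagreements has to be defined over \<open>M\<close>: \<open>j d\<close> enters
      through its definable graph, and \<open>maps_to\<close> is absolute between \<open>K\<close>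
      and \<open>M\<close>.\<close>
    proof (rule is_set_sub[OF is_set_ext[OF At(1)], where P = "\<lambda>N d. \<exists>y\<in>N. maps_to N h d y \<and>
        (\<exists>w\<in>N. w = j d \<and> \<not> maps_to N w t y)"])
      show "DM (\<lambda>N s. \<exists>y\<in>N. maps_to N h (s 0) y \<and> (\<exists>w\<in>N. w = j (s 0) \<and> \<not> maps_to N w t y))"
        by (intro dfn_intros jt tM is_fun_in[OF At(2)])
      fix d
      show "d \<in> S \<longleftrightarrow> d \<in> ext M D \<and> (\<exists>y\<in>M. maps_to M h d y \<and> (\<exists>w\<in>M. w = j d \<and> \<not> maps_to M w t y))"
      proof (cases "d \<in> ext M D")
        case True
        have "j d \<in> K" "j d \<in> M" using jK KM ext_in[OF True] by auto
        then show ?thesis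
          unfolding S_def maps_to_iff[OF At(2)] using True app_in[OF At(2) True]
            maps_to_abs[OF tr, of "j d"] v[OF At(3)[OF True]] by auto
      qed (auto simp: S_def)
    qed
    moreover have "f \<in> S" using ne Dh(2) z.cls_eq[OF Dh] unfolding S_def by simp
    ultimately obtain d where d: "d \<in> S" and min: "\<And>e. e \<in> S \<Longrightarrow> \<not> ult_mem M Z e d"
      using z.ult_mem_wf[of S] At(3) unfolding S_def by blast
    then have dD: "d \<in> ext M D" "app M h d \<noteq> v d" unfolding S_def by auto
    note fd = At(3)[OF dD(1)]
    have hv: "app M h e = v e" if "e \<in> ext M D" "ult_mem M Z e d" for e using min that unfolding S_def by blast
    have "ext M (app M h d) = ext M (v d)"
    proof
      show "ext M (app M h d) \<subseteq> ext M (v d)"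
      proof
        fix y assume "y \<in> ext M (app M h d)"
        then obtain e where e: "e \<in> ext M D" "ult_mem M Z e d" "y = app M h e" unfolding At(5)[OF dD(1)] by blast
        then have "y = v e" using hv by blast
        then show "y \<in> ext M (v d)"
          using v_mem[OF At(3)[OF e(1)] fd] e(2) vK[OF At(3)[OF e(1)]] KM unfolding ext_def by blast
      qed
      show "ext M (v d) \<subseteq> ext M (app M h d)"
      proof
        fix y assume y: "y \<in> ext M (v d)"
        then have "y \<in> K" using tr vK[OF fd] unfolding transitive_in_def by blast
        then obtain e' where e': "z.fn e'" "y = v e'" using surj by blast
        then have "ult_mem M Z e' d" using y v_mem[OF e'(1) fd] unfolding ext_def by blast
        then obtain e where e: "e \<in> ext M D" "ult_eq M Z e e'" using At(4)[OF dD(1) e'(1)] by blast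
        have "v e = y" using v_eq[OF At(3)[OF e(1)] e'(1)] e(2) e'(2) by blast
        moreover have "ult_mem M Z e d"
          using v_mem[OF At(3)[OF e(1)] fd] y calculation unfolding ext_def by blast
        ultimately show "y \<in> ext M (app M h d)" using hv[OF e(1)] e(1) unfolding At(5)[OF dD(1)] by force
      qed
    qed
    then have "app M h d = v d" by (rule ext_inject[OF app_in[OF At(2) dD(1)] subsetD[OF KM vK[OF fd]]])
    then show False using dD(2) by blast
  qed
  have "y \<in> Ult M Z \<longleftrightarrow> y \<in> K" for y unfolding z.K_iff using cls surj[of y] vK by metis
  then have "Ult M Z = K" by blast
  moreover have "ult_emb M Z a = j a" if a: "a \<in> M" for a
  proof -
    note c = z.const(1)[OF a]
    have "\<forall>x\<in>ext M B. maps_to M (z.const a) x a" using z.const(2)[OF a] app_maps[OF c] by auto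
    moreover have "dfn ZFCs {} (\<lambda>N s. \<forall>x\<in>ext N (s 0). maps_to N (s 1) x (s 2))" by (intro dfn_intros)
    ultimately have "\<forall>x\<in>ext K (j B). maps_to K (j (z.const a)) x (j a)"
      using el4[where R = "\<lambda>N b c a _. \<forall>x\<in>ext N b. maps_to N c x a" and a = B and b = "z.const a" and c = a and d = a]
        B a is_fun_in[OF c] by blast
    then have "j a = v (z.const a)" using tB v[OF c] by blast
    then show ?thesis unfolding z.emb_eq cls[OF c] by simp
  qed
  moreover have "cc_ultrafilter M Z" using z.U unfolding cc_ultrafilter_def by blast
  ultimately show ?thesis using Z by blast
qed

end

context ultrafilter_model
begin

section \<open>Composition of ultrapowers\<close>

lemma transitive_K: "transitive_in K M"
  unfolding transitive_in_def using K_subset K_transitive by blast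

lemma emb_dfn4:
  assumes R: "dfn ZFCs {} (\<lambda>N s. R N (s 0) (s 1) (s 2) (s 3))" and "a \<in> M" "b \<in> M" "c \<in> M" "d \<in> M"
  shows "R K (emb a) (emb b) (emb c) (emb d) \<longleftrightarrow> R M a b c d"
  using emb_dfn[OF R _ _, of "\<lambda>n. if n = 0 then a else if n = 1 then b else if n = 2 then c else d"]
    assms(2-) ZFC_M ZFC_K by auto

text \<open>Identifies the image of omega with the omega of the ultrapower, so that
  \<open>emb_omega\<close> can be applied a second time, inside \<open>K\<close>.\<close>

lemma emb_omega_eq: "emb (omega M) = omega K"
proof -
  have "dfn ZFCs {} (\<lambda>N s. ext N (s 0) = {n \<in> N. natural N n})" by (intro dfn_intros)
  then have "ext K (emb (omega M)) = {n \<in> K. natural K n}"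
    using emb_dfn4[where R = "\<lambda>N w _ _ _. ext N w = {n \<in> N. natural N n}" and a = "omega M" and b = X and c = X and d = X]
      omega_in X_in omega_unique[OF ZFC_M] by blast
  then show ?thesis using omega_unique[OF ZFC_K] emb_in[OF omega_in] by blast
qed

lemma seed_mem: "seed M U \<epsilon> emb X"
  unfolding seed_eq emb_eq cls_mem_iff[OF idf(1) const(1)[OF X_in]] ult_mem_iff
  using large_X by (simp add: idf(2) const(2)[OF X_in] ext_def cong: conj_cong)

text \<open>The representation of an element of the ultrapower as \<open>j(f)\<close> at the seed.
  It is Los's theorem for the constant function with value \<open>f\<close>, the identity and
  \<open>f\<close>: at each \<open>x\<close> the formula says that \<open>f\<close> maps
  \<open>x\<close> to \<open>f(x)\<close>.\<close>

lemma emb_app_seed: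
  assumes f: "fn f" shows "maps_to K (emb f) (seed M U) (cls f)"
proof -
  define F where "F n = (if n = 0 then const f else if n = 1 then idf else f)" for n :: nat
  have F: "fn (F n)" for n using f idf(1) const(1)[OF is_fun_in[OF f]] unfolding F_def by simp
  have "{x \<in> ext M X. maps_to M (app M (F 0) x) (app M (F 1) x) (app M (F 2) x)} = ext M X"
    unfolding F_def using idf(2) const(2)[OF is_fun_in[OF f]] app_maps[OF f] by auto
  moreover have "dfn UNIV {} (\<lambda>N s. maps_to N (s 0) (s 1) (s 2))" by (intro dfn_intros)
  ultimately have "maps_to K (cls (F 0)) (cls (F 1)) (cls (F 2))"
    using los_dfn[of UNIV "\<lambda>N s. maps_to N (s 0) (s 1) (s 2)" F] F large_X by simp
  then show ?thesis unfolding F_def emb_eq seed_eq by simp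
qed

text \<open>
  The composite embedding is generated by the pair \<open>t\<close> of the image of the seed of \<open>U\<close> and the seed
  of \<open>W\<close>, which lies in the image of \<open>B = X \<times> C\<close>, where \<open>C\<close> is large enough to cover \<open>Y\<close>.
\<close>

theorem ultrapower_composition:
  assumes W: "cc_ultrafilter K W"
  shows "\<exists>Z\<in>M. cc_ultrafilter M Z \<and> Ult M Z = Ult K W \<and> (\<forall>a\<in>M. ult_emb M Z a = ult_emb K W (emb a))"
proof -
  interpret k: zfc_model E K by (rule K_model)
  obtain Y where "ultrafilter_model E K W Y" using cc_model[OF ZFC_K W] .
  then interpret w: ultrafilter_model E K W Y .
  interpret l: zfc_model E "Ult K W" by (rule w.K_model)
  let ?L = "Ult K W" and ?j = "\<lambda>a. ult_emb K W (emb a)" and ?s = "seed M U"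
  have cc: "cc_ultrafilter M U" using U unfolding cc_ultrafilter_def by blast
  have W_in: "W \<in> K" "W \<in> M" using w.U_in K_subset by auto
  have inner: "inner_cc M U W" unfolding inner_cc_def using cc W W_in by blast
  have trL: "transitive_in ?L M" by (rule transitive_in_trans[OF w.transitive_K transitive_K])
  have jL: "?j a \<in> ?L" if "a \<in> M" for a using w.emb_in[OF emb_in[OF that]] .
  have el: "R ?L (\<lambda>n. ?j (s n)) \<longleftrightarrow> R M s" if R: "dfn ZFCs {} R" and s: "range s \<subseteq> M" for R s
  proof -
    have "range (\<lambda>n. emb (s n)) \<subseteq> K" using s emb_in by blast
    from w.emb_dfn[OF R _ _ this] emb_dfn[OF R _ _ s] show ?thesis
      using ZFC_M ZFC_K w.ZFC_K by simp
  qed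
  have el4: "R ?L (?j a) (?j b) (?j c) (?j d) \<longleftrightarrow> R M a b c d"
    if R: "dfn ZFCs {} (\<lambda>N s. R N (s 0) (s 1) (s 2) (s 3))" and "a \<in> M" "b \<in> M" "c \<in> M" "d \<in> M"
    for R :: "'a set \<Rightarrow> 'a \<Rightarrow> 'a \<Rightarrow> 'a \<Rightarrow> 'a \<Rightarrow> bool" and a b c d
    using el[OF R, of "\<lambda>n. if n = 0 then a else if n = 1 then b else if n = 2 then c else d"] that by auto
  \<comment> \<open>The composite is definable over \<open>M\<close> although its second factor is
    formed in \<open>K\<close>: \<open>inner_emb\<close> describes it with \<open>U\<close> and
    \<open>W\<close> as parameters.\<close>
  have gr: "DM (\<lambda>N s. s 1 = ?j (s 0))"
  proof -
    have "DM (\<lambda>N s. \<exists>b\<in>N. is_emb N U (s 0) b \<and> inner_emb N U W b (s 1))"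
      by (intro dfn_intros dfn_inner_emb U_in W_in) (use ZFC_M in simp)
    then show ?thesis
    proof (rule dfn_cong)
      fix N and s :: "nat \<Rightarrow> 'a" assume "N \<in> {M}" "range s \<subseteq> N"
      then have N: "N = M" "s 0 \<in> M" by auto
      show "(s 1 = ?j (s 0)) = (\<exists>b\<in>N. is_emb N U (s 0) b \<and> inner_emb N U W b (s 1))"
        unfolding N(1) Bex_def inner_emb_iff(1)[OF ZFC_M inner N(2)] by simp
    qed
  qed
  \<comment> \<open>Neither factor adds new naturals: an element below the image of omega is the
    image of a natural of \<open>K\<close>, and that in turn is the image of a natural of
    \<open>M\<close>.\<close>
  have om: "\<exists>n\<in>ext M (omega M). m = ?j n" if m: "m \<in> ?L" "m \<epsilon> ?j (omega M)" for m
  proof -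
    obtain n' where n': "n' \<in> ext K (omega K)" "m = ult_emb K W n'"
      using w.emb_omega m unfolding emb_omega_eq by blast
    then have "n' \<in> K" "n' \<epsilon> emb (omega M)" unfolding emb_omega_eq ext_def by auto
    then show ?thesis using emb_omega n'(2) by blast
  qed
  \<comment> \<open>\<open>Y\<close> is only an element of \<open>K\<close>. It is represented by a
    function \<open>y\<close> in \<open>M\<close>, and the union \<open>C\<close> of the values of
    \<open>y\<close> has an image in \<open>K\<close> that includes \<open>Y\<close>; this gives a
    set in \<open>M\<close> whose image contains the second seed.\<close>
  obtain y where y: "fn y" "Y = cls y" using w.X_in K_iff by blast
  obtain C where C: "C \<in> M" "ext M C = (\<Union>v\<in>app M y ` ext M X. ext M v)"
    using is_set_Union[OF is_set_range[OF y(1) X_in]] by (rule is_setE)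
  obtain B where B: "B \<in> M" "ext M B = {p \<in> M. \<exists>x\<in>ext M X. \<exists>c\<in>ext M C. is_opair M p x c}"
    using is_set_prod[OF is_set_ext[OF X_in] is_set_ext[OF C(1)]] by (rule is_setE)
  have sX: "?s \<in> ext K (emb X)" using seed_in seed_mem unfolding ext_def by blast
  have "dfn ZFCs {} (\<lambda>N s. \<forall>u\<in>ext N (s 0). \<forall>v\<in>N. maps_to N (s 1) u v \<longrightarrow> ext N v \<subseteq> ext N (s 2))" by (intro dfn_intros)
  moreover have "\<forall>u\<in>ext M X. \<forall>v\<in>M. maps_to M y u v \<longrightarrow> ext M v \<subseteq> ext M C"
    unfolding C(2) maps_to_iff[OF y(1)] by blast
  ultimately have "\<forall>u\<in>ext K (emb X). \<forall>v\<in>K. maps_to K (emb y) u v \<longrightarrow> ext K v \<subseteq> ext K (emb C)"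
    using emb_dfn4[where R = "\<lambda>N x y c _. \<forall>u\<in>ext N x. \<forall>v\<in>N. maps_to N y u v \<longrightarrow> ext N v \<subseteq> ext N c"
        and a = X and b = y and c = C and d = C] X_in C(1) is_fun_in[OF y(1)] by blast
  then have YC: "ext K Y \<subseteq> ext K (emb C)" using sX w.X_in emb_app_seed[OF y(1)] y(2) by blast
  have "ext ?L (w.emb Y) \<subseteq> ext ?L (?j C)"
    using w.emb_dfn4[where R = "\<lambda>N a b _ _. ext N a \<subseteq> ext N b" and a = Y and b = "emb C" and c = Y and d = Y]
      YC w.X_in emb_in[OF C(1)] by (simp add: dfn_intros)
  then have sC: "seed K W \<in> ext ?L (?j C)" using w.seed_mem w.seed_in unfolding ext_def by blast
  have sX': "w.emb ?s \<in> ext ?L (?j X)"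
    using w.emb_dfn4[where R = "\<lambda>N a b _ _. a \<epsilon> b" and a = ?s and b = "emb X" and c = Y and d = Y]
      seed_mem w.emb_in[OF seed_in] w.X_in emb_in[OF X_in] seed_in by (simp add: dfn_intros l.in_ext_iff)
  obtain t where t: "t \<in> ?L" "is_opair ?L t (w.emb ?s) (seed K W)"
    using l.opair_ex[OF w.emb_in[OF seed_in] w.seed_in] by blast
  have "dfn ZFCs {} (\<lambda>N s. \<forall>p\<in>N. \<forall>u\<in>ext N (s 0). \<forall>v\<in>ext N (s 1). is_opair N p u v \<longrightarrow> p \<epsilon> s 2)" by (intro dfn_intros)
  moreover have "\<forall>p\<in>M. \<forall>u\<in>ext M X. \<forall>v\<in>ext M C. is_opair M p u v \<longrightarrow> p \<epsilon> B"
    using B(2) in_ext_iff[of _ B] by blast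
  ultimately have "\<forall>p\<in>?L. \<forall>u\<in>ext ?L (?j X). \<forall>v\<in>ext ?L (?j C). is_opair ?L p u v \<longrightarrow> p \<epsilon> ?j B"
    using el4[where R = "\<lambda>N x c b _. \<forall>p\<in>N. \<forall>u\<in>ext N x. \<forall>v\<in>ext N c. is_opair N p u v \<longrightarrow> p \<epsilon> b"
        and a = X and b = C and c = B and d = B] X_in C(1) B(1) by blast
  then have tB: "t \<epsilon> ?j B" using t sX' sC by blast
  have gen: "\<exists>f. is_fun M f B \<and> maps_to ?L (?j f) t z" if z: "z \<in> ?L" for z
  proof -
    obtain F where F: "is_fun K F Y" "z = w.cls F" using z w.K_iff by blast
    have FK: "F \<in> K" using k.is_fun_in[OF F(1)] .
    obtain \<phi> where \<phi>: "fn \<phi>" "F = cls \<phi>" using FK K_iff by blast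
    note \<phi>M = is_fun_in[OF \<phi>(1)]
    \<comment> \<open>\<open>\<phi>\<close> represents \<open>F\<close>, and the intended
      \<open>f\<close> sends the pair of \<open>x\<close> and \<open>c\<close> to
      \<open>\<phi>(x)(c)\<close>. Since \<open>\<phi>(x)\<close> may fail to have a value at
      \<open>c\<close>, the requirement is conditional on a value existing, which leaves
      \<open>f\<close> arbitrary elsewhere.\<close>
    let ?P = "\<lambda>N p v. \<forall>x\<in>N. \<forall>c\<in>N. \<forall>G\<in>N. is_opair N p x c \<and> maps_to N \<phi> x G \<and> (\<exists>v'\<in>N. maps_to N G c v') \<longrightarrow> maps_to N G c v"
    have "\<exists>f. is_fun M f B \<and> (\<forall>p\<in>ext M B. ?P M p (app M f p))"
    proof (rule choice_fun[OF B(1), where Q = ?P])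
      show "DM (\<lambda>N s. ?P N (s 0) (s 1))" by (intro dfn_intros \<phi>M)
      fix p assume "p \<in> ext M B"
      show "\<exists>v\<in>M. ?P M p v"
      proof (cases "\<exists>x c G v'. is_opair M p x c \<and> maps_to M \<phi> x G \<and> maps_to M G c v'")
        case True
        then obtain x c G v' where v': "is_opair M p x c" "maps_to M \<phi> x G" "maps_to M G c v'" by blast
        have "?P M p v'"
        proof (intro ballI impI, elim conjE)
          fix x' c' G' assume *: "is_opair M p x' c'" "maps_to M \<phi> x' G'"
          have "x' = x" "c' = c" using opair_inject[OF *(1) v'(1)] by auto
          moreover from this have "G' = G" using *(2) v'(2) maps_to_iff[OF \<phi>(1)] by simp
          ultimately show "maps_to M G' c' v'" using v'(3) by simp
        qed
        then show ?thesis using maps_to_in[OF v'(3)] by blast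
      next
        case False
        then show ?thesis using B(1) by blast
      qed
    qed
    then obtain f where f: "is_fun M f B" "\<forall>p\<in>ext M B. ?P M p (app M f p)" by blast
    let ?R = "\<lambda>N b f \<phi> _. \<forall>p\<in>ext N b. \<forall>v\<in>N. \<forall>x\<in>N. \<forall>c\<in>N. \<forall>G\<in>N. maps_to N f p v \<and>
      is_opair N p x c \<and> maps_to N \<phi> x G \<and> (\<exists>v'\<in>N. maps_to N G c v') \<longrightarrow> maps_to N G c v"
    have "?R M B f \<phi> B" using f(2) unfolding maps_to_iff[OF f(1)] by blast
    moreover have "dfn ZFCs {} (\<lambda>N s. ?R N (s 0) (s 1) (s 2) (s 3))" by (intro dfn_intros)
    ultimately have R: "?R ?L (?j B) (?j f) (?j \<phi>) (?j B)"
      using el4[where R = ?R and a = B and b = f and c = \<phi> and d = B] B(1) is_fun_in[OF f(1)] \<phi>M by blast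
    have jf: "is_fun ?L (?j f) (?j B)"
      using el4[where R = "\<lambda>N f b _ _. is_fun N f b" and a = f and b = B and c = B and d = B] B(1) f(1) is_fun_in[OF f(1)]
      by (simp add: dfn_intros)
    have tB': "t \<in> ext ?L (?j B)" using t(1) tB unfolding ext_def by blast
    have 1: "maps_to ?L (?j \<phi>) (w.emb ?s) (w.emb F)"
      using w.emb_dfn4[where R = "\<lambda>N f x y _. maps_to N f x y" and a = "emb \<phi>" and b = ?s and c = F and d = F]
        emb_app_seed[OF \<phi>(1)] \<phi>(2) emb_in[OF \<phi>M] seed_in FK by (simp add: dfn_intros)
    have 2: "maps_to ?L (w.emb F) (seed K W) z" using w.emb_app_seed[OF F(1)] F(2) by blast
    have 3: "is_fun ?L (w.emb F) (w.emb Y)"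
      using w.emb_dfn4[where R = "\<lambda>N f x _ _. is_fun N f x" and a = F and b = Y and c = Y and d = Y] F(1) FK w.X_in
      by (simp add: dfn_intros)
    \<comment> \<open>The property of \<open>f\<close>, transferred to the final model, is applied
      to the pair \<open>t\<close>: its components are the image of the first seed, where the image
      of \<open>\<phi>\<close> takes the value \<open>w.emb F\<close>, and the second seed, where
      \<open>w.emb F\<close> takes the value \<open>z\<close>.\<close>
    have "maps_to ?L (w.emb F) (seed K W) (app ?L (?j f) t)"
      using R tB' l.app_maps[OF jf tB'] l.app_in[OF jf tB'] w.emb_in[OF seed_in] w.seed_in w.emb_in[OF FK] t(2) 1 2 z
      by blast
    then have "app ?L (?j f) t = z" using 2 unfolding l.maps_to_iff[OF 3] by simp
    then show ?thesis using l.app_maps[OF jf tB'] f(1) by blast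
  qed
  show ?thesis
    by (rule derived_ultrapower[OF w.ZFC_K trL jL el gr om B(1) t(1) tB gen])
qed

lemma emb_finset_le: "a \<in> M \<Longrightarrow> b \<in> M \<Longrightarrow> finset_le M a b \<Longrightarrow> finset_le K (emb a) (emb b)"
  using emb_dfn4[where R = "\<lambda>N a b _ _. finset_le N a b" and a = a and b = b and c = X and d = X] X_in
  by (simp add: dfn_finset_le tm_var)

lemma emb_ordinal_set: "a \<in> M \<Longrightarrow> ordinal_set M a \<Longrightarrow> ordinal_set K (emb a)"
  using emb_dfn4[where R = "\<lambda>N a _ _ _. ordinal_set N a" and a = a and b = X and c = X and d = X] X_in
  by (simp add: dfn_ordinal_set tm_var)

text \<open>Los's theorem for the identity function, whose class is the seed.\<close>

lemma seed_ordinal_set: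
  assumes "\<And>x. x \<in> ext M X \<Longrightarrow> ordinal_set M x" shows "ordinal_set K (seed M U)"
proof -
  have "{x \<in> ext M X. ordinal_set M (app M idf x)} = ext M X" using idf(2) assms by auto
  then show ?thesis
    using los_dfn[of UNIV "\<lambda>N s. ordinal_set N (s 0)" "\<lambda>_. idf"] idf(1) large_X unfolding seed_eq
    by (simp add: dfn_ordinal_set tm_var)
qed

end

context zfc_model
begin

section \<open>Transitivity of the seed order\<close>

text \<open>A uniform ultrafilter lives on some \<open>[\<kappa>]^n\<close>, whose elements are sets
  of ordinals; hence its seed is a set of ordinals in the ultrapower.\<close>

lemma uniform_model:
  assumes "uniform_ultrafilter M U"
  obtains X where "ultrafilter_model E M U X" "ordinal_set (Ult M U) (seed M U)"
proof -
  obtain \<kappa> n S where S: "ordinal M \<kappa>" "is_nsubsets M \<kappa> n S" "cc_ultrafilter_on M U S"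
    using assms unfolding uniform_ultrafilter_def by blast
  interpret u: ultrafilter_model E M U S using S(3) by unfold_locales
  have "ext M x \<subseteq> ext M \<kappa>" if "x \<in> ext M S" for x using that S(2) unfolding is_nsubsets_def by blast
  then have "ordinal_set M x" if "x \<in> ext M S" for x
    using that ordinal_elem[OF S(1)] unfolding ordinal_set_def by blast
  then have "ordinal_set (Ult M U) (seed M U)" by (rule u.seed_ordinal_set)
  then show thesis using that u.ultrafilter_model_axioms by blast
qed

theorem seed_le_trans:
  assumes UA: "ultrapower_axiom M"
    and u: "uniform_ultrafilter M U0" "uniform_ultrafilter M U1" "uniform_ultrafilter M U2"
    and le: "seed_le M U0 U1" "seed_le M U1 U2"
  shows "seed_le M U0 U2"
proof -
  obtain X0 where "ultrafilter_model E M U0 X0" and o0: "ordinal_set (Ult M U0) (seed M U0)"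
    using uniform_model[OF u(1)] .
  then interpret m0: ultrafilter_model E M U0 X0 by simp
  obtain X1 where "ultrafilter_model E M U1 X1" and o1: "ordinal_set (Ult M U1) (seed M U1)"
    using uniform_model[OF u(2)] .
  then interpret m1: ultrafilter_model E M U1 X1 by simp
  obtain X2 where "ultrafilter_model E M U2 X2" and o2: "ordinal_set (Ult M U2) (seed M U2)"
    using uniform_model[OF u(3)] .
  then interpret m2: ultrafilter_model E M U2 X2 by simp
  obtain W0 W1 where c1: "comparison M U0 U1 W0 W1"
    and le1: "finset_le M (ult_emb (Ult M U0) W0 (seed M U0)) (ult_emb (Ult M U1) W1 (seed M U1))"
    using le(1) unfolding seed_le_def by blast
  obtain W1' W2 where c2: "comparison M U1 U2 W1' W2"
    and le2: "finset_le M (ult_emb (Ult M U1) W1' (seed M U1)) (ult_emb (Ult M U2) W2 (seed M U2))"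
    using le(2) unfolding seed_le_def by blast
  have "W1 \<in> Ult M U1" "cc_ultrafilter (Ult M U1) W1" "W1' \<in> Ult M U1" "cc_ultrafilter (Ult M U1) W1'"
    using c1 c2 unfolding comparison_def by auto
  then obtain Z Z' where c3: "comparison (Ult M U1) W1 W1' Z Z'"
    using m1.ultrapower_axiom_K[OF UA] unfolding ultrapower_axiom_def by blast
  note c1 = c1[unfolded comparison_def] and c2 = c2[unfolded comparison_def] and c3 = c3[unfolded comparison_def]
  obtain Y0 where "ultrafilter_model E (Ult M U0) W0 Y0" using cc_model[OF m0.ZFC_K] c1 by blast
  then interpret w0: ultrafilter_model E "Ult M U0" W0 Y0 .
  obtain Y1 where "ultrafilter_model E (Ult M U1) W1 Y1" using cc_model[OF m1.ZFC_K] c1 by blast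
  then interpret w1: ultrafilter_model E "Ult M U1" W1 Y1 .
  obtain Y1' where "ultrafilter_model E (Ult M U1) W1' Y1'" using cc_model[OF m1.ZFC_K] c2 by blast
  then interpret w1': ultrafilter_model E "Ult M U1" W1' Y1' .
  obtain Y2 where "ultrafilter_model E (Ult M U2) W2 Y2" using cc_model[OF m2.ZFC_K] c2 by blast
  then interpret w2: ultrafilter_model E "Ult M U2" W2 Y2 .
  have eq1: "Ult (Ult M U0) W0 = Ult (Ult M U1) W1" and eq2: "Ult (Ult M U1) W1' = Ult (Ult M U2) W2"
    and eq3: "Ult (Ult (Ult M U1) W1) Z = Ult (Ult (Ult M U1) W1') Z'"
    using c1 c2 c3 by auto
  let ?N = "Ult (Ult M U1) W1" and ?N' = "Ult (Ult M U1) W1'"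
  obtain T where "ultrafilter_model E ?N Z T" using cc_model[OF w1.ZFC_K] c3 by blast
  then interpret z: ultrafilter_model E ?N Z T .
  obtain T' where "ultrafilter_model E ?N' Z' T'" using cc_model[OF w1'.ZFC_K] c3 by blast
  then interpret z': ultrafilter_model E ?N' Z' T' .
  \<comment> \<open>\<open>Z\<close> is an ultrafilter of the common ultrapower by \<open>W0\<close>
    and \<open>W1\<close>. Rewriting with \<open>eq1\<close> regards it as internal to the
    ultrapower of \<open>Ult M U0\<close> by \<open>W0\<close>, so composition is carried out on the
    side of \<open>U0\<close>; the next step does the same on the side of \<open>U2\<close>.\<close>
  obtain Z0 where Z0: "Z0 \<in> Ult M U0" "cc_ultrafilter (Ult M U0) Z0" "Ult (Ult M U0) Z0 = Ult ?N Z"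
    "\<And>a. a \<in> Ult M U0 \<Longrightarrow> ult_emb (Ult M U0) Z0 a = ult_emb ?N Z (ult_emb (Ult M U0) W0 a)"
    using w0.ultrapower_composition[of Z] c3 unfolding eq1 by blast
  obtain Z2 where Z2: "Z2 \<in> Ult M U2" "cc_ultrafilter (Ult M U2) Z2" "Ult (Ult M U2) Z2 = Ult ?N' Z'"
    "\<And>a. a \<in> Ult M U2 \<Longrightarrow> ult_emb (Ult M U2) Z2 a = ult_emb ?N' Z' (ult_emb (Ult M U2) W2 a)"
    using w2.ultrapower_composition[of Z'] c3 unfolding eq2[symmetric] by blast
  have commute: "ult_emb ?N Z (ult_emb (Ult M U1) W1 b) = ult_emb ?N' Z' (ult_emb (Ult M U1) W1' b)"
    if "b \<in> Ult M U1" for b using c3 that by blast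
  have "ult_emb (Ult M U0) Z0 (ult_emb M U0 a) = ult_emb (Ult M U2) Z2 (ult_emb M U2 a)" if a: "a \<in> M" for a
  proof -
    have "ult_emb (Ult M U0) Z0 (ult_emb M U0 a) = ult_emb ?N Z (ult_emb (Ult M U1) W1 (ult_emb M U1 a))"
      using Z0(4)[OF m0.emb_in[OF a]] c1 a by auto
    also have "\<dots> = ult_emb ?N' Z' (ult_emb (Ult M U1) W1' (ult_emb M U1 a))"
      by (rule commute[OF m1.emb_in[OF a]])
    also have "\<dots> = ult_emb (Ult M U2) Z2 (ult_emb M U2 a)"
      using Z2(4)[OF m2.emb_in[OF a]] c2 a by auto
    finally show ?thesis .
  qed
  then have comp: "comparison M U0 U2 Z0 Z2"
    unfolding comparison_def using Z0 Z2 eq3 by simp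
  let ?s0 = "ult_emb (Ult M U0) W0 (seed M U0)" and ?s1 = "ult_emb (Ult M U1) W1 (seed M U1)"
    and ?s1' = "ult_emb (Ult M U1) W1' (seed M U1)" and ?s2 = "ult_emb (Ult M U2) W2 (seed M U2)"
  have s_in: "?s0 \<in> ?N" "?s1 \<in> ?N" "?s1' \<in> ?N'" "?s2 \<in> ?N'"
    using w0.emb_in[OF m0.seed_in] w1.emb_in[OF m1.seed_in] w1'.emb_in[OF m1.seed_in] w2.emb_in[OF m2.seed_in] eq1 eq2
    by auto
  have trN: "transitive_in ?N M" "transitive_in ?N' M"
    using transitive_in_trans w1.transitive_K w1'.transitive_K m1.transitive_K by blast+
  have trZ: "transitive_in (Ult ?N Z) M"
    using transitive_in_trans z.transitive_K trN by blast
  have o: "ordinal_set ?N ?s0" "ordinal_set ?N ?s1" "ordinal_set ?N' ?s2"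
    using w0.emb_ordinal_set[OF m0.seed_in o0] w1.emb_ordinal_set[OF m1.seed_in o1]
      w2.emb_ordinal_set[OF m2.seed_in o2] eq1 eq2 by auto
  let ?a = "ult_emb ?N Z ?s0" and ?b = "ult_emb ?N Z ?s1" and ?c = "ult_emb ?N' Z' ?s2"
  have b: "?b = ult_emb ?N' Z' ?s1'" by (rule commute[OF m1.seed_in])
  have abc_in: "?a \<in> Ult ?N Z" "?b \<in> Ult ?N Z" "?c \<in> Ult ?N Z"
    using z.emb_in s_in z'.emb_in eq3 by auto
  have "ordinal_set (Ult ?N Z) ?a" "ordinal_set (Ult ?N Z) ?b" "ordinal_set (Ult ?N Z) ?c"
    using z.emb_ordinal_set s_in o z'.emb_ordinal_set eq3 by auto
  then have o_abc: "ordinal_set M ?a" "ordinal_set M ?b" "ordinal_set M ?c"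
    using ordinal_set_abs[OF trZ] abc_in by auto
  \<comment> \<open>The given inequality is evaluated in \<open>M\<close>, while the embedding by
    \<open>Z\<close> is elementary on \<open>?N\<close>. So it is read in \<open>?N\<close>, pushed
    into the ultrapower by \<open>Z\<close>, and read in \<open>M\<close> again; both readings agree
    because the classes are transitive.\<close>
  have "finset_le ?N ?s0 ?s1" using le1 finset_le_abs[OF trN(1)] s_in by blast
  then have "finset_le (Ult ?N Z) ?a ?b" by (rule z.emb_finset_le[OF s_in(1,2)])
  then have ab: "finset_le M ?a ?b" using finset_le_abs[OF trZ] abc_in by blast
  have "finset_le ?N' ?s1' ?s2" using le2 finset_le_abs[OF trN(2)] s_in by blast
  then have "finset_le (Ult ?N' Z') (ult_emb ?N' Z' ?s1') ?c" by (rule z'.emb_finset_le[OF s_in(3,4)])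
  then have bc: "finset_le M ?b ?c" using finset_le_abs[OF trZ] abc_in b eq3 by metis
  have "finset_le M ?a ?c" by (rule finset_le_trans[OF o_abc ab bc])
  then show ?thesis
    unfolding seed_le_def using comp Z0(4)[OF m0.seed_in] Z2(4)[OF m2.seed_in] by metis
qed

end

theorem theorem3p5:
  fixes V :: "'v set" and mem :: "'v \<Rightarrow> 'v \<Rightarrow> bool"
  assumes "set_structure.ZFC mem V"
    and "set_structure.ultrapower_axiom mem V"
  shows "\<forall>U0\<in>V. \<forall>U1\<in>V. \<forall>U2\<in>V.
           set_structure.uniform_ultrafilter mem V U0 \<longrightarrow>
           set_structure.uniform_ultrafilter mem V U1 \<longrightarrow>
           set_structure.uniform_ultrafilter mem V U2 \<longrightarrow>
           set_structure.seed_le mem V U0 U1 \<longrightarrow>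
           set_structure.seed_le mem V U1 U2 \<longrightarrow>
           set_structure.seed_le mem V U0 U2"
proof -
  interpret zfc_model mem V using assms(1) by unfold_locales
  show ?thesis using seed_le_trans[OF assms(2)] by blast
qed

end
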